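(* Let $X$ be a compact tropical space, let $\tau\in H^1(X;\mathcal W_1)$, and let $X_{\epsilon\tau}$ be the deformation of $X$ obtained by precomposing the overlap maps of $X$ with the translations by $\epsilon\tau_{\alpha\beta}$, where $(\tau_{\alpha\beta})$ is a Čech cocycle representing $\tau$. Then for all sufficiently small $\epsilon>0$, $X_{\epsilon\tau}$ is a tropical space.
   Context: **Tropical spaces.** $\mathbb T=[-\infty,\infty)$. For $I\subset\{1,\dots,N\}$ put $\mathbb T_I^\circ=\{y\in\mathbb T^N: y_i=-\infty \iff i\in I\}\cong\mathbb R^{N-|I|}$ and let $\mathbb T_I$ be its closure. An integral affine map $\mathbb T^N\dashrightarrow\mathbb T^M$ is the extension by continuity (wherever it exists) of an affine map $\mathbb R^N\to\mathbb R^M$ with integral linear part. A convex polyhedral domain $D\subset\mathbb T^N$ is a finite intersection of half-spaces $\{jx\le a\}$, $j\in\mathbb Z^N$, $a\in\mathbb R$; its mobile faces $E$ are its intersections with boundaries $\{jx=a\}$ of some defining half-spaces; the sets $E\cap\mathbb T_I$ are its faces, of sedentarity $|I|$ and refined sedentarity $I$, and $E$ is the parent of $E\cap \mathbb T_I$. $D$ is regular at infinity if each $D\cap\mathbb T_I^\circ$ is empty or a polyhedral domain of dimension $\dim D-|I|$. An $n$-dimensional polyhedral complex $Y\subset\mathbb T^N$ is a finite union of $n$-dimensional domains (facets) such that the intersection of any collection of facets is a face of each of them; all complexes are assumed regular at infinity. $Y$ is balanced if for each $(n-1)$-dimensional mobile face $E$ with adjacent facets $D_1,\dots,D_l$ one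 has $\sum_k\epsilon_k=0$, where $\epsilon_k$ is the outward primitive integer vector of the image of $D_k$ in the quotient of $\mathbb R^N$ by the linear space parallel to $E\cap\mathbb R^N$. A tropical space is a topological space $X$ with a finite cover by open sets $U_\alpha$ and open embeddings (charts) $\phi_\alpha:U_\alpha\to Y_\alpha\subset\mathbb T^{N_\alpha}$ into balanced polyhedral complexes, with overlap maps induced by integral affine maps $\psi_{\alpha\beta}:\mathbb T^{N_\alpha}\dashrightarrow\mathbb T^{N_\beta}$, such that (finite type) if $x_j\in U_\alpha$ and $\phi_\alpha(x_j)\to y\in\mathbb T^{N_\alpha}$ then either $x_j$ converges in $X$ or some coordinate is $-\infty$ at $y$ but finite on $\phi_\alpha(U_\alpha)$. **Wave tangent spaces and the sheaf $\mathcal W_1$.** For $y$ of refined sedentarity $I$ in $Y\subset\mathbb T^N$, let $\Sigma(y)\subset\mathbb T_I^\circ\cong\mathbb R^{N-|I|}$ be the cone of vectors $u$ with $y+\epsilon u\in Y\cap\mathbb T_I^\circ$ for small $\epsilon>0$, and $W'(y)$ the intersection of all maximal linear subspaces contained in $\Sigma(y)$. $W(y)=W'(y_m)$ for $y_m$ in the relative interior of the parent of the face containing $y$ in its relative interior. Combinatorial strata of $X$ are classes of points connected by paths along which $\dim W$ and the sedentarity are constant. Within a chart $W$ is canonically constant along strata, and if the stratum of $x$ lies in the closure of that of $y$ there is an inclusion $W(x)\to W(y)$. These data define a constructible sheaf $\mathcal W_1$: on a connected open $U$ inside a chart its sections are the compatible collections of elements of $W$ at the components of intersections of strata with $U$ (concretely,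 vectors parallel to all mobile strata in $U$). **Construction of $X_{\epsilon\tau}$.** $X$ is the quotient of $\bigsqcup_\alpha\phi_\alpha(U_\alpha)$ by the equivalence relation identifying points corresponding under the $\psi_{\alpha\beta}$, where $\psi_{\alpha\beta}=\psi_{\beta\alpha}^{-1}$ and $\psi_{\beta\gamma}\circ\psi_{\alpha\beta}=\psi_{\alpha\gamma}$. The finite covering $\{U_\alpha\}$ is chosen so fine that $\tau$ is represented by a Čech $1$-cocycle $\tau_{\alpha\beta}\in W(U_\alpha\cap U_\beta)$, that all $U_\alpha$ and $U_\alpha\cap U_\beta$ are connected, and (after shrinking) that there are slightly larger open sets $V_\alpha\supset\overline{U_\alpha}$ containing no strata other than those already met by $U_\alpha$. Via $\phi_\alpha$, $W(U_\alpha\cap U_\beta)$ is a subspace of $\mathbb R^{N_\alpha}$. For $\epsilon>0$ let $\psi^{\epsilon\tau}_{\alpha\beta}$ be $\psi_{\alpha\beta}$ precomposed with the translation of $\mathbb T^{N_\alpha}$ by $\epsilon\tau_{\alpha\beta}$. As $\tau$ is a cocycle these maps again satisfy $\psi^{\epsilon\tau}_{\alpha\beta}=(\psi^{\epsilon\tau}_{\beta\alpha})^{-1}$ and the composition rule, and $X_{\epsilon\tau}$ is the quotient of $\bigsqcup_\alpha\phi_\alpha(U_\alpha)$ by the equivalence relation they define, with charts given by the $\phi_\alpha(U_\alpha)\subset Y_\alpha$.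
   Formalization: The larger sets V_α must carry the same charts and overlap maps; the condition of no new strata is required for all intersections of the V_α, not only single ones; and sections of W_1 over U_α∩U_β must remain sections over V_α∩V_β. Without this the claim can fail for some covers. *)

theory Defs
  imports "HOL-Analysis.Analysis" "HOL-Library.Function_Algebras"
begin

section \<open>Vectors and points\<close>

text \<open>
  The charts of one space live in ambient spaces of different dimensions \<open>N\<close>, so the
  dimension is a number and not a type.  A vector of \<open>\<real>\<^sup>N\<close> is a function
  \<open>nat \<Rightarrow> real\<close> vanishing from index \<open>N\<close> on, and a point of \<open>\<T>\<^sup>N\<close> is a function
  \<open>nat \<Rightarrow> ereal\<close> avoiding \<open>\<infinity>\<close> below \<open>N\<close> and equal to \<open>0\<close> from \<open>N\<close> on.  The topology of
  \<open>\<T>\<^sup>N\<close> is the one induced by the library's product topology on \<open>nat \<Rightarrow> ereal\<close>.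
\<close>

definition rscale :: "real \<Rightarrow> (nat \<Rightarrow> real) \<Rightarrow> nat \<Rightarrow> real" where
  "rscale c v = (\<lambda>i. c * v i)"

global_interpretation rv: vector_space rscale
  by unfold_locales (auto simp: rscale_def algebra_simps fun_eq_iff)

definition RN :: "nat \<Rightarrow> (nat \<Rightarrow> real) set" where
  "RN N = {v. \<forall>i\<ge>N. v i = 0}"

definition TN :: "nat \<Rightarrow> (nat \<Rightarrow> ereal) set" where
  "TN N = {x. (\<forall>i<N. x i \<noteq> \<infinity>) \<and> (\<forall>i\<ge>N. x i = 0)}"

definition sedentarity :: "nat \<Rightarrow> (nat \<Rightarrow> ereal) \<Rightarrow> nat set" where
  "sedentarity N x = {i. i < N \<and> x i = -\<infinity>}"

definition TI_open :: "nat \<Rightarrow> nat set \<Rightarrow> (nat \<Rightarrow> ereal) set" where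
  "TI_open N I = {x \<in> TN N. \<forall>i<N. x i = -\<infinity> \<longleftrightarrow> i \<in> I}"

(* the closure of TI_open N I in TN N, for I a subset of {..<N} *)
definition TI_closed :: "nat \<Rightarrow> nat set \<Rightarrow> (nat \<Rightarrow> ereal) set" where
  "TI_closed N I = {x \<in> TN N. \<forall>i\<in>I. x i = -\<infinity>}"

(* -\<infinity> is sent to 0, so this identifies TI_open N I with the vectors of RN N vanishing on I *)
definition realpart :: "(nat \<Rightarrow> ereal) \<Rightarrow> nat \<Rightarrow> real" where
  "realpart x = (\<lambda>i. real_of_ereal (x i))"

definition translate :: "(nat \<Rightarrow> ereal) \<Rightarrow> (nat \<Rightarrow> real) \<Rightarrow> nat \<Rightarrow> ereal" where
  "translate x v = (\<lambda>i. x i + ereal (v i))"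


section \<open>Integral affine maps\<close>

text \<open>A pair \<open>(A, b)\<close> stands for \<open>x \<mapsto> A x + b\<close>; entries outside the relevant \<open>M \<times> N\<close> range are
  ignored.\<close>

type_synonym int_affine = "(nat \<Rightarrow> nat \<Rightarrow> int) \<times> (nat \<Rightarrow> real)"

definition linear_part :: "nat \<Rightarrow> nat \<Rightarrow> int_affine \<Rightarrow> (nat \<Rightarrow> real) \<Rightarrow> nat \<Rightarrow> real" where
  "linear_part N M f v = (\<lambda>i. if i < M then (\<Sum>j<N. of_int (fst f i j) * v j) else 0)"

definition affine_value :: "nat \<Rightarrow> nat \<Rightarrow> int_affine \<Rightarrow> (nat \<Rightarrow> ereal) \<Rightarrow> nat \<Rightarrow> ereal" where
  "affine_value N M f x =
     (\<lambda>i. if i < M then ereal (linear_part N M f (realpart x) i + snd f i) else 0)"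

(* The partial map from TN N to TN M given by f, as a relation: "f is defined at x with value y",
   where f has been extended from the finite points by continuity.  The filter is not
   "at x within", so that finite x are included also for N = 0. *)
definition maps_to :: "nat \<Rightarrow> nat \<Rightarrow> int_affine \<Rightarrow> (nat \<Rightarrow> ereal) \<Rightarrow> (nat \<Rightarrow> ereal) \<Rightarrow> bool" where
  "maps_to N M f x y \<longleftrightarrow> x \<in> TN N \<and> y \<in> TN M \<and>
     (affine_value N M f \<longlongrightarrow> y) (inf (nhds x) (principal (TI_open N {})))"

definition precompose_translation :: "nat \<Rightarrow> nat \<Rightarrow> int_affine \<Rightarrow> (nat \<Rightarrow> real) \<Rightarrow> int_affine" where
  "precompose_translation N M f v = (fst f, \<lambda>i. linear_part N M f v i + snd f i)"


section \<open>Polyhedral domains and their faces\<close>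

text \<open>
  On \<open>\<T>\<^sup>N\<close> the inequality \<open>j x \<le> a\<close> is read with the terms of negative coefficient moved to the
  right-hand side, so that both sides lie in \<open>[-\<infinity>, \<infinity>)\<close>.  The solution set is the closure in
  \<open>\<T>\<^sup>N\<close> of the half-space of \<open>\<real>\<^sup>N\<close>; likewise for the boundary \<open>j x = a\<close>.
\<close>

definition pos_terms :: "nat \<Rightarrow> (nat \<Rightarrow> int) \<Rightarrow> (nat \<Rightarrow> ereal) \<Rightarrow> ereal" where
  "pos_terms N j x = (\<Sum>i<N. ereal (of_int (max (j i) 0)) * x i)"

definition half_space :: "nat \<Rightarrow> (nat \<Rightarrow> int) \<times> real \<Rightarrow> (nat \<Rightarrow> ereal) set" where
  "half_space N h = {x \<in> TN N. pos_terms N (fst h) x \<le> ereal (snd h) + pos_terms N (- fst h) x}"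

definition half_space_bd :: "nat \<Rightarrow> (nat \<Rightarrow> int) \<times> real \<Rightarrow> (nat \<Rightarrow> ereal) set" where
  "half_space_bd N h = {x \<in> TN N. pos_terms N (fst h) x = ereal (snd h) + pos_terms N (- fst h) x}"

definition polyhedral_domain :: "nat \<Rightarrow> (nat \<Rightarrow> ereal) set \<Rightarrow> bool" where
  "polyhedral_domain N D \<longleftrightarrow> (\<exists>H. finite H \<and> D = TN N \<inter> (\<Inter>h\<in>H. half_space N h))"

(* B = {} gives D itself; the empty set is allowed *)
definition mobile_face :: "nat \<Rightarrow> (nat \<Rightarrow> ereal) set \<Rightarrow> (nat \<Rightarrow> ereal) set \<Rightarrow> bool" where
  "mobile_face N D E \<longleftrightarrow> (\<exists>H B. finite H \<and> B \<subseteq> H \<and>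
     D = TN N \<inter> (\<Inter>h\<in>H. half_space N h) \<and> E = D \<inter> (\<Inter>h\<in>B. half_space_bd N h))"

definition face :: "nat \<Rightarrow> (nat \<Rightarrow> ereal) set \<Rightarrow> (nat \<Rightarrow> ereal) set \<Rightarrow> bool" where
  "face N D F \<longleftrightarrow> (\<exists>E I. mobile_face N D E \<and> I \<subseteq> {..<N} \<and> F = E \<inter> TI_closed N I)"

text \<open>The next three are applied to convex sets inside a single \<open>TI_open N I\<close>.\<close>

definition parallel_space :: "(nat \<Rightarrow> ereal) set \<Rightarrow> (nat \<Rightarrow> real) set" where
  "parallel_space S = rv.span {realpart x - realpart y | x y. x \<in> S \<and> y \<in> S}"

definition polyhedral_dim :: "(nat \<Rightarrow> ereal) set \<Rightarrow> nat" where
  "polyhedral_dim S = rv.dim (parallel_space S)"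

definition relative_interior :: "(nat \<Rightarrow> ereal) set \<Rightarrow> (nat \<Rightarrow> ereal) set" where
  "relative_interior S = {x \<in> S. \<exists>d>0. \<forall>v\<in>parallel_space S. (\<forall>i. \<bar>v i\<bar> < d) \<longrightarrow> translate x v \<in> S}"

(* D \<inter> TI_open N I is automatically empty or a polyhedral domain of TI_open N I,
   so only its dimension has to be prescribed *)
definition regular_at_infinity :: "nat \<Rightarrow> (nat \<Rightarrow> ereal) set \<Rightarrow> bool" where
  "regular_at_infinity N D \<longleftrightarrow> (\<forall>I\<subseteq>{..<N}. D \<inter> TI_open N I \<noteq> {} \<longrightarrow>
     D \<inter> TI_open N {} \<noteq> {} \<and>
     polyhedral_dim (D \<inter> TI_open N I) + card I = polyhedral_dim (D \<inter> TI_open N {}))"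


section \<open>Balanced polyhedral complexes\<close>

text \<open>
  A complex is given by its finite set of facets.  Regularity at infinity is imposed on all mobile
  faces (including the facets).  This is what makes the parent of a face unique: the facets
  \<open>x\<^sub>1 \<le> x\<^sub>2\<close> and \<open>x\<^sub>1 \<ge> x\<^sub>2\<close> of \<open>\<T>\<^sup>2\<close> are regular, their common edge is not, and all three meet
  the stratum of sedentarity 2 in the same point.
\<close>

definition polyhedral_complex :: "nat \<Rightarrow> nat \<Rightarrow> (nat \<Rightarrow> ereal) set set \<Rightarrow> bool" where
  "polyhedral_complex N n \<F> \<longleftrightarrow> finite \<F> \<and>
     (\<forall>D\<in>\<F>. polyhedral_domain N D \<and> D \<inter> TI_open N {} \<noteq> {} \<and>
        polyhedral_dim (D \<inter> TI_open N {}) = n) \<and>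
     (\<forall>\<G>\<subseteq>\<F>. \<G> \<noteq> {} \<longrightarrow> (\<forall>D\<in>\<G>. face N D (\<Inter>\<G>))) \<and>
     (\<forall>D\<in>\<F>. \<forall>E. mobile_face N D E \<longrightarrow> regular_at_infinity N E)"

definition integer_vector :: "nat \<Rightarrow> (nat \<Rightarrow> real) \<Rightarrow> bool" where
  "integer_vector N u \<longleftrightarrow> u \<in> RN N \<and> (\<forall>i. u i \<in> \<int>)"

(* u represents the outward primitive integer vector of the image of D in RN N / L, L being
   parallel to the codimension-1 face E: E maps to a single point p of the quotient, and the
   image of D contains a point p + t [u] with t > 0.  Taking w = 0 shows that u is not in L. *)
definition outward_primitive ::
    "nat \<Rightarrow> (nat \<Rightarrow> ereal) set \<Rightarrow> (nat \<Rightarrow> ereal) set \<Rightarrow> (nat \<Rightarrow> real) \<Rightarrow> bool" where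
  "outward_primitive N E D u \<longleftrightarrow>
     (let L = parallel_space (E \<inter> TI_open N {}) in
      integer_vector N u \<and>
      (\<exists>p \<in> E \<inter> TI_open N {}. \<exists>q \<in> D \<inter> TI_open N {}. \<exists>t>0. realpart q - realpart p - rscale t u \<in> L) \<and>
      (\<forall>m w. (2::nat) \<le> m \<and> integer_vector N w \<longrightarrow> u - rscale (real m) w \<notin> L))"

definition balanced :: "nat \<Rightarrow> nat \<Rightarrow> (nat \<Rightarrow> ereal) set set \<Rightarrow> bool" where
  "balanced N n \<F> \<longleftrightarrow>
     (\<forall>D\<in>\<F>. \<forall>E. mobile_face N D E \<and> E \<inter> TI_open N {} \<noteq> {} \<and>
          polyhedral_dim (E \<inter> TI_open N {}) + 1 = n \<longrightarrow>
        (\<exists>e. (\<forall>D'\<in>{D'\<in>\<F>. mobile_face N D' E}. outward_primitive N E D' (e D')) \<and>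
             (\<Sum>D'\<in>{D'\<in>\<F>. mobile_face N D' E}. e D') \<in> parallel_space (E \<inter> TI_open N {})))"


section \<open>Wave tangent spaces\<close>

definition tangent_cone :: "nat \<Rightarrow> (nat \<Rightarrow> ereal) set \<Rightarrow> (nat \<Rightarrow> ereal) \<Rightarrow> (nat \<Rightarrow> real) set" where
  "tangent_cone N Y y = {u \<in> RN N. (\<forall>i\<in>sedentarity N y. u i = 0) \<and>
     (\<forall>\<^sub>F \<epsilon> in at_right 0. translate y (rscale \<epsilon> u) \<in> Y)}"

definition wave_mobile :: "nat \<Rightarrow> (nat \<Rightarrow> ereal) set \<Rightarrow> (nat \<Rightarrow> ereal) \<Rightarrow> (nat \<Rightarrow> real) set" where
  "wave_mobile N Y y = \<Inter>{L. rv.subspace L \<and> L \<subseteq> tangent_cone N Y y \<and>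
     (\<forall>L'. rv.subspace L' \<and> L' \<subseteq> tangent_cone N Y y \<and> L \<subseteq> L' \<longrightarrow> L' = L)}"

(* z is in the relative interior of the parent E of the face having y in its relative interior *)
definition mobile_representative ::
    "nat \<Rightarrow> (nat \<Rightarrow> ereal) set set \<Rightarrow> (nat \<Rightarrow> ereal) \<Rightarrow> (nat \<Rightarrow> ereal) \<Rightarrow> bool" where
  "mobile_representative N \<F> y z \<longleftrightarrow> (\<exists>D\<in>\<F>. \<exists>E. mobile_face N D E \<and>
     y \<in> relative_interior (E \<inter> TI_open N (sedentarity N y)) \<and>
     z \<in> relative_interior (E \<inter> TI_open N {}))"

(* independent of the choice: the parent is unique and wave_mobile is constant along its interior *)
definition wave_space :: "nat \<Rightarrow> (nat \<Rightarrow> ereal) set set \<Rightarrow> (nat \<Rightarrow> ereal) \<Rightarrow> (nat \<Rightarrow> real) set" where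
  "wave_space N \<F> y = wave_mobile N (\<Union>\<F>) (SOME z. mobile_representative N \<F> y z)"


section \<open>Tropical spaces\<close>

record ('i, 'x) atlas =
  index :: "'i set"
  patch :: "'i \<Rightarrow> 'x set"
  ambient :: "'i \<Rightarrow> nat"
  facets :: "'i \<Rightarrow> (nat \<Rightarrow> ereal) set set"
  chart :: "'i \<Rightarrow> 'x \<Rightarrow> nat \<Rightarrow> ereal"
  overlap :: "'i \<Rightarrow> 'i \<Rightarrow> int_affine"

definition tropical_charts :: "'x topology \<Rightarrow> ('i, 'x) atlas \<Rightarrow> bool" where
  "tropical_charts X \<A> \<longleftrightarrow>
     finite (index \<A>) \<and>
     (\<forall>\<alpha>\<in>index \<A>. openin X (patch \<A> \<alpha>)) \<and>
     (\<Union>\<alpha>\<in>index \<A>. patch \<A> \<alpha>) = topspace X \<and>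
     (\<forall>\<alpha>\<in>index \<A>. \<exists>n. polyhedral_complex (ambient \<A> \<alpha>) n (facets \<A> \<alpha>) \<and>
        balanced (ambient \<A> \<alpha>) n (facets \<A> \<alpha>)) \<and>
     (\<forall>\<alpha>\<in>index \<A>.
        embedding_map (subtopology X (patch \<A> \<alpha>)) (top_of_set (\<Union>(facets \<A> \<alpha>))) (chart \<A> \<alpha>) \<and>
        open_map (subtopology X (patch \<A> \<alpha>)) (top_of_set (\<Union>(facets \<A> \<alpha>))) (chart \<A> \<alpha>)) \<and>
     (\<forall>\<alpha>\<in>index \<A>. \<forall>\<beta>\<in>index \<A>. \<forall>x \<in> patch \<A> \<alpha> \<inter> patch \<A> \<beta>.
        maps_to (ambient \<A> \<alpha>) (ambient \<A> \<beta>) (overlap \<A> \<alpha> \<beta>) (chart \<A> \<alpha> x) (chart \<A> \<beta> x))"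

definition finite_type :: "'x topology \<Rightarrow> ('i, 'x) atlas \<Rightarrow> bool" where
  "finite_type X \<A> \<longleftrightarrow>
     (\<forall>\<alpha>\<in>index \<A>. \<forall>s :: nat \<Rightarrow> 'x. \<forall>y \<in> TN (ambient \<A> \<alpha>).
        range s \<subseteq> patch \<A> \<alpha> \<and> (\<lambda>k. chart \<A> \<alpha> (s k)) \<longlonglongrightarrow> y \<longrightarrow>
        (\<exists>l. limitin X s l sequentially) \<or>
        (\<exists>i<ambient \<A> \<alpha>. y i = -\<infinity> \<and> (\<forall>x\<in>patch \<A> \<alpha>. chart \<A> \<alpha> x i \<noteq> -\<infinity>)))"

definition tropical_space :: "'x topology \<Rightarrow> ('i, 'x) atlas \<Rightarrow> bool" where
  "tropical_space X \<A> \<longleftrightarrow> tropical_charts X \<A> \<and> finite_type X \<A>"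


section \<open>Combinatorial strata and the sheaf of wave tangent spaces\<close>

definition wave_at :: "('i, 'x) atlas \<Rightarrow> 'i \<Rightarrow> 'x \<Rightarrow> (nat \<Rightarrow> real) set" where
  "wave_at \<A> \<alpha> x = wave_space (ambient \<A> \<alpha>) (facets \<A> \<alpha>) (chart \<A> \<alpha> x)"

(* dim W and the sedentarity do not depend on the chart in which they are computed *)
definition same_stratum :: "'x topology \<Rightarrow> ('i, 'x) atlas \<Rightarrow> 'x \<Rightarrow> 'x \<Rightarrow> bool" where
  "same_stratum X \<A> x y \<longleftrightarrow> (\<exists>g d k. pathin X g \<and> g 0 = x \<and> g 1 = y \<and>
     (\<forall>t\<in>{0..1}. \<exists>\<alpha>\<in>index \<A>. g t \<in> patch \<A> \<alpha> \<and>
        rv.dim (wave_at \<A> \<alpha> (g t)) = d \<and>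
        card (sedentarity (ambient \<A> \<alpha>) (chart \<A> \<alpha> (g t))) = k))"

definition strata :: "'x topology \<Rightarrow> ('i, 'x) atlas \<Rightarrow> 'x set set" where
  "strata X \<A> = (\<lambda>x. {y. same_stratum X \<A> x y}) ` topspace X"

definition strata_in :: "'x topology \<Rightarrow> ('i, 'x) atlas \<Rightarrow> 'x set \<Rightarrow> 'x set set" where
  "strata_in X \<A> G = (\<Union>S\<in>strata X \<A>. connected_components_of (subtopology X (S \<inter> G)))"

(* Sections over a connected open subset G of the patch \<alpha>, read in the chart \<alpha>: there all the
   transition inclusions between wave spaces are inclusions of subspaces of RN N, so that a
   compatible collection is one single vector. *)
definition wave_sections :: "('i, 'x) atlas \<Rightarrow> 'i \<Rightarrow> 'x set \<Rightarrow> (nat \<Rightarrow> real) set" where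
  "wave_sections \<A> \<alpha> G = {v \<in> RN (ambient \<A> \<alpha>). (\<forall>x\<in>G. v \<in> wave_at \<A> \<alpha> x) \<and> (G = {} \<longrightarrow> v = 0)}"

text \<open>
  Cech cochains for the cover by patches: \<open>c \<alpha> \<beta>\<close> is written in the chart \<open>\<alpha>\<close>, and a section
  written in the chart \<open>\<beta>\<close> is carried to the chart \<open>\<alpha>\<close> by the differential of the overlap map.
\<close>

definition wave_transport :: "('i, 'x) atlas \<Rightarrow> 'i \<Rightarrow> 'i \<Rightarrow> (nat \<Rightarrow> real) \<Rightarrow> nat \<Rightarrow> real" where
  "wave_transport \<A> \<beta> \<alpha> = linear_part (ambient \<A> \<beta>) (ambient \<A> \<alpha>) (overlap \<A> \<beta> \<alpha>)"

definition wave_cocycle :: "('i, 'x) atlas \<Rightarrow> ('i \<Rightarrow> 'i \<Rightarrow> nat \<Rightarrow> real) \<Rightarrow> bool" where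
  "wave_cocycle \<A> c \<longleftrightarrow>
     (\<forall>\<alpha>\<in>index \<A>. \<forall>\<beta>\<in>index \<A>. c \<alpha> \<beta> \<in> wave_sections \<A> \<alpha> (patch \<A> \<alpha> \<inter> patch \<A> \<beta>)) \<and>
     (\<forall>\<alpha>\<in>index \<A>. \<forall>\<beta>\<in>index \<A>. \<forall>\<gamma>\<in>index \<A>. patch \<A> \<alpha> \<inter> patch \<A> \<beta> \<inter> patch \<A> \<gamma> \<noteq> {} \<longrightarrow>
        c \<alpha> \<gamma> = c \<alpha> \<beta> + wave_transport \<A> \<beta> \<alpha> (c \<beta> \<gamma>))"

definition wave_cohomologous ::
    "('i, 'x) atlas \<Rightarrow> ('i \<Rightarrow> 'i \<Rightarrow> nat \<Rightarrow> real) \<Rightarrow> ('i \<Rightarrow> 'i \<Rightarrow> nat \<Rightarrow> real) \<Rightarrow> bool" where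
  "wave_cohomologous \<A> c c' \<longleftrightarrow>
     (\<exists>s. (\<forall>\<alpha>\<in>index \<A>. s \<alpha> \<in> wave_sections \<A> \<alpha> (patch \<A> \<alpha>)) \<and>
        (\<forall>\<alpha>\<in>index \<A>. \<forall>\<beta>\<in>index \<A>. patch \<A> \<alpha> \<inter> patch \<A> \<beta> \<noteq> {} \<longrightarrow>
           c' \<alpha> \<beta> = c \<alpha> \<beta> + (wave_transport \<A> \<beta> \<alpha> (s \<beta>) - s \<alpha>)))"

(* The first cohomology of the given cover.  It embeds into that of X, with image the classes
   represented by a cocycle on this cover; its elements are the sets of all representatives. *)
definition wave_H1 :: "('i, 'x) atlas \<Rightarrow> ('i \<Rightarrow> 'i \<Rightarrow> nat \<Rightarrow> real) set set" where
  "wave_H1 \<A> = {c. wave_cocycle \<A> c} //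
     {(c, c'). wave_cocycle \<A> c \<and> wave_cocycle \<A> c' \<and> wave_cohomologous \<A> c c'}"


section \<open>The standing assumptions on the cover\<close>

definition connected_overlaps :: "'x topology \<Rightarrow> ('i, 'x) atlas \<Rightarrow> bool" where
  "connected_overlaps X \<A> \<longleftrightarrow>
     (\<forall>\<alpha>\<in>index \<A>. connectedin X (patch \<A> \<alpha>)) \<and>
     (\<forall>\<alpha>\<in>index \<A>. \<forall>\<beta>\<in>index \<A>. connectedin X (patch \<A> \<alpha> \<inter> patch \<A> \<beta>))"

text \<open>
  The patches \<open>U\<close> of \<open>\<A>\<close> are obtained from the patches \<open>V\<close> of an atlas with the same charts and
  overlap maps by a slight shrinking, under which no stratum is lost.  Strata in an open set \<open>G\<close>
  are the components of the intersections of strata with \<open>G\<close>, as in the definition of the sheaf.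

  The condition is required for all intersections of patches.  If
  \<open>V \<alpha> \<inter> V \<beta> \<inter> V \<gamma>\<close> were nonempty but \<open>U \<alpha> \<inter> U \<beta> \<inter> U \<gamma>\<close> empty, the cocycle condition would say
  nothing about points where the deformed patches may come to overlap.  Likewise, if
  \<open>U \<alpha> \<inter> U \<beta>\<close> could approach a stratum without meeting it, its sections could translate points
  across that stratum and out of the complex.

  The last clause says what the strata condition is for: no section of the sheaf over
  \<open>U \<alpha> \<inter> U \<beta>\<close> is created by the shrinking.  It follows from the strata condition where the wave
  spaces are constant along strata.  They are not at the vertex of a 1-dimensional fan with
  primitive rays \<open>e, -e, f\<^sub>1, f\<^sub>2, f\<^sub>3\<close>, where \<open>f\<^sub>1 + f\<^sub>2 + f\<^sub>3 = 0\<close> and no other two rays are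
  opposite: there the only maximal linear subspace is the line of \<open>e\<close>, so the vertex and all five
  rays make up one stratum.
\<close>

definition slightly_larger :: "'x topology \<Rightarrow> ('i, 'x) atlas \<Rightarrow> ('i \<Rightarrow> 'x set) \<Rightarrow> bool" where
  "slightly_larger X \<A> V \<longleftrightarrow>
     tropical_charts X (\<A>\<lparr>patch := V\<rparr>) \<and>
     (\<forall>\<alpha>\<in>index \<A>. X closure_of (patch \<A> \<alpha>) \<subseteq> V \<alpha>) \<and>
     (\<forall>B\<subseteq>index \<A>. B \<noteq> {} \<longrightarrow>
        (\<forall>C\<in>strata_in X \<A> (\<Inter>\<beta>\<in>B. V \<beta>). C \<inter> (\<Inter>\<beta>\<in>B. patch \<A> \<beta>) \<noteq> {})) \<and>
     (\<forall>\<alpha>\<in>index \<A>. \<forall>\<beta>\<in>index \<A>.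
        wave_sections \<A> \<alpha> (patch \<A> \<alpha> \<inter> patch \<A> \<beta>) \<subseteq> wave_sections \<A> \<alpha> (V \<alpha> \<inter> V \<beta>))"


section \<open>The deformed space\<close>

definition quotient_topology :: "'z topology \<Rightarrow> 'z rel \<Rightarrow> 'z set topology" where
  "quotient_topology Z R =
     topology (\<lambda>S. S \<subseteq> topspace Z // R \<and> openin Z {z \<in> topspace Z. R `` {z} \<in> S})"

lemma openin_quotient_topology:
  "openin (quotient_topology Z R) S \<longleftrightarrow>
     S \<subseteq> topspace Z // R \<and> openin Z {z \<in> topspace Z. R `` {z} \<in> S}"
proof -
  have 1: "{z \<in> topspace Z. R `` {z} \<in> S \<inter> T} =
      {z \<in> topspace Z. R `` {z} \<in> S} \<inter> {z \<in> topspace Z. R `` {z} \<in> T}" for S T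
    by auto
  have 2: "{z \<in> topspace Z. R `` {z} \<in> \<Union>K} = (\<Union>S\<in>K. {z \<in> topspace Z. R `` {z} \<in> S})" for K
    by auto
  have "istopology (\<lambda>S. S \<subseteq> topspace Z // R \<and> openin Z {z \<in> topspace Z. R `` {z} \<in> S})"
    unfolding istopology_def 1 2 by auto
  then show ?thesis
    by (simp add: quotient_topology_def)
qed

lemma topspace_quotient_topology: "topspace (quotient_topology Z R) = topspace Z // R"
proof -
  have "{z \<in> topspace Z. R `` {z} \<in> topspace Z // R} = topspace Z"
    by (auto simp: quotientI)
  then show ?thesis
    by (auto simp: topspace_def[of "quotient_topology Z R"] openin_quotient_topology)
qed

lemma quotient_map_quotient_topology:
  "quotient_map Z (quotient_topology Z R) (\<lambda>z. R `` {z})"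
  by (auto simp: quotient_map_def topspace_quotient_topology openin_quotient_topology
      quotient_def)

context
  fixes \<A> :: "('i, 'x) atlas" and c :: "'i \<Rightarrow> 'i \<Rightarrow> nat \<Rightarrow> real" and \<epsilon> :: real
begin

definition deformed_overlap :: "'i \<Rightarrow> 'i \<Rightarrow> int_affine" where
  "deformed_overlap \<alpha> \<beta> =
     precompose_translation (ambient \<A> \<alpha>) (ambient \<A> \<beta>) (overlap \<A> \<alpha> \<beta>) (rscale \<epsilon> (c \<alpha> \<beta>))"

definition chart_sum :: "('i \<times> (nat \<Rightarrow> ereal)) topology" where
  "chart_sum = sum_topology (\<lambda>\<alpha>. top_of_set (chart \<A> \<alpha> ` patch \<A> \<alpha>)) (index \<A>)"

(* The overlap map \<alpha> \<beta> of X has domain chart \<A> \<alpha> ` (patch \<A> \<alpha> \<inter> patch \<A> \<beta>), and not all points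
   where the affine map overlap \<A> \<alpha> \<beta> is defined; its precomposition with the translation has the
   translated domain. *)
definition deformed_gluing :: "('i \<times> (nat \<Rightarrow> ereal)) rel" where
  "deformed_gluing = {((\<alpha>, y), (\<beta>, z)) | \<alpha> y \<beta> z.
     (\<alpha>, y) \<in> topspace chart_sum \<and> (\<beta>, z) \<in> topspace chart_sum \<and>
     translate y (rscale \<epsilon> (c \<alpha> \<beta>)) \<in> chart \<A> \<alpha> ` (patch \<A> \<alpha> \<inter> patch \<A> \<beta>) \<and>
     maps_to (ambient \<A> \<alpha>) (ambient \<A> \<beta>) (deformed_overlap \<alpha> \<beta>) y z}"

(* the equivalence relation on the disjoint union generated by the gluing *)
definition deformed_equiv :: "('i \<times> (nat \<Rightarrow> ereal)) rel" where
  "deformed_equiv = Id_on (topspace chart_sum) \<union> (deformed_gluing \<union> deformed_gluing\<inverse>)\<^sup>+"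

definition deformed_space :: "('i \<times> (nat \<Rightarrow> ereal)) set topology" where
  "deformed_space = quotient_topology chart_sum deformed_equiv"

(* the charts invert the maps from chart \<A> \<alpha> ` patch \<A> \<alpha> to the quotient *)
definition deformed_atlas :: "('i, ('i \<times> (nat \<Rightarrow> ereal)) set) atlas" where
  "deformed_atlas =
     \<lparr>index = index \<A>,
      patch = (\<lambda>\<alpha>. (\<lambda>y. deformed_equiv `` {(\<alpha>, y)}) ` chart \<A> \<alpha> ` patch \<A> \<alpha>),
      ambient = ambient \<A>,
      facets = facets \<A>,
      chart = (\<lambda>\<alpha> q. THE y. y \<in> chart \<A> \<alpha> ` patch \<A> \<alpha> \<and> (\<alpha>, y) \<in> q),
      overlap = deformed_overlap\<rparr>"

end

end

theory Submission
  imports Defs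
begin

text \<open>
  Regularity of all mobile faces makes the direction space of a face at infinity, together with
  the directions going to infinity, fill up the direction space of the parent.  Hence a wave vector
  at the parent also moves the points at infinity inside the complex.  A point moved along a wave
  vector therefore stays in the complex as long as it stays in the region where the vector is a
  wave vector, and by compactness all points of the (thickened) overlaps can be moved for one
  common time.

  Moving by \<open>\<epsilon> c \<alpha> \<beta>\<close> in the chart \<open>\<alpha>\<close>, for points of the thickened patches, is an equivalence
  relation on the disjoint union of the patches by the cocycle condition, once \<open>\<epsilon>\<close> is so small that
  points moved twice by such vectors do not leave the thickened patches.  It is
  the relation generated by the gluing of the deformed overlap maps.  Its classes
  meet each patch in at most one point, and the saturation of an open set is open, so the patches
  embed as open sets.  A sequence in a patch that converges in the ambient space has its limit in
  the image of the closure of the patch, which is covered by the other patches.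
\<close>

section \<open>Half-spaces and sedentarity\<close>

text \<open>Two obstacles shape the proof. A wave vector moves each point inside the complex for
  some time, but nothing bounds this time from below near the point. The remedy: the times at which
  a line lies in the complex form a closed set, so the motion can always be resumed until the line
  leaves a fixed open region, and the time needed for that is locally bounded below. The other
  obstacle is that the gluing requires the moved point to lie in
  \<open>U \<alpha> \<inter> U \<beta>\<close>. Near the boundary of a patch a point may leave
  \<open>U \<alpha>\<close> when moved, so that this relation need not be symmetric or transitive.
  The relation \<open>glued\<close> therefore asks only for membership in the thickened patches. It
  is recovered from the gluing by two steps through a patch that contains every point one move away,
  found as with a Lebesgue number. Transitivity composes two moves, whence the iterated smallness
  condition. A move is a relation on \<open>X\<close> itself, read in a chart, so compactness of
  \<open>X\<close> makes the local bounds on \<open>e\<close> uniform.\<close>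

definition linear_form :: "nat \<Rightarrow> (nat \<Rightarrow> int) \<Rightarrow> (nat \<Rightarrow> real) \<Rightarrow> real" where
  "linear_form N j v = (\<Sum>i<N. of_int (j i) * v i)"

lemma linear_form_add: "linear_form N j (v + w) = linear_form N j v + linear_form N j w"
  by (simp add: linear_form_def algebra_simps sum.distrib)

lemma linear_form_diff: "linear_form N j (v - w) = linear_form N j v - linear_form N j w"
  by (simp add: linear_form_def algebra_simps sum_subtractf)

lemma linear_form_rscale: "linear_form N j (rscale r v) = r * linear_form N j v"
  by (simp add: linear_form_def rscale_def algebra_simps sum_distrib_left)

lemma linear_form_0: "linear_form N j 0 = 0"
  by (simp add: linear_form_def)

lemma subspace_linear_form: "rv.subspace {v. linear_form N j v = 0}"
  by (simp add: rv.subspace_def linear_form_add linear_form_rscale linear_form_0)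

lemma linear_form_cong: "(\<And>i. i < N \<Longrightarrow> j i \<noteq> 0 \<Longrightarrow> v i = w i) \<Longrightarrow> linear_form N j v = linear_form N j w"
  unfolding linear_form_def by (rule sum.cong) force+

lemma linear_form_bound:
  assumes "\<And>i. \<bar>v i\<bar> < d"
  shows "\<bar>linear_form N j v\<bar> \<le> d * (\<Sum>i<N. \<bar>of_int (j i)\<bar>)"
proof -
  have "\<bar>linear_form N j v\<bar> \<le> (\<Sum>i<N. \<bar>of_int (j i) * v i\<bar>)"
    unfolding linear_form_def by (rule sum_abs)
  also have "\<dots> \<le> (\<Sum>i<N. d * \<bar>of_int (j i)\<bar>)"
    using assms by (intro sum_mono) (auto simp: abs_mult mult.commute[of "\<bar>of_int _\<bar>"] less_imp_le intro!: mult_right_mono)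
  finally show ?thesis by (simp add: sum_distrib_left)
qed

lemma translate_0 [simp]: "translate x 0 = x"
  by (simp add: translate_def fun_eq_iff zero_ereal_def[symmetric])

lemma translate_translate: "translate (translate x v) w = translate x (v + w)"
  by (simp add: translate_def fun_eq_iff add.assoc)

lemma RN_rscale: "v \<in> RN N \<Longrightarrow> rscale a v \<in> RN N"
  by (simp add: RN_def rscale_def)

lemma RN_add: "v \<in> RN N \<Longrightarrow> w \<in> RN N \<Longrightarrow> v + w \<in> RN N"
  by (simp add: RN_def)

lemma RN_diff: "v \<in> RN N \<Longrightarrow> w \<in> RN N \<Longrightarrow> v - w \<in> RN N"
  by (simp add: RN_def)

lemma RN_0: "0 \<in> RN N"
  by (simp add: RN_def)

lemma subspace_RN: "rv.subspace (RN N)"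
  by (simp add: rv.subspace_def RN_0 RN_add RN_rscale)

lemma translate_TI_open:
  assumes "x \<in> TI_open N I" "v \<in> RN N"
  shows "translate x v \<in> TI_open N I"
proof -
  have "x i + ereal (v i) \<noteq> \<infinity>" "x i + ereal (v i) = -\<infinity> \<longleftrightarrow> i \<in> I" if "i < N" for i
    using assms(1) that by (cases "x i"; force simp: TI_open_def TN_def)+
  then show ?thesis
    using assms unfolding TI_open_def TN_def translate_def RN_def by auto
qed

lemma TI_open_sedentarity: "x \<in> TN N \<Longrightarrow> x \<in> TI_open N (sedentarity N x)"
  by (auto simp: TI_open_def sedentarity_def)

lemma sedentarity_subset: "sedentarity N x \<subseteq> {..<N}"
  by (auto simp: sedentarity_def)

lemma TI_open_TN: "x \<in> TI_open N I \<Longrightarrow> x \<in> TN N"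
  by (simp add: TI_open_def)

lemma realpart_RN: "x \<in> TN N \<Longrightarrow> realpart x \<in> RN N"
  by (simp add: RN_def TN_def realpart_def)

lemma realpart_translate:
  assumes "x \<in> TI_open N I" "i < N" "i \<notin> I"
  shows "realpart (translate x v) i = realpart x i + v i"
  using assms by (cases "x i") (auto simp: realpart_def translate_def TI_open_def TN_def)

text \<open>In sedentarity \<open>I\<close> the left side of the inequality
  \<open>j x \<le> a\<close> is minus infinity exactly if \<open>meets_pos I j\<close>, the right
  side exactly if \<open>meets_neg I j\<close>. If neither holds, \<open>j\<close> vanishes on
  \<open>I\<close> and the inequality is one of real numbers.\<close>

definition meets_pos :: "nat set \<Rightarrow> (nat \<Rightarrow> int) \<Rightarrow> bool" where
  "meets_pos I j \<longleftrightarrow> (\<exists>i\<in>I. j i > 0)"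

definition meets_neg :: "nat set \<Rightarrow> (nat \<Rightarrow> int) \<Rightarrow> bool" where
  "meets_neg I j \<longleftrightarrow> (\<exists>i\<in>I. j i < 0)"

lemma pos_terms_eq:
  assumes "x \<in> TI_open N I" "I \<subseteq> {..<N}"
  shows "pos_terms N j x = (if meets_pos I j then -\<infinity> else ereal (\<Sum>i<N. of_int (max (j i) 0) * realpart x i))"
proof (cases "meets_pos I j")
  case True
  then obtain k where k: "k \<in> I" "j k > 0" by (auto simp: meets_pos_def)
  let ?f = "\<lambda>i. ereal (of_int (max (j i) 0)) * x i"
  have "?f k = -\<infinity>" "k < N"
    using k assms by (auto simp: TI_open_def)
  moreover have "?f i \<noteq> \<infinity>" if "i < N" for i
  proof -
    have "x i \<noteq> \<infinity>" using assms that by (auto simp: TI_open_def TN_def)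
    then show ?thesis by (cases "x i"; cases "j i > 0") (auto simp: max_def)
  qed
  ultimately have "sum ?f {..<N} = -\<infinity>"
    by (subst sum.remove[of _ k]) (auto simp: sum_Pinfty)
  with True show ?thesis by (simp add: pos_terms_def)
next
  case False
  have "ereal (of_int (max (j i) 0)) * x i = ereal (of_int (max (j i) 0) * realpart x i)" if "i < N" for i
  proof (cases "i \<in> I")
    case True
    \<comment> \<open>A vanishing coefficient kills an infinite coordinate, since zero times minus
      infinity is zero.\<close>
    then have "max (j i) 0 = 0" using False by (force simp: meets_pos_def)
    then show ?thesis by (simp add: zero_ereal_def[symmetric])
  next
    case False
    then show ?thesis using assms that by (cases "x i") (auto simp: TI_open_def TN_def realpart_def)
  qed
  then have "pos_terms N j x = (\<Sum>i<N. ereal (of_int (max (j i) 0) * realpart x i))"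
    unfolding pos_terms_def by (intro sum.cong) auto
  with False show ?thesis by simp
qed

lemma pos_minus_neg:
  "(\<Sum>i<N. of_int (max (j i) 0) * v i) - (\<Sum>i<N. of_int (max ((- j) i) 0) * v i) = linear_form N j v"
  unfolding linear_form_def sum_subtractf[symmetric]
  by (rule sum.cong) (auto simp: max_def algebra_simps)

lemma meets_pos_uminus: "meets_pos I (- j) \<longleftrightarrow> meets_neg I j"
  by (simp add: meets_pos_def meets_neg_def)

text \<open>A left side of minus infinity satisfies the inequality whatever the right side; a finite
  left side violates it against minus infinity. For the boundary both sides have to be infinite, or
  neither.\<close>

lemma half_space_iff:
  assumes "x \<in> TI_open N I" "I \<subseteq> {..<N}"
  shows "x \<in> half_space N h \<longleftrightarrow> meets_pos I (fst h) \<or>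
     (\<not> meets_neg I (fst h) \<and> linear_form N (fst h) (realpart x) \<le> snd h)"
  using pos_minus_neg[of "fst h" "realpart x" N] TI_open_TN[OF assms(1)]
  unfolding half_space_def
  by (auto simp: pos_terms_eq[OF assms] meets_pos_uminus)

lemma half_space_bd_iff:
  assumes "x \<in> TI_open N I" "I \<subseteq> {..<N}"
  shows "x \<in> half_space_bd N h \<longleftrightarrow> meets_pos I (fst h) \<and> meets_neg I (fst h) \<or>
     (\<not> meets_pos I (fst h) \<and> \<not> meets_neg I (fst h) \<and> linear_form N (fst h) (realpart x) = snd h)"
  using pos_minus_neg[of "fst h" "realpart x" N] TI_open_TN[OF assms(1)]
  unfolding half_space_bd_def
  by (auto simp: pos_terms_eq[OF assms] meets_pos_uminus)

lemma half_space_bd_subset: "half_space_bd N h \<subseteq> half_space N h"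
  by (auto simp: half_space_bd_def half_space_def)

lemma not_meets_empty [simp]: "\<not> meets_pos {} j" "\<not> meets_neg {} j"
  by (simp_all add: meets_pos_def meets_neg_def)

lemma off_zero: "\<not> meets_pos I j \<Longrightarrow> \<not> meets_neg I j \<Longrightarrow> i \<in> I \<Longrightarrow> j i = 0"
  by (force simp: meets_pos_def meets_neg_def)

text \<open>\<open>realpart\<close> reads an infinite coordinate as 0 before and after the
  translation, so additivity holds only because \<open>j\<close> vanishes on
  \<open>I\<close>.\<close>

lemma linear_form_translate:
  assumes "x \<in> TI_open N I" "\<not> meets_pos I j" "\<not> meets_neg I j"
  shows "linear_form N j (realpart (translate x v)) = linear_form N j (realpart x) + linear_form N j v"
  unfolding linear_form_add[symmetric]
  using realpart_translate[OF assms(1)] off_zero[OF assms(2,3)]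
  by (intro linear_form_cong) auto

text \<open>The limit of \<open>x\<close> when its coordinates in \<open>I\<close> go to minus
  infinity: the projection of the finite part to the stratum of sedentarity
  \<open>I\<close>.\<close>

definition send_to_infinity :: "nat set \<Rightarrow> (nat \<Rightarrow> ereal) \<Rightarrow> nat \<Rightarrow> ereal" where
  "send_to_infinity I x = (\<lambda>i. if i \<in> I then -\<infinity> else x i)"

lemma send_to_infinity_TI_open:
  "x \<in> TI_open N {} \<Longrightarrow> I \<subseteq> {..<N} \<Longrightarrow> send_to_infinity I x \<in> TI_open N I"
  by (auto simp: TI_open_def TN_def send_to_infinity_def)

lemma realpart_send_to_infinity: "realpart (send_to_infinity I x) i = (if i \<in> I then 0 else realpart x i)"
  by (simp add: realpart_def send_to_infinity_def)

lemma linear_form_send_to_infinity: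
  assumes "\<not> meets_pos I j" "\<not> meets_neg I j"
  shows "linear_form N j (realpart (send_to_infinity I x)) = linear_form N j (realpart x)"
  by (intro linear_form_cong) (use off_zero[OF assms] in \<open>auto simp: realpart_send_to_infinity\<close>)

section \<open>Relative interiors and directions of faces\<close>

lemma parallel_space_RN: "S \<subseteq> TN N \<Longrightarrow> parallel_space S \<subseteq> RN N"
  unfolding parallel_space_def
  by (rule rv.span_minimal[OF _ subspace_RN]) (auto intro: RN_diff realpart_RN)

lemma parallel_space_diff: "x \<in> S \<Longrightarrow> y \<in> S \<Longrightarrow> realpart x - realpart y \<in> parallel_space S"
  unfolding parallel_space_def by (rule rv.span_base) auto

lemma parallel_space_linear_form:
  assumes "\<And>x. x \<in> S \<Longrightarrow> linear_form N j (realpart x) = a" "v \<in> parallel_space S"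
  shows "linear_form N j v = 0"
proof -
  have "parallel_space S \<subseteq> {v. linear_form N j v = 0}"
    unfolding parallel_space_def
    by (rule rv.span_minimal[OF _ subspace_linear_form]) (auto simp: linear_form_diff assms(1))
  then show ?thesis using assms(2) by auto
qed

text \<open>A linear form with its maximum at a relative interior point is constant: otherwise a
  small step from \<open>y\<close> away from a point \<open>x\<close> of smaller value would exceed
  the maximum.\<close>

lemma relative_interior_half_space_bd:
  assumes S: "S \<subseteq> TI_open N I" "I \<subseteq> {..<N}" and y: "y \<in> relative_interior S"
    and sub: "S \<subseteq> half_space N h" and bd: "y \<in> half_space_bd N h"
  shows "S \<subseteq> half_space_bd N h"
proof
  fix x assume x: "x \<in> S"
  let ?j = "fst h"
  have yS: "y \<in> S" using y by (simp add: relative_interior_def)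
  have xI: "x \<in> TI_open N I" and yI: "y \<in> TI_open N I" using S x yS by auto
  show "x \<in> half_space_bd N h"
  proof (cases "meets_pos I ?j")
    case True
    then show ?thesis using bd by (simp add: half_space_bd_iff[OF xI S(2)] half_space_bd_iff[OF yI S(2)])
  next
    case False
    then have n: "\<not> meets_neg I ?j" and la: "linear_form N ?j (realpart y) = snd h"
      using bd by (simp_all add: half_space_bd_iff[OF yI S(2)])
    have "linear_form N ?j (realpart x) \<le> snd h"
      using sub x False by (auto simp: half_space_iff[OF xI S(2)])
    moreover have "snd h \<le> linear_form N ?j (realpart x)"
    proof -
      obtain d where d: "d > 0" "\<And>v. v \<in> parallel_space S \<Longrightarrow> (\<forall>i. \<bar>v i\<bar> < d) \<Longrightarrow> translate y v \<in> S"
        using y by (auto simp: relative_interior_def)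
      define w where "w = realpart y - realpart x"
      have wR: "w \<in> RN N" using xI yI by (auto simp: w_def intro!: RN_diff realpart_RN TI_open_TN)
      \<comment> \<open>\<open>M\<close> strictly exceeds all entries of \<open>w\<close>, so
        \<open>d / M\<close> scales \<open>w\<close> into the box of size \<open>d\<close>; the
        summand 1 keeps \<open>M\<close> positive when \<open>w = 0\<close>.\<close>
      define M where "M = 1 + (\<Sum>i<N. \<bar>w i\<bar>)"
      have M: "\<bar>w i\<bar> < M" for i
      proof (cases "i < N")
        case True
        then have "\<bar>w i\<bar> \<le> (\<Sum>i<N. \<bar>w i\<bar>)" by (intro member_le_sum) auto
        then show ?thesis by (simp add: M_def)
      next
        case False
        then show ?thesis using wR by (simp add: RN_def M_def add_pos_nonneg sum_nonneg)
      qed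
      have M0: "M > 0" using M[of 0] by linarith
      define v where "v = rscale (d / M) w"
      have "\<bar>v i\<bar> < d" for i
        using M[of i] M0 d(1) by (simp add: v_def rscale_def abs_mult field_simps)
      moreover have "v \<in> parallel_space S"
        unfolding v_def w_def parallel_space_def
        by (intro rv.span_scale rv.span_base) (use x yS in auto)
      ultimately have tS: "translate y v \<in> S" using d by blast
      then have tI: "translate y v \<in> TI_open N I" using S by auto
      have "linear_form N ?j (realpart (translate y v)) \<le> snd h"
        using sub tS False by (auto simp: half_space_iff[OF tI S(2)])
      then have "linear_form N ?j v \<le> 0"
        using linear_form_translate[OF yI False n, of v] la by simp
      then have "linear_form N ?j w \<le> 0"
        using d(1) M0 by (simp add: v_def linear_form_rscale mult_le_0_iff divide_le_0_iff not_le)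
      then show ?thesis by (simp add: w_def linear_form_diff la)
    qed
    ultimately show ?thesis using False n by (simp add: half_space_bd_iff[OF xI S(2)])
  qed
qed

section \<open>Mobile faces presented by inequalities \<open>H\<close> and equalities
  \<open>B\<close>\<close>

definition polyhedron :: "nat \<Rightarrow> ((nat \<Rightarrow> int) \<times> real) set \<Rightarrow> ((nat \<Rightarrow> int) \<times> real) set \<Rightarrow> (nat \<Rightarrow> ereal) set" where
  "polyhedron N H B = TN N \<inter> (\<Inter>h\<in>H. half_space N h) \<inter> (\<Inter>h\<in>B. half_space_bd N h)"

lemma mobile_face_polyhedron: "mobile_face N D E \<longleftrightarrow> (\<exists>H B. finite H \<and> B \<subseteq> H \<and> D = polyhedron N H {} \<and> E = polyhedron N H B)"
  unfolding mobile_face_def polyhedron_def by auto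

text \<open>An inequality active at \<open>y\<close> is an equality on the whole set, so its form
  vanishes on all directions of the set. An inactive one either holds by an infinite left side,
  which no translation changes, or has slack that survives small translations.\<close>

lemma relative_interior_polyhedronI:
  assumes H: "finite H" "B \<subseteq> H" and I: "I \<subseteq> {..<N}"
    and y: "y \<in> polyhedron N H B \<inter> TI_open N I"
    and active: "\<And>h. h \<in> H \<Longrightarrow> y \<in> half_space_bd N h \<Longrightarrow> polyhedron N H B \<inter> TI_open N I \<subseteq> half_space_bd N h"
  shows "y \<in> relative_interior (polyhedron N H B \<inter> TI_open N I)"
proof -
  let ?S = "polyhedron N H B \<inter> TI_open N I"
  have yI: "y \<in> TI_open N I" using y by auto
  have P: "parallel_space ?S \<subseteq> RN N"
    by (rule parallel_space_RN) (auto simp: polyhedron_def)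
  have *: "\<forall>\<^sub>F d in at_right 0. \<forall>v\<in>parallel_space ?S. (\<forall>i. \<bar>v i\<bar> < d) \<longrightarrow>
      translate y v \<in> half_space N h \<and> (h \<in> B \<longrightarrow> translate y v \<in> half_space_bd N h)" if h: "h \<in> H" for h
  proof (cases "y \<in> half_space_bd N h")
    case True
    have "translate y v \<in> half_space_bd N h" if v: "v \<in> parallel_space ?S" for v
    proof -
      have tI: "translate y v \<in> TI_open N I" using yI v P by (intro translate_TI_open) auto
      show ?thesis
      proof (cases "meets_pos I (fst h)")
        case True2: True
        then show ?thesis using True
          by (simp add: half_space_bd_iff[OF tI I] half_space_bd_iff[OF yI I])
      next
        case False
        then have n: "\<not> meets_neg I (fst h)" and la: "linear_form N (fst h) (realpart y) = snd h"
          using True by (simp_all add: half_space_bd_iff[OF yI I])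
        have "linear_form N (fst h) v = 0"
        proof (rule parallel_space_linear_form[OF _ v])
          fix x assume x: "x \<in> ?S"
          then have "x \<in> half_space_bd N h" using active[OF h True] by auto
          then show "linear_form N (fst h) (realpart x) = snd h"
            using False x half_space_bd_iff[of x N I h] I by simp
        qed
        then show ?thesis
          by (simp add: half_space_bd_iff[OF tI I] linear_form_translate[OF yI False n] la False n)
      qed
    qed
    then show ?thesis using half_space_bd_subset by (intro always_eventually) blast
  next
    case False
    have hB: "h \<notin> B" using False y by (auto simp: polyhedron_def)
    have yh: "y \<in> half_space N h" using y h by (auto simp: polyhedron_def)
    show ?thesis
    proof (cases "meets_pos I (fst h)")
      case True
      have "translate y v \<in> half_space N h" if v: "v \<in> parallel_space ?S" for v
      proof -
        have tI: "translate y v \<in> TI_open N I" using yI v P by (intro translate_TI_open) auto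
        show ?thesis by (simp add: half_space_iff[OF tI I] True)
      qed
      then show ?thesis using hB by (intro always_eventually) blast
    next
      case p: False
      then have n: "\<not> meets_neg I (fst h)" and la: "linear_form N (fst h) (realpart y) < snd h"
        using yh False by (auto simp: half_space_iff[OF yI I] half_space_bd_iff[OF yI I])
      \<comment> \<open>The sum of the absolute coefficients bounds the form on the box of size
        \<open>d\<close> by \<open>d * s\<close>.\<close>
      define s where "s = (\<Sum>i<N. \<bar>real_of_int (fst h i)\<bar>)"
      have "((\<lambda>d. linear_form N (fst h) (realpart y) + d * s) \<longlongrightarrow> linear_form N (fst h) (realpart y) + 0 * s) (at_right 0)"
        by (intro tendsto_intros)
      then have "\<forall>\<^sub>F d in at_right 0. linear_form N (fst h) (realpart y) + d * s < snd h"
        by (rule order_tendstoD(2)) (use la in simp)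
      then show ?thesis
      proof eventually_elim
        case (elim d)
        show ?case
        proof (intro ballI impI conjI)
          fix v assume v: "v \<in> parallel_space ?S" "\<forall>i. \<bar>v i\<bar> < d"
          have tI: "translate y v \<in> TI_open N I" using yI v P by (intro translate_TI_open) auto
          have "\<bar>linear_form N (fst h) v\<bar> \<le> d * s" unfolding s_def using v by (intro linear_form_bound) auto
          then show "translate y v \<in> half_space N h"
            using elim by (simp add: half_space_iff[OF tI I] linear_form_translate[OF yI p n] p n)
        qed (use hB in auto)
      qed
    qed
  qed
  have "\<forall>\<^sub>F d in at_right 0. \<forall>h\<in>H. \<forall>v\<in>parallel_space ?S. (\<forall>i. \<bar>v i\<bar> < d) \<longrightarrow>
      translate y v \<in> half_space N h \<and> (h \<in> B \<longrightarrow> translate y v \<in> half_space_bd N h)"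
    using H(1) * by (simp add: eventually_ball_finite)
  moreover have "\<forall>\<^sub>F d in at_right (0::real). d > 0" by (rule eventually_at_right_less)
  ultimately have "\<forall>\<^sub>F d in at_right 0. d > 0 \<and> (\<forall>h\<in>H. \<forall>v\<in>parallel_space ?S. (\<forall>i. \<bar>v i\<bar> < d) \<longrightarrow>
      translate y v \<in> half_space N h \<and> (h \<in> B \<longrightarrow> translate y v \<in> half_space_bd N h))"
    by (rule eventually_conj[rotated])
  then obtain d where d: "d > 0" "\<forall>h\<in>H. \<forall>v\<in>parallel_space ?S. (\<forall>i. \<bar>v i\<bar> < d) \<longrightarrow>
      translate y v \<in> half_space N h \<and> (h \<in> B \<longrightarrow> translate y v \<in> half_space_bd N h)"
    using eventually_happens'[OF trivial_limit_at_right_real] by blast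
  have "translate y v \<in> ?S" if v: "v \<in> parallel_space ?S" "\<forall>i. \<bar>v i\<bar> < d" for v
  proof -
    have tI: "translate y v \<in> TI_open N I" using yI v P by (intro translate_TI_open) auto
    then show ?thesis using d(2) v H(2) by (auto simp: polyhedron_def TI_open_TN)
  qed
  then show ?thesis unfolding relative_interior_def using y d(1) by blast
qed

text \<open>A point \<open>z\<close> with the fewest active inequalities works: at the midpoint of
  \<open>z\<close> and \<open>x\<close> only inequalities active at both are active, so by
  minimality everything active at \<open>z\<close> is active at \<open>x\<close>.\<close>

lemma relative_interior_polyhedron_nonempty:
  assumes H: "finite H" "B \<subseteq> H" and ne: "polyhedron N H B \<inter> TI_open N {} \<noteq> {}"
  shows "relative_interior (polyhedron N H B \<inter> TI_open N {}) \<noteq> {}"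
proof -
  let ?S = "polyhedron N H B \<inter> TI_open N {}"
  define active where "active x = {h\<in>H. x \<in> half_space_bd N h}" for x
  obtain z where z: "z \<in> ?S" and zmin: "\<And>x. x \<in> ?S \<Longrightarrow> card (active z) \<le> card (active x)"
    using ne arg_min_natI[of "\<lambda>x. x \<in> ?S" _ "\<lambda>x. card (active x)"] arg_min_nat_le[of "\<lambda>x. x \<in> ?S" _ "\<lambda>x. card (active x)"]
    by (metis (no_types, lifting) ex_in_conv)
  have "z \<in> relative_interior ?S"
  proof (rule relative_interior_polyhedronI[OF H _ z])
    fix h assume h: "h \<in> H" "z \<in> half_space_bd N h"
    show "?S \<subseteq> half_space_bd N h"
    proof
      fix x assume x: "x \<in> ?S"
      define m where "m = translate z (rscale (1/2) (realpart x - realpart z))"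
      have zI: "z \<in> TI_open N {}" and xI: "x \<in> TI_open N {}" using x z by auto
      have mI: "m \<in> TI_open N {}"
        unfolding m_def using zI xI by (intro translate_TI_open RN_rscale RN_diff realpart_RN TI_open_TN) auto
      have lm: "linear_form N j (realpart m) = (linear_form N j (realpart x) + linear_form N j (realpart z)) / 2" for j
        unfolding m_def by (simp add: linear_form_translate[OF zI] linear_form_rscale linear_form_diff field_simps)
      have iffs: "p \<in> half_space N h \<longleftrightarrow> linear_form N (fst h) (realpart p) \<le> snd h"
        "p \<in> half_space_bd N h \<longleftrightarrow> linear_form N (fst h) (realpart p) = snd h" if "p \<in> TI_open N {}" for p h
        using half_space_iff[OF that, of h] half_space_bd_iff[OF that, of h] by auto
      have le: "linear_form N (fst h) (realpart x) \<le> snd h \<and> linear_form N (fst h) (realpart z) \<le> snd h" if "h \<in> H" for h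
        using x z that iffs[OF xI] iffs[OF zI] by (auto simp: polyhedron_def)
      have mS: "m \<in> ?S"
      proof -
        have "m \<in> half_space N h" if "h \<in> H" for h
          using le[OF that] by (simp add: iffs[OF mI] lm)
        moreover have "m \<in> half_space_bd N h" if "h \<in> B" for h
          using x z that by (simp add: polyhedron_def iffs[OF mI] iffs[OF xI] iffs[OF zI] lm)
        ultimately show ?thesis using mI by (auto simp: polyhedron_def TI_open_TN)
      qed
      have "active m \<subseteq> active z \<inter> active x"
      proof -
        have "linear_form N (fst h) (realpart z) = snd h \<and> linear_form N (fst h) (realpart x) = snd h"
          if "h \<in> H" "linear_form N (fst h) (realpart m) = snd h" for h
          using le[OF that(1)] that(2) by (auto simp: lm)
        then show ?thesis by (auto simp: active_def iffs[OF mI] iffs[OF xI] iffs[OF zI])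
      qed
      moreover have "finite (active z)" using H by (simp add: active_def)
      ultimately have "active m = active z"
        using zmin[OF mS] by (intro card_seteq) auto
      then show "x \<in> half_space_bd N h"
        using h \<open>active m \<subseteq> active z \<inter> active x\<close> by (auto simp: active_def)
    qed
  qed auto
  then show ?thesis by auto
qed

text \<open>The point \<open>y\<close> certifies that every inequality with a negative coefficient
  on \<open>I\<close> also has a positive one there, and that every equality has both or neither.
  What remains does not involve the coordinates in \<open>I\<close> and is inherited from
  \<open>x\<close>.\<close>

lemma send_to_infinity_polyhedron:
  assumes x: "x \<in> polyhedron N H B \<inter> TI_open N {}" and y: "y \<in> polyhedron N H B \<inter> TI_open N I" and I: "I \<subseteq> {..<N}"
  shows "send_to_infinity I x \<in> polyhedron N H B \<inter> TI_open N I"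
proof -
  have xI: "x \<in> TI_open N {}" and yI: "y \<in> TI_open N I" using x y by auto
  have pI: "send_to_infinity I x \<in> TI_open N I" using send_to_infinity_TI_open[OF xI I] .
  have "send_to_infinity I x \<in> half_space N h" if "h \<in> H" for h
  proof -
    have "x \<in> half_space N h" "y \<in> half_space N h" using x y that by (auto simp: polyhedron_def)
    then show ?thesis
      by (auto simp: half_space_iff[OF xI] half_space_iff[OF yI I] half_space_iff[OF pI I]
          linear_form_send_to_infinity)
  qed
  moreover have "send_to_infinity I x \<in> half_space_bd N h" if "h \<in> B" for h
  proof -
    have "x \<in> half_space_bd N h" "y \<in> half_space_bd N h" using x y that by (auto simp: polyhedron_def)
    then show ?thesis
      by (auto simp: half_space_bd_iff[OF xI] half_space_bd_iff[OF yI I] half_space_bd_iff[OF pI I]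
          linear_form_send_to_infinity)
  qed
  ultimately show ?thesis using pI by (auto simp: polyhedron_def TI_open_TN)
qed

definition unit_vector :: "nat \<Rightarrow> nat \<Rightarrow> real" where
  "unit_vector i = (\<lambda>k. if k = i then 1 else 0)"

lemma sum_apply: "(\<Sum>i\<in>A. f i) k = (\<Sum>i\<in>A. f i k)" for f :: "'a \<Rightarrow> 'b \<Rightarrow> 'c::comm_monoid_add"
  by (induction A rule: infinite_finite_induct) auto

lemma unit_vector_expansion:
  assumes "finite I" "\<And>k. k \<notin> I \<Longrightarrow> v k = 0"
  shows "v = (\<Sum>i\<in>I. rscale (v i) (unit_vector i))"
proof
  fix k
  have "(\<Sum>i\<in>I. rscale (v i) (unit_vector i)) k = (\<Sum>i\<in>I. if i = k then v k else 0)"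
    unfolding sum_apply by (rule sum.cong) (auto simp: rscale_def unit_vector_def)
  then show "v k = (\<Sum>i\<in>I. rscale (v i) (unit_vector i)) k" using assms by simp
qed

lemma RN_span_unit_vectors: "RN N \<subseteq> rv.span (unit_vector ` {..<N})"
proof
  fix v assume "v \<in> RN N"
  then have "v = (\<Sum>i<N. rscale (v i) (unit_vector i))"
    by (intro unit_vector_expansion) (auto simp: RN_def)
  also have "\<dots> \<in> rv.span (unit_vector ` {..<N})"
    by (intro rv.span_sum rv.span_scale rv.span_base) auto
  finally show "v \<in> rv.span (unit_vector ` {..<N})" .
qed

text \<open>The space of all functions is infinite-dimensional; inside \<open>RN N\<close> the
  \<open>N\<close> unit vectors bound every independent set.\<close>

lemma finite_dim_basis:
  assumes "P \<subseteq> RN N"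
  obtains C where "finite C" "C \<subseteq> P" "rv.independent C" "P \<subseteq> rv.span C" "card C = rv.dim P"
proof -
  obtain C where C: "C \<subseteq> P" "rv.independent C" "P \<subseteq> rv.span C" "card C = rv.dim P"
    by (rule rv.basis_exists)
  have "finite C"
    using rv.independent_span_bound[of "unit_vector ` {..<N}" C] C assms RN_span_unit_vectors by blast
  with C that show ?thesis by blast
qed

text \<open>The directions of the finite part always lie in the sum of those of the part at infinity and
  those going to infinity; regularity is the equality of dimensions.\<close>

lemma regular_directions:
  assumes reg: "regular_at_infinity N (polyhedron N H B)" and I: "I \<subseteq> {..<N}"
    and ne: "polyhedron N H B \<inter> TI_open N I \<noteq> {}"
  shows "parallel_space (polyhedron N H B \<inter> TI_open N I) \<subseteq> parallel_space (polyhedron N H B \<inter> TI_open N {})"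
    and "i \<in> I \<Longrightarrow> unit_vector i \<in> parallel_space (polyhedron N H B \<inter> TI_open N {})"
proof -
  let ?P = "parallel_space (polyhedron N H B \<inter> TI_open N {})"
  let ?Q = "parallel_space (polyhedron N H B \<inter> TI_open N I)"
  have dims: "rv.dim ?Q + card I = rv.dim ?P"
    using reg ne I by (auto simp: regular_at_infinity_def polyhedral_dim_def)
  obtain y where y: "y \<in> polyhedron N H B \<inter> TI_open N I" using ne by auto
  have PR: "?P \<subseteq> RN N" "?Q \<subseteq> RN N" by (rule parallel_space_RN; auto simp: polyhedron_def)+
  obtain C where C: "finite C" "C \<subseteq> ?Q" "?Q \<subseteq> rv.span C" "card C = rv.dim ?Q"
    using finite_dim_basis[OF PR(2)] by metis
  obtain C' where C': "finite C'" "C' \<subseteq> ?P" "rv.independent C'" "card C' = rv.dim ?P"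
    using finite_dim_basis[OF PR(1)] by metis
  have fI: "finite I" using I finite_subset by auto
  define T where "T = C \<union> unit_vector ` I"
  have fT: "finite T" using C fI by (simp add: T_def)
  have cT: "card T \<le> card C'"
    unfolding T_def using card_Un_le[of C "unit_vector ` I"] card_image_le[OF fI, of unit_vector] dims C C' by linarith
  have PT: "?P \<subseteq> rv.span T"
    unfolding parallel_space_def[of "polyhedron N H B \<inter> TI_open N {}"]
  proof (rule rv.span_minimal[OF _ rv.subspace_span], safe)
    fix x x' assume x: "x \<in> polyhedron N H B" "x \<in> TI_open N {}" and x': "x' \<in> polyhedron N H B" "x' \<in> TI_open N {}"
    let ?p = "send_to_infinity I x" and ?p' = "send_to_infinity I x'"
    have 1: "realpart ?p - realpart ?p' \<in> rv.span T"
    proof -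
      have "realpart ?p - realpart ?p' \<in> ?Q"
        using send_to_infinity_polyhedron[OF _ y I] x x' by (intro parallel_space_diff) auto
      also have "?Q \<subseteq> rv.span T" using C(3) rv.span_mono[of C T] by (auto simp: T_def)
      finally show ?thesis .
    qed
    \<comment> \<open>Sending to infinity changes only coordinates in \<open>I\<close>, so the error
      \<open>w\<close> is a combination of their unit vectors.\<close>
    define w where "w = (realpart x - realpart x') - (realpart ?p - realpart ?p')"
    have "w = (\<Sum>i\<in>I. rscale (w i) (unit_vector i))"
      by (rule unit_vector_expansion[OF fI]) (simp add: w_def realpart_send_to_infinity)
    also have "\<dots> \<in> rv.span T"
      by (intro rv.span_sum rv.span_scale rv.span_base) (auto simp: T_def)
    finally have 2: "w \<in> rv.span T" .
    have "realpart x - realpart x' = (realpart ?p - realpart ?p') + w" by (simp add: w_def)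
    then show "realpart x - realpart x' \<in> rv.span T" using rv.span_add[OF 1 2] by simp
  qed
  \<comment> \<open>Dimension count: \<open>T\<close> has at most \<open>dim ?P\<close> elements and
    spans \<open>?P\<close>. An element of \<open>T\<close> outside \<open>?P\<close> would enlarge
    the basis \<open>C'\<close> to an independent set inside \<open>rv.span T\<close> with more
    elements than \<open>T\<close>.\<close>
  have TP: "t \<in> ?P" if "t \<in> T" for t
  proof -
    have "t \<in> rv.span C'"
    proof (rule ccontr)
      assume t: "t \<notin> rv.span C'"
      then have "rv.independent (insert t C')" using C'(3) by (simp add: rv.independent_insert)
      moreover have "insert t C' \<subseteq> rv.span T" using that PT C' by (auto intro: rv.span_base)
      ultimately have "card (insert t C') \<le> card T" using rv.independent_span_bound[OF fT] by blast
      moreover have "t \<notin> C'" using t rv.span_base by blast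
      ultimately show False using cT C' by simp
    qed
    also have "rv.span C' \<subseteq> ?P"
      using C'(2) by (intro rv.span_minimal) (auto simp: parallel_space_def)
    finally show ?thesis .
  qed
  then show "unit_vector i \<in> ?P" if "i \<in> I" using that by (auto simp: T_def)
  have "?Q \<subseteq> rv.span T" using C(3) rv.span_mono[of C T] by (auto simp: T_def)
  also have "\<dots> \<subseteq> ?P" using TP by (intro rv.span_minimal) (auto simp: parallel_space_def)
  finally show "?Q \<subseteq> ?P" .
qed

lemma linear_form_unit_vector: "i < N \<Longrightarrow> linear_form N j (unit_vector i) = of_int (j i)"
  by (simp add: linear_form_def unit_vector_def if_distrib[of "(*) _"] cong: if_cong)

text \<open>Carries an equality from a finite interior point of a face to its points at infinity.
  The form vanishes on the directions of the finite part; by regularity these contain the unit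
  vectors of \<open>I\<close>, so the coefficients on \<open>I\<close> vanish, and the directions at
  infinity, so the value at \<open>y\<close> is that at the projection of \<open>z\<close>.\<close>

lemma half_space_bd_at_infinity:
  assumes reg: "regular_at_infinity N (polyhedron N H B)" and I: "I \<subseteq> {..<N}"
    and y: "y \<in> polyhedron N H B \<inter> TI_open N I"
    and z: "z \<in> relative_interior (polyhedron N H B \<inter> TI_open N {})"
    and sub: "polyhedron N H B \<subseteq> half_space N h" and bd: "z \<in> half_space_bd N h"
  shows "y \<in> half_space_bd N h"
proof -
  let ?S = "polyhedron N H B \<inter> TI_open N {}" and ?j = "fst h"
  have ne: "polyhedron N H B \<inter> TI_open N I \<noteq> {}" using y by auto
  have zS: "z \<in> ?S" using z by (simp add: relative_interior_def)
  have "?S \<subseteq> half_space_bd N h"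
    by (rule relative_interior_half_space_bd[OF _ _ z _ bd]) (use sub in auto)
  then have la: "linear_form N ?j (realpart x) = snd h" if "x \<in> ?S" for x
    using that half_space_bd_iff[of x N "{}" h] by auto
  then have l0: "linear_form N ?j v = 0" if "v \<in> parallel_space ?S" for v
    using parallel_space_linear_form[OF _ that] by blast
  have "?j i = 0" if "i \<in> I" for i
    using l0[OF regular_directions(2)[OF reg I ne that]] linear_form_unit_vector[of i N ?j] I that by auto
  then have off: "\<not> meets_pos I ?j" "\<not> meets_neg I ?j" by (auto simp: meets_pos_def meets_neg_def)
  let ?p = "send_to_infinity I z"
  have "realpart y - realpart ?p \<in> parallel_space (polyhedron N H B \<inter> TI_open N I)"
    using y send_to_infinity_polyhedron[OF zS y I] by (rule parallel_space_diff)
  then have "linear_form N ?j (realpart y) = linear_form N ?j (realpart ?p)"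
    using l0 regular_directions(1)[OF reg I ne] linear_form_diff by (metis eq_iff_diff_eq_0 subsetD)
  also have "\<dots> = snd h" using la[OF zS] by (simp add: linear_form_send_to_infinity[OF off])
  finally show ?thesis using y off half_space_bd_iff[of y N I h] I by auto
qed

section \<open>Wave vectors move points inside the complex\<close>

text \<open>The intersection over an empty family would be everything, so a maximal subspace must be
  produced. Zorn's lemma gives one, starting from the zero space, which lies in the cone because
  \<open>z\<close> lies in \<open>Y\<close>.\<close>

lemma wave_mobile_subset_tangent_cone:
  assumes z: "z \<in> Y"
  shows "wave_mobile N Y z \<subseteq> tangent_cone N Y z"
proof -
  let ?A = "{L. rv.subspace L \<and> L \<subseteq> tangent_cone N Y z}"
  have "\<exists>M\<in>?A. \<forall>L\<in>?A. M \<subseteq> L \<longrightarrow> L = M"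
  proof (rule subset_Zorn_nonempty)
    have r0: "rscale e 0 = 0" for e by (simp add: rscale_def fun_eq_iff)
    have "{0} \<in> ?A"
      using z by (auto simp: tangent_cone_def RN_0 r0)
    then show "?A \<noteq> {}" by blast
  next
    fix \<C> assume C: "\<C> \<noteq> {}" "subset.chain ?A \<C>"
    have sub: "rv.subspace L" "L \<subseteq> tangent_cone N Y z" if "L \<in> \<C>" for L
      using C that by (auto simp: subset_chain_def)
    have "rv.subspace (\<Union>\<C>)"
      unfolding rv.subspace_def
    proof (intro conjI ballI allI)
      obtain K where K: "K \<in> \<C>" using C(1) by blast
      then show "0 \<in> \<Union>\<C>" using rv.subspace_0[OF sub(1)[OF K]] by (rule_tac UnionI)
    next
      fix v w assume "v \<in> \<Union>\<C>" "w \<in> \<Union>\<C>"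
      then obtain L L' where L: "L \<in> \<C>" "v \<in> L" "L' \<in> \<C>" "w \<in> L'" by blast
      then have "L \<subseteq> L' \<or> L' \<subseteq> L" using C(2) by (auto simp: subset_chain_def)
      then obtain K where K: "K \<in> \<C>" "v \<in> K" "w \<in> K" using L by blast
      then show "v + w \<in> \<Union>\<C>" using rv.subspace_add[OF sub(1)[OF K(1)] K(2,3)] by (rule_tac UnionI)
    next
      fix r v assume "v \<in> \<Union>\<C>"
      then obtain K where K: "K \<in> \<C>" "v \<in> K" by (rule UnionE)
      then show "rscale r v \<in> \<Union>\<C>" using rv.subspace_scale[OF sub(1)[OF K(1)] K(2)] by (rule_tac UnionI)
    qed
    then show "\<Union>\<C> \<in> ?A" using sub by auto
  qed
  then obtain M where M: "M \<in> ?A" "\<forall>L\<in>?A. M \<subseteq> L \<longrightarrow> L = M" by (rule bexE)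
  then have "wave_mobile N Y z \<subseteq> M" unfolding wave_mobile_def by (intro Inter_lower) simp
  then show ?thesis using M(1) by blast
qed

lemma complex_domain_polyhedron:
  assumes "polyhedral_complex N n \<F>" "D \<in> \<F>"
  obtains H where "finite H" "D = polyhedron N H {}"
proof -
  have "polyhedral_domain N D" using assms by (simp add: polyhedral_complex_def)
  then obtain H where "finite H" "D = TN N \<inter> (\<Inter>h\<in>H. half_space N h)"
    unfolding polyhedral_domain_def by (elim exE conjE)
  with that[of H] show thesis by (simp add: polyhedron_def)
qed

lemma complex_subset_TN:
  assumes "polyhedral_complex N n \<F>"
  shows "\<Union>\<F> \<subseteq> TN N"
  using assms by (auto simp: polyhedral_complex_def polyhedral_domain_def)

text \<open>Needed because \<open>wave_space\<close> picks its representative with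
  \<open>SOME\<close>. The parent is cut out of a facet by all equalities active at
  \<open>y\<close>; regularity guarantees that it has finite points.\<close>

lemma mobile_representative_exists:
  assumes complex: "polyhedral_complex N n \<F>" and y: "y \<in> \<Union>\<F>"
  shows "\<exists>z. mobile_representative N \<F> y z"
proof -
  obtain D where D: "D \<in> \<F>" "y \<in> D" using y by auto
  obtain H where H: "finite H" "D = polyhedron N H {}" using complex_domain_polyhedron[OF complex D(1)] .
  define B where "B = {h\<in>H. y \<in> half_space_bd N h}"
  let ?E = "polyhedron N H B" and ?I = "sedentarity N y"
  have yN: "y \<in> TN N" using D H by (auto simp: polyhedron_def)
  have B: "B \<subseteq> H" by (auto simp: B_def)
  have face: "mobile_face N D ?E" unfolding mobile_face_polyhedron using H B by blast
  have yE: "y \<in> ?E \<inter> TI_open N ?I"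
    using D H TI_open_sedentarity[OF yN] by (auto simp: polyhedron_def B_def)
  have "regular_at_infinity N ?E" using complex D(1) face by (auto simp: polyhedral_complex_def)
  then have "?E \<inter> TI_open N {} \<noteq> {}" using yE sedentarity_subset unfolding regular_at_infinity_def by blast
  then obtain z where z: "z \<in> relative_interior (?E \<inter> TI_open N {})"
    using relative_interior_polyhedron_nonempty[OF H(1) B] by auto
  have "y \<in> relative_interior (?E \<inter> TI_open N ?I)"
    by (rule relative_interior_polyhedronI[OF H(1) B sedentarity_subset yE]) (auto simp: B_def polyhedron_def)
  then show ?thesis unfolding mobile_representative_def using D face z by blast
qed

lemma eventually_translate_half_space:
  assumes y: "y \<in> TI_open N I" "y \<in> half_space N h" and I: "I \<subseteq> {..<N}" and v: "v \<in> RN N"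
    and active: "\<not> meets_pos I (fst h) \<Longrightarrow> y \<in> half_space_bd N h \<Longrightarrow> linear_form N (fst h) v \<le> 0"
  shows "\<forall>\<^sub>F s in at_right 0. translate y (rscale s v) \<in> half_space N h"
proof -
  have tI: "translate y (rscale s v) \<in> TI_open N I" for s
    using y v by (intro translate_TI_open RN_rscale)
  show ?thesis
  proof (cases "meets_pos I (fst h)")
    case True
    then show ?thesis by (simp add: half_space_iff[OF tI I])
  next
    case p: False
    let ?l = "linear_form N (fst h)"
    have n: "\<not> meets_neg I (fst h)" and le: "?l (realpart y) \<le> snd h"
      using y p by (auto simp: half_space_iff[OF y(1) I])
    have iff: "translate y (rscale s v) \<in> half_space N h \<longleftrightarrow> ?l (realpart y) + s * ?l v \<le> snd h" for s
      by (simp add: half_space_iff[OF tI I] p n linear_form_translate[OF y(1) p n] linear_form_rscale)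
    show ?thesis
    proof (cases "?l (realpart y) = snd h")
      case True
      then have "?l v \<le> 0" using active[OF p] by (simp add: half_space_bd_iff[OF y(1) I] p n)
      moreover have "\<forall>\<^sub>F s in at_right (0::real). s > 0" by (rule eventually_at_right_less)
      ultimately show ?thesis unfolding iff
        by (auto elim!: eventually_mono simp: True mult_nonneg_nonpos)
    next
      case False
      have "((\<lambda>s. ?l (realpart y) + s * ?l v) \<longlongrightarrow> ?l (realpart y) + 0 * ?l v) (at_right 0)"
        by (intro tendsto_intros)
      then have "\<forall>\<^sub>F s in at_right 0. ?l (realpart y) + s * ?l v < snd h"
        by (rule order_tendstoD(2)) (use le False in simp)
      then show ?thesis unfolding iff by (auto elim: eventually_mono)
    qed
  qed
qed

text \<open>Only \<open>frequently\<close> is available where this is applied: among finitely many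
  facets one is visited at arbitrarily small times. For a single linear inequality that already
  decides membership and the sign of the slope.\<close>

lemma frequently_finite_half_space:
  assumes z: "z \<in> TI_open N {}" and v: "v \<in> RN N"
    and freq: "\<exists>\<^sub>F s in at_right 0. translate z (rscale s v) \<in> half_space N h"
  shows "z \<in> half_space N h"
    and "z \<in> half_space_bd N h \<Longrightarrow> linear_form N (fst h) v \<le> 0"
proof -
  let ?l = "linear_form N (fst h)"
  have tI: "translate z (rscale s v) \<in> TI_open N {}" for s
    using z v by (intro translate_TI_open RN_rscale)
  have iff: "translate z (rscale s v) \<in> half_space N h \<longleftrightarrow> ?l (realpart z) + s * ?l v \<le> snd h" for s
    using half_space_iff[OF tI] linear_form_translate[OF z] by (simp add: linear_form_rscale)
  show "z \<in> half_space N h"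
  proof (rule ccontr)
    assume "z \<notin> half_space N h"
    then have *: "?l (realpart z) > snd h" by (simp add: half_space_iff[OF z])
    have "((\<lambda>s. ?l (realpart z) + s * ?l v) \<longlongrightarrow> ?l (realpart z) + 0 * ?l v) (at_right 0)"
      by (intro tendsto_intros)
    then have "\<forall>\<^sub>F s in at_right 0. ?l (realpart z) + s * ?l v > snd h"
      by (rule order_tendstoD(1)) (use * in simp)
    then show False using freq unfolding iff frequently_def by (auto simp: not_le)
  qed
  assume "z \<in> half_space_bd N h"
  then have *: "?l (realpart z) = snd h" by (simp add: half_space_bd_iff[OF z])
  show "?l v \<le> 0"
  proof (rule ccontr)
    assume "\<not> ?l v \<le> 0"
    moreover have "\<forall>\<^sub>F s in at_right (0::real). s > 0" by (rule eventually_at_right_less)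
    ultimately have "\<forall>\<^sub>F s in at_right 0. \<not> ?l (realpart z) + s * ?l v \<le> snd h"
      by (auto elim!: eventually_mono simp: * mult_le_0_iff)
    then show False using freq unfolding iff frequently_def by auto
  qed
qed

text \<open>The vector is known to be tangent only at the finite representative \<open>z\<close>. A
  facet \<open>D'\<close> that \<open>z\<close> enters along \<open>v\<close> contains the part of
  the face at infinity through \<open>y\<close>, and its inequalities active at \<open>y\<close> are
  active at \<open>z\<close>, where \<open>v\<close> points into \<open>D'\<close>. So
  \<open>v\<close> points into \<open>D'\<close> at \<open>y\<close> too.\<close>

theorem wave_space_translate:
  assumes complex: "polyhedral_complex N n \<F>" and y: "y \<in> \<Union>\<F>" and v: "v \<in> wave_space N \<F> y"
  shows "\<forall>\<^sub>F s in at_right 0. translate y (rscale s v) \<in> \<Union>\<F>"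
proof -
  let ?I = "sedentarity N y"
  define z where "z = (SOME z. mobile_representative N \<F> y z)"
  have "mobile_representative N \<F> y z"
    unfolding z_def using mobile_representative_exists[OF complex y] by (rule someI_ex)
  then obtain D E where D: "D \<in> \<F>" and DE: "mobile_face N D E"
    and yE: "y \<in> relative_interior (E \<inter> TI_open N ?I)"
    and zE: "z \<in> relative_interior (E \<inter> TI_open N {})"
    unfolding mobile_representative_def by blast
  obtain H B where H: "finite H" "B \<subseteq> H" "D = polyhedron N H {}" "E = polyhedron N H B"
    using DE unfolding mobile_face_polyhedron by blast
  have reg: "regular_at_infinity N (polyhedron N H B)"
    using complex D DE H(4) by (auto simp: polyhedral_complex_def)
  have ED: "E \<subseteq> D" using H by (auto simp: polyhedron_def)
  have zS: "z \<in> E" "z \<in> TI_open N {}" and yS: "y \<in> E" "y \<in> TI_open N ?I"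
    using yE zE by (auto simp: relative_interior_def)
  have I: "?I \<subseteq> {..<N}" by (rule sedentarity_subset)
  have "v \<in> tangent_cone N (\<Union>\<F>) z"
    using v wave_mobile_subset_tangent_cone[of z "\<Union>\<F>" N] zS ED D
    by (auto simp: wave_space_def z_def[symmetric])
  then have vR: "v \<in> RN N" and ev: "\<forall>\<^sub>F s in at_right 0. translate z (rscale s v) \<in> \<Union>\<F>"
    by (auto simp: tangent_cone_def)
  have fin: "finite \<F>" using complex by (simp add: polyhedral_complex_def)
  have "\<exists>\<^sub>F s in at_right 0. \<exists>D'\<in>\<F>. translate z (rscale s v) \<in> D'"
    using eventually_frequently[OF trivial_limit_at_right_real ev] by simp
  then obtain D' where D': "D' \<in> \<F>" and freq: "\<exists>\<^sub>F s in at_right 0. translate z (rscale s v) \<in> D'"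
    using frequently_bex_finite[OF fin, of "\<lambda>s D'. translate z (rscale s v) \<in> D'"] by blast
  obtain H' where H': "finite H'" "D' = polyhedron N H' {}" using complex_domain_polyhedron[OF complex D'] .
  have freq_h: "\<exists>\<^sub>F s in at_right 0. translate z (rscale s v) \<in> half_space N h" if "h \<in> H'" for h
    using freq that by (auto elim!: frequently_elim1 simp: H' polyhedron_def)
  have zD': "z \<in> D'"
    using frequently_finite_half_space(1)[OF zS(2) vR freq_h] zS by (auto simp: H' polyhedron_def TI_open_TN)
  have "E \<inter> TI_open N ?I \<subseteq> D'"
  proof
    fix x assume x: "x \<in> E \<inter> TI_open N ?I"
    have "face N D (\<Inter>{D, D'})"
      using complex D D' unfolding polyhedral_complex_def
      by (metis empty_subsetI insertI1 insert_not_empty insert_subset)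
    then obtain E' J where J: "J \<subseteq> {..<N}" "mobile_face N D E'" "D \<inter> D' = E' \<inter> TI_closed N J"
      by (auto simp: face_def)
    \<comment> \<open>The common face contains the finite point \<open>z\<close>, so it is a mobile
      face of \<open>D\<close> and no face at infinity.\<close>
    have "J = {}"
    proof -
      have "z \<in> TI_closed N J" using J(3) zD' zS(1) ED by blast
      then show ?thesis using J(1) zS(2) by (auto simp: TI_closed_def TI_open_def)
    qed
    then have E': "D \<inter> D' = E'"
      using J(3) J(2) by (auto simp: TI_closed_def mobile_face_polyhedron polyhedron_def)
    obtain K C where K: "C \<subseteq> K" "D = polyhedron N K {}" "E' = polyhedron N K C"
      using J(2) unfolding mobile_face_polyhedron by blast
    \<comment> \<open>The presentation \<open>K\<close> of \<open>D\<close> may differ from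
      \<open>H\<close>. This is harmless, since the equality is transported along the set
      \<open>E\<close> and not along its presentation.\<close>
    have "x \<in> half_space_bd N h" if h: "h \<in> C" for h
    proof (rule half_space_bd_at_infinity[OF reg I])
      show "z \<in> relative_interior (polyhedron N H B \<inter> TI_open N {})" using zE H by simp
      show "z \<in> half_space_bd N h" 
      proof -
        have "z \<in> polyhedron N K C" using zS(1) zD' ED E' K(3) by blast
        then show ?thesis using h by (simp add: polyhedron_def)
      qed
      show "polyhedron N H B \<subseteq> half_space N h" using ED K h H by (auto simp: polyhedron_def)
    qed (use x H in auto)
    then have "x \<in> E'" using x ED K by (auto simp: polyhedron_def)
    then show "x \<in> D'" using E' by auto
  qed
  have "\<forall>\<^sub>F s in at_right 0. translate y (rscale s v) \<in> half_space N h" if h: "h \<in> H'" for h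
  proof (rule eventually_translate_half_space[OF yS(2) _ I vR])
    show "y \<in> half_space N h"
      using \<open>E \<inter> TI_open N ?I \<subseteq> D'\<close> yS h by (auto simp: H' polyhedron_def)
    assume p: "\<not> meets_pos ?I (fst h)" and bd: "y \<in> half_space_bd N h"
    then have n: "\<not> meets_neg ?I (fst h)" by (simp add: half_space_bd_iff[OF yS(2) I])
    have *: "E \<inter> TI_open N ?I \<subseteq> half_space_bd N h"
      by (rule relative_interior_half_space_bd[OF _ I yE _ bd])
        (use \<open>E \<inter> TI_open N ?I \<subseteq> D'\<close> h in \<open>auto simp: H' polyhedron_def\<close>)
    \<comment> \<open>The projection of \<open>z\<close> lies in the part of \<open>E\<close>
      through \<open>y\<close>, on which the inequality is an equality; the form ignores the
      coordinates in \<open>?I\<close>, so it is active at \<open>z\<close> itself.\<close>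
    have "send_to_infinity ?I z \<in> E \<inter> TI_open N ?I"
      unfolding H(4) by (rule send_to_infinity_polyhedron[OF _ _ I]) (use zS yS H in auto)
    then have "linear_form N (fst h) (realpart z) = snd h"
      using * half_space_bd_iff[of "send_to_infinity ?I z" N ?I h] I p n
      by (auto simp: linear_form_send_to_infinity[OF p n])
    then have "z \<in> half_space_bd N h" by (simp add: half_space_bd_iff[OF zS(2)])
    then show "linear_form N (fst h) v \<le> 0"
      using frequently_finite_half_space(2)[OF zS(2) vR freq_h[OF h]] by blast
  qed
  then have "\<forall>\<^sub>F s in at_right 0. \<forall>h\<in>H'. translate y (rscale s v) \<in> half_space N h"
    using H'(1) by (simp add: eventually_ball_finite)
  then show ?thesis
  proof (rule eventually_mono)
    fix s assume *: "\<forall>h\<in>H'. translate y (rscale s v) \<in> half_space N h"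
    have "translate y (rscale s v) \<in> TI_open N ?I"
      using yS vR by (intro translate_TI_open RN_rscale)
    then have "translate y (rscale s v) \<in> D'" using * by (auto simp: H' polyhedron_def TI_open_TN)
    then show "translate y (rscale s v) \<in> \<Union>\<F>" using D' by blast
  qed
qed

section \<open>Continuity of translations\<close>

lemma tendsto_fun_iff:
  fixes f :: "'a \<Rightarrow> 'b \<Rightarrow> 'c::topological_space"
  shows "(f \<longlongrightarrow> l) F \<longleftrightarrow> (\<forall>i. ((\<lambda>k. f k i) \<longlongrightarrow> l i) F)"
proof -
  have "(f \<longlongrightarrow> l) F \<longleftrightarrow> limitin (product_topology (\<lambda>_. euclidean) UNIV) f l F"
    by (simp add: euclidean_product_topology)
  then show ?thesis by (simp add: limitin_componentwise)
qed

lemma Hausdorff_space_fun: "Hausdorff_space (euclidean :: ('a \<Rightarrow> 'b::t2_space) topology)"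
  unfolding Hausdorff_space_def
proof (intro allI impI, elim conjE)
  fix x y :: "'a \<Rightarrow> 'b" assume "x \<noteq> y"
  then obtain i where "x i \<noteq> y i" by auto
  then obtain S T where ST: "open S" "open T" "x i \<in> S" "y i \<in> T" "S \<inter> T = {}"
    using hausdorff by metis
  have "open ((\<lambda>z::'a \<Rightarrow> 'b. z i) -` S)" "open ((\<lambda>z::'a \<Rightarrow> 'b. z i) -` T)"
    using ST continuous_on_product_coordinates by (auto intro!: open_vimage)
  then show "\<exists>S T. openin euclidean S \<and> openin euclidean T \<and> x \<in> S \<and> y \<in> T \<and> disjnt S T"
    using ST by (intro exI[of _ "(\<lambda>z. z i) -` S"] exI[of _ "(\<lambda>z. z i) -` T"]) (auto simp: disjnt_def)
qed

lemma tendsto_translate: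
  assumes "(f \<longlongrightarrow> x) F" "(g \<longlongrightarrow> s) F"
  shows "((\<lambda>k. translate (f k) (rscale (g k) v)) \<longlongrightarrow> translate x (rscale s v)) F"
  unfolding tendsto_fun_iff translate_def rscale_def
proof
  fix i
  have "((\<lambda>k. f k i) \<longlongrightarrow> x i) F" using assms(1) by (simp add: tendsto_fun_iff)
  moreover have "((\<lambda>k. ereal (g k * v i)) \<longlongrightarrow> ereal (s * v i)) F"
    using assms(2) by (auto intro!: tendsto_intros)
  ultimately show "((\<lambda>k. f k i + ereal (g k * v i)) \<longlongrightarrow> x i + ereal (s * v i)) F"
    by (intro tendsto_add_ereal_general) auto
qed

lemma continuous_on_translate: "continuous_on S (\<lambda>x. translate x v)"
  unfolding continuous_on_def
  using tendsto_translate[OF tendsto_ident_at tendsto_const, where s = 1] by auto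

text \<open>Joint continuity at the point \<open>y\<close> and time 0 gives one time bound for a
  whole neighbourhood.\<close>

lemma translate_into_open:
  assumes "open W" "y \<in> W"
  obtains G d where "open G" "y \<in> G" "d > (0::real)"
    "\<And>y' s. y' \<in> G \<Longrightarrow> \<bar>s\<bar> < d \<Longrightarrow> translate y' (rscale s v) \<in> W"
proof -
  have "((\<lambda>p. translate (fst p) (rscale (snd p) v)) \<longlongrightarrow> translate y (rscale 0 v)) (nhds y \<times>\<^sub>F nhds (0::real))"
    by (intro tendsto_translate filterlim_fst filterlim_snd)
  then have "\<forall>\<^sub>F p in nhds y \<times>\<^sub>F nhds 0. translate (fst p) (rscale (snd p) v) \<in> W"
    using assms by (intro topological_tendstoD) auto
  then obtain P Q where P: "eventually P (nhds y)" and Q: "eventually Q (nhds (0::real))"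
    and PQ: "\<And>y' s. P y' \<Longrightarrow> Q s \<Longrightarrow> translate y' (rscale s v) \<in> W"
    unfolding eventually_prod_filter by auto
  obtain G where G: "open G" "y \<in> G" "\<And>y'. y' \<in> G \<Longrightarrow> P y'"
    using P unfolding eventually_nhds by auto
  obtain d where d: "d > 0" "\<And>s. dist s 0 < d \<Longrightarrow> Q s"
    using Q unfolding eventually_nhds_metric by auto
  show thesis
    by (rule that[OF G(1,2) d(1)]) (use G d PQ in \<open>auto simp: dist_real_def\<close>)
qed

section \<open>Lines inside a complex\<close>

text \<open>The uniform shape makes the set of times visibly closed. The degenerate strata are
  encoded by constants: \<open>0 \<le> 0\<close> for all times, \<open>0 \<le> -1\<close> for
  none.\<close>

lemma translate_half_space_ray:
  assumes y: "y \<in> TN N" and v: "v \<in> RN N"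
  obtains k b where "\<And>s. translate y (rscale s v) \<in> half_space N h \<longleftrightarrow> s * k \<le> (b::real)"
proof -
  let ?I = "sedentarity N y" and ?l = "linear_form N (fst h)"
  have yI: "y \<in> TI_open N ?I" using y by (rule TI_open_sedentarity)
  have I: "?I \<subseteq> {..<N}" by (rule sedentarity_subset)
  have tI: "translate y (rscale s v) \<in> TI_open N ?I" for s
    using yI v by (intro translate_TI_open RN_rscale)
  show thesis
  proof (cases "meets_pos ?I (fst h)")
    case True
    then show thesis by (intro that[of 0 0]) (simp add: half_space_iff[OF tI I])
  next
    case p: False
    show thesis
    proof (cases "meets_neg ?I (fst h)")
      case True
      then show thesis using p by (intro that[of 0 "-1"]) (simp add: half_space_iff[OF tI I])
    next
      case False
      show thesis
        by (rule that[of "?l v" "snd h - ?l (realpart y)"])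
          (auto simp: half_space_iff[OF tI I] p False linear_form_translate[OF yI p False] linear_form_rscale)
    qed
  qed
qed

lemma closed_line_in_complex:
  assumes complex: "polyhedral_complex N n \<F>" and y: "y \<in> TN N" and v: "v \<in> RN N"
  shows "closed {s. translate y (rscale s v) \<in> \<Union>\<F>}"
proof -
  have "closed {s. translate y (rscale s v) \<in> D}" if D: "D \<in> \<F>" for D
  proof -
    obtain H where H: "finite H" "D = polyhedron N H {}" using complex_domain_polyhedron[OF complex D] .
    have "translate y (rscale s v) \<in> TN N" for s
      using translate_TI_open[OF TI_open_sedentarity[OF y] RN_rscale[OF v]] by (rule TI_open_TN)
    then have "{s. translate y (rscale s v) \<in> D} = (\<Inter>h\<in>H. {s. translate y (rscale s v) \<in> half_space N h})"
      by (auto simp: H polyhedron_def)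
    moreover have "closed {s. translate y (rscale s v) \<in> half_space N h}" for h
    proof -
      obtain k b where kb: "\<And>s. translate y (rscale s v) \<in> half_space N h \<longleftrightarrow> s * k \<le> b"
        using translate_half_space_ray[OF y v] by metis
      show ?thesis unfolding kb by (intro closed_Collect_le continuous_intros)
    qed
    ultimately show ?thesis by auto
  qed
  moreover have "{s. translate y (rscale s v) \<in> \<Union>\<F>} = (\<Union>D\<in>\<F>. {s. translate y (rscale s v) \<in> D})"
    by auto
  moreover have "finite \<F>" using complex by (simp add: polyhedral_complex_def)
  ultimately show ?thesis by auto
qed

text \<open>Steps of uncontrolled length suffice: the infimum \<open>m\<close> of the missed times
  belongs to \<open>T\<close> by closedness, and extending beyond \<open>m\<close> contradicts the
  choice of \<open>m\<close>.\<close>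

lemma continuous_induction:
  fixes T :: "real set"
  assumes "closed T" "0 \<in> T" and ext: "\<And>s. s \<in> T \<Longrightarrow> 0 \<le> s \<Longrightarrow> s < d \<Longrightarrow> \<forall>\<^sub>F r in at_right 0. s + r \<in> T"
    and t: "0 \<le> t" "t < d"
  shows "t \<in> T"
proof (rule ccontr)
  assume tT: "t \<notin> T"
  define C where "C = {s. 0 \<le> s \<and> s \<le> t \<and> s \<notin> T}"
  have C: "C \<noteq> {}" "bdd_below C" using t tT by (auto simp: C_def intro!: bdd_belowI[of _ 0])
  define m where "m = Inf C"
  have mt: "m \<le> t" unfolding m_def using C tT t by (intro cInf_lower) (auto simp: C_def)
  have m0: "0 \<le> m" unfolding m_def using C by (intro cInf_greatest) (auto simp: C_def)
  have below: "s \<in> T" if "0 \<le> s" "s < m" for s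
    using that mt cInf_lower[OF _ C(2), of s] by (auto simp: C_def m_def)
  have mT: "m \<in> T"
  proof (cases "m = 0")
    case False
    then have m: "0 < m" using m0 by simp
    have "\<forall>\<^sub>F s in at_left m. s \<in> T"
      using eventually_at_left_real[OF m] by eventually_elim (auto intro: below)
    then show ?thesis
      using assms(1) Lim_in_closed_set[of T "\<lambda>s. s" "at_left m" m] by (auto simp: tendsto_ident_at)
  qed (use assms(2) in simp)
  then have "m < t" using mt tT by (cases "m = t") auto
  then have "\<forall>\<^sub>F r in at_right 0. m + r \<in> T" using ext[OF mT m0] t by linarith
  then obtain b where b: "b > 0" "\<And>r. 0 < r \<Longrightarrow> r < b \<Longrightarrow> m + r \<in> T"
    unfolding eventually_at_right_field by auto
  have "m + b \<le> s" if s: "s \<in> C" for s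
  proof (rule ccontr)
    assume "\<not> m + b \<le> s"
    moreover have "m \<le> s" unfolding m_def using s C(2) by (rule cInf_lower)
    moreover have "s \<noteq> m" using s mT by (auto simp: C_def)
    ultimately show False using b(2)[of "s - m"] s by (auto simp: C_def)
  qed
  then have "m + b \<le> m" unfolding m_def using C(1) by (intro cInf_greatest)
  then show False using b by simp
qed

section \<open>Integral affine maps and translations\<close>

lemma TI_open_frequently:
  assumes "x \<in> TN N"
  shows "inf (nhds x) (principal (TI_open N {})) \<noteq> bot"
proof -
  \<comment> \<open>Replacing each infinite coordinate by \<open>- k\<close> approximates
    \<open>x\<close> by finite points; this makes limits along finite points unique.\<close>
  define f where "f k = (\<lambda>i. if x i = -\<infinity> then ereal (- real k) else x i)" for k
  have fI: "f k \<in> TI_open N {}" for k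
    using assms by (auto simp: f_def TI_open_def TN_def)
  have "f \<longlonglongrightarrow> x"
    unfolding tendsto_fun_iff
  proof
    fix i
    have "(\<lambda>k. ereal (- real k)) \<longlonglongrightarrow> -\<infinity>"
      unfolding tendsto_MInfty
    proof
      fix r :: real
      obtain m where "- r < real m" using reals_Archimedean2 by blast
      then show "\<forall>\<^sub>F k in sequentially. ereal (- real k) < ereal r"
        by (intro eventually_sequentiallyI[of m]) auto
    qed
    then show "(\<lambda>k. f k i) \<longlonglongrightarrow> x i" by (cases "x i = -\<infinity>") (simp_all add: f_def)
  qed
  then have "filterlim f (inf (nhds x) (principal (TI_open N {}))) sequentially"
    unfolding filterlim_inf filterlim_principal using fI by auto
  then have "eventually (\<lambda>_. False) sequentially" if "inf (nhds x) (principal (TI_open N {})) = bot"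
    unfolding that filterlim_iff by (elim allE[of _ "\<lambda>_. False"]) simp
  then show ?thesis by auto
qed

lemma maps_to_unique: "maps_to N M f x y \<Longrightarrow> maps_to N M f x z \<Longrightarrow> y = z"
  using tendsto_unique[OF TI_open_frequently] unfolding maps_to_def tendsto_fun_iff fun_eq_iff
  by metis

lemma linear_part_add: "linear_part N M f (v + w) = linear_part N M f v + linear_part N M f w"
  by (auto simp: linear_part_def fun_eq_iff algebra_simps sum.distrib)

lemma linear_part_rscale: "linear_part N M f (rscale a v) = rscale a (linear_part N M f v)"
  by (auto simp: linear_part_def rscale_def fun_eq_iff algebra_simps sum_distrib_left)

lemma linear_part_RN: "linear_part N M f v \<in> RN M"
  by (auto simp: linear_part_def RN_def)

lemma linear_part_realpart_translate:
  assumes "x \<in> TI_open N {}"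
  shows "linear_part N M f (realpart (translate x v)) = linear_part N M f (realpart x) + linear_part N M f v"
  unfolding linear_part_add[symmetric]
  by (auto simp: linear_part_def fun_eq_iff realpart_translate[OF assms] intro!: sum.cong)

lemma affine_value_translate:
  assumes "x \<in> TI_open N {}"
  shows "affine_value N M f (translate x v) = translate (affine_value N M f x) (linear_part N M f v)"
  unfolding affine_value_def linear_part_realpart_translate[OF assms]
  by (auto simp: translate_def fun_eq_iff linear_part_def zero_ereal_def)

lemma affine_value_precompose:
  "affine_value N M (precompose_translation N M f v) x = translate (affine_value N M f x) (linear_part N M f v)"
  by (auto simp: affine_value_def precompose_translation_def translate_def fun_eq_iff linear_part_def
      zero_ereal_def)

lemma translate_TN: "x \<in> TN N \<Longrightarrow> v \<in> RN N \<Longrightarrow> translate x v \<in> TN N"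
  using translate_TI_open[OF TI_open_sedentarity] TI_open_TN by blast

lemma tendsto_translate_const:
  "(f \<longlongrightarrow> x) F \<Longrightarrow> ((\<lambda>k. translate (f k) v) \<longlongrightarrow> translate x v) F"
  using tendsto_translate[OF _ tendsto_const[of 1], of f x F v] by simp

lemma RN_uminus: "v \<in> RN N \<Longrightarrow> - v \<in> RN N"
  by (simp add: RN_def)

lemma filterlim_translate:
  assumes "v \<in> RN N"
  shows "filterlim (\<lambda>x'. translate x' v) (inf (nhds (translate x v)) (principal (TI_open N {})))
     (inf (nhds x) (principal (TI_open N {})))"
  unfolding filterlim_inf filterlim_principal
proof
  show "filterlim (\<lambda>x'. translate x' v) (nhds (translate x v)) (inf (nhds x) (principal (TI_open N {})))"
    by (intro tendsto_translate_const) (rule tendsto_mono[OF inf_le1 filterlim_ident])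
  show "\<forall>\<^sub>F x' in inf (nhds x) (principal (TI_open N {})). translate x' v \<in> TI_open N {}"
    using translate_TI_open[OF _ assms] by (auto simp: eventually_inf_principal)
qed

text \<open>On finite points this is affine algebra. It extends to infinity because translation is a
  homeomorphism that preserves finiteness.\<close>

lemma maps_to_translate:
  assumes m: "maps_to N M f x y" and v: "v \<in> RN N"
  shows "maps_to N M f (translate x v) (translate y (linear_part N M f v))"
proof -
  let ?F = "\<lambda>x. inf (nhds x) (principal (TI_open N {}))"
  have x: "x \<in> TN N" and y: "y \<in> TN M" and lim: "(affine_value N M f \<longlongrightarrow> y) (?F x)"
    using m by (auto simp: maps_to_def)
  have "filterlim (\<lambda>x'. translate x' (- v)) (?F x) (?F (translate x v))"
    using filterlim_translate[OF RN_uminus[OF v], of "translate x v"] by (simp add: translate_translate)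
  then have "((\<lambda>x'. affine_value N M f (translate x' (- v))) \<longlongrightarrow> y) (?F (translate x v))"
    by (rule filterlim_compose[OF lim])
  then have "((\<lambda>x'. translate (affine_value N M f (translate x' (- v))) (linear_part N M f v))
      \<longlongrightarrow> translate y (linear_part N M f v)) (?F (translate x v))"
    by (rule tendsto_translate_const)
  moreover have "\<forall>\<^sub>F x' in ?F (translate x v).
      translate (affine_value N M f (translate x' (- v))) (linear_part N M f v) = affine_value N M f x'"
  proof -
    have "translate (affine_value N M f (translate x' (- v))) (linear_part N M f v) = affine_value N M f x'"
      if "x' \<in> TI_open N {}" for x'
      using affine_value_translate[OF translate_TI_open[OF that RN_uminus[OF v]], of M f v]
      by (simp add: translate_translate)
    then show ?thesis unfolding eventually_inf_principal by (intro always_eventually) blast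
  qed
  ultimately have "(affine_value N M f \<longlongrightarrow> translate y (linear_part N M f v)) (?F (translate x v))"
    by (rule Lim_transform_eventually)
  then show ?thesis
    using x y v translate_TN linear_part_RN by (auto simp: maps_to_def)
qed

lemma maps_to_precompose:
  assumes v: "v \<in> RN N" and x: "x \<in> TN N"
  shows "maps_to N M (precompose_translation N M f v) x z \<longleftrightarrow> maps_to N M f (translate x v) z"
proof -
  let ?F = "\<lambda>x. inf (nhds x) (principal (TI_open N {}))"
  let ?p = "affine_value N M (precompose_translation N M f v)"
  have eq: "?p x' = affine_value N M f (translate x' v)" if "x' \<in> TI_open N {}" for x'
    by (simp add: affine_value_precompose affine_value_translate[OF that])
  have "(?p \<longlongrightarrow> z) (?F x) \<longleftrightarrow> ((\<lambda>x'. affine_value N M f (translate x' v)) \<longlongrightarrow> z) (?F x)"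
    by (rule tendsto_cong) (auto simp: eventually_inf_principal eq)
  also have "\<dots> \<longleftrightarrow> (affine_value N M f \<longlongrightarrow> z) (?F (translate x v))"
  proof
    assume "(affine_value N M f \<longlongrightarrow> z) (?F (translate x v))"
    then show "((\<lambda>x'. affine_value N M f (translate x' v)) \<longlongrightarrow> z) (?F x)"
      by (rule filterlim_compose[OF _ filterlim_translate[OF v]])
  next
    assume *: "((\<lambda>x'. affine_value N M f (translate x' v)) \<longlongrightarrow> z) (?F x)"
    have "filterlim (\<lambda>x'. translate x' (- v)) (?F x) (?F (translate x v))"
      using filterlim_translate[OF RN_uminus[OF v], of "translate x v"] by (simp add: translate_translate)
    from filterlim_compose[OF * this] show "(affine_value N M f \<longlongrightarrow> z) (?F (translate x v))"
      by (simp add: translate_translate)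
  qed
  finally show ?thesis using x v translate_TN by (auto simp: maps_to_def)
qed

section \<open>Locally uniform eventual statements\<close>

lemma compactin_eventually_ball:
  assumes K: "compactin X K"
    and loc: "\<And>x. x \<in> K \<Longrightarrow> \<exists>G. openin X G \<and> x \<in> G \<and> (\<forall>\<^sub>F e in F. \<forall>q\<in>G. P e q)"
  shows "\<forall>\<^sub>F e in F. \<forall>q\<in>K. P e q"
proof -
  define \<G> where "\<G> = {G. openin X G \<and> (\<forall>\<^sub>F e in F. \<forall>q\<in>G. P e q)}"
  have "K \<subseteq> \<Union>\<G>" using loc by (auto simp: \<G>_def)
  moreover have "\<forall>G\<in>\<G>. openin X G" by (simp add: \<G>_def)
  ultimately obtain \<F> where \<F>: "finite \<F>" "\<F> \<subseteq> \<G>" "K \<subseteq> \<Union>\<F>"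
    using K unfolding compactin_def by metis
  have "\<forall>\<^sub>F e in F. \<forall>G\<in>\<F>. \<forall>q\<in>G. P e q"
    by (rule eventually_ball_finite[OF \<F>(1)]) (use \<F>(2) in \<open>auto simp: \<G>_def\<close>)
  then show ?thesis
    by (rule eventually_mono) (use \<F>(3) in blast)
qed

text \<open>The hypothesis of \<open>compactin_eventually_ball\<close> at one point, named so that
  finitely many conditions can be combined before compactness is used.\<close>

definition locally_eventually :: "'x topology \<Rightarrow> 'e filter \<Rightarrow> 'x \<Rightarrow> ('e \<Rightarrow> 'x \<Rightarrow> bool) \<Rightarrow> bool" where
  "locally_eventually X F x P \<longleftrightarrow> (\<exists>G. openin X G \<and> x \<in> G \<and> (\<forall>\<^sub>F e in F. \<forall>q\<in>G. P e q))"

lemma locally_eventually_mono: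
  assumes "locally_eventually X F x P" "\<And>e q. P e q \<Longrightarrow> Q e q"
  shows "locally_eventually X F x Q"
proof -
  obtain G where "openin X G" "x \<in> G" "\<forall>\<^sub>F e in F. \<forall>q\<in>G. P e q"
    using assms(1) unfolding locally_eventually_def by auto
  then show ?thesis unfolding locally_eventually_def
    by (intro exI[of _ G]) (auto intro: assms(2) elim!: eventually_mono)
qed

lemma locally_eventually_conj:
  assumes "locally_eventually X F x P" "locally_eventually X F x Q"
  shows "locally_eventually X F x (\<lambda>e q. P e q \<and> Q e q)"
proof -
  obtain G G' where "openin X G" "x \<in> G" "\<forall>\<^sub>F e in F. \<forall>q\<in>G. P e q"
    and "openin X G'" "x \<in> G'" "\<forall>\<^sub>F e in F. \<forall>q\<in>G'. Q e q"
    using assms unfolding locally_eventually_def by auto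
  then show ?thesis unfolding locally_eventually_def
    by (intro exI[of _ "G \<inter> G'"]) (auto intro: openin_Int elim: eventually_elim2)
qed

lemma locally_eventually_ball_finite:
  assumes "finite J" "x \<in> topspace X" "\<And>i. i \<in> J \<Longrightarrow> locally_eventually X F x (P i)"
  shows "locally_eventually X F x (\<lambda>e q. \<forall>i\<in>J. P i e q)"
  using assms(1,3)
proof (induction J)
  case empty
  then show ?case using assms(2) unfolding locally_eventually_def
    by (intro exI[of _ "topspace X"]) auto
next
  case (insert i J)
  then show ?case
    using locally_eventually_conj[of X F x "P i" "\<lambda>e q. \<forall>i\<in>J. P i e q"] by auto
qed

section \<open>Compact tropical spaces with thickened patches\<close>

locale thickened_atlas =
  fixes X :: "'x topology" and \<A> :: "('i, 'x) atlas" and V :: "'i \<Rightarrow> 'x set"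
    and c :: "'i \<Rightarrow> 'i \<Rightarrow> nat \<Rightarrow> real"
  assumes tropical: "tropical_space X \<A>"
    and compact: "compact_space X"
    and larger: "slightly_larger X \<A> V"
    and cocycle: "wave_cocycle \<A> c"
begin

abbreviation "Idx \<equiv> index \<A>"
abbreviation "U \<equiv> patch \<A>"
abbreviation "amb \<equiv> ambient \<A>"
abbreviation "\<phi> \<equiv> chart \<A>"
abbreviation "Y \<alpha> \<equiv> \<Union>(facets \<A> \<alpha>)"
abbreviation "clU \<alpha> \<equiv> X closure_of U \<alpha>"

lemma charts: "tropical_charts X \<A>"
  using tropical by (simp add: tropical_space_def)

lemma larger_charts: "tropical_charts X (\<A>\<lparr>patch := V\<rparr>)"
  using larger by (simp add: slightly_larger_def)

lemma finite_Idx: "finite Idx"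
  using charts by (simp add: tropical_charts_def)

lemma openin_U: "\<alpha> \<in> Idx \<Longrightarrow> openin X (U \<alpha>)"
  using charts by (simp add: tropical_charts_def)

lemma cover: "(\<Union>\<alpha>\<in>Idx. U \<alpha>) = topspace X"
  using charts by (simp add: tropical_charts_def)

lemma complex_balanced:
  "\<alpha> \<in> Idx \<Longrightarrow> \<exists>n. polyhedral_complex (amb \<alpha>) n (facets \<A> \<alpha>) \<and> balanced (amb \<alpha>) n (facets \<A> \<alpha>)"
  using charts by (simp add: tropical_charts_def)

lemma openin_V: "\<alpha> \<in> Idx \<Longrightarrow> openin X (V \<alpha>)"
  using larger_charts by (simp add: tropical_charts_def)

lemma V_topspace: "\<alpha> \<in> Idx \<Longrightarrow> V \<alpha> \<subseteq> topspace X"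
  using openin_V openin_subset by blast

lemma clU_V: "\<alpha> \<in> Idx \<Longrightarrow> clU \<alpha> \<subseteq> V \<alpha>"
  using larger by (simp add: slightly_larger_def)

lemma U_clU: "\<alpha> \<in> Idx \<Longrightarrow> U \<alpha> \<subseteq> clU \<alpha>"
  by (simp add: closure_of_subset openin_U openin_subset)

lemma U_V: "\<alpha> \<in> Idx \<Longrightarrow> U \<alpha> \<subseteq> V \<alpha>"
  using U_clU clU_V by blast

lemma embedding: "\<alpha> \<in> Idx \<Longrightarrow> embedding_map (subtopology X (V \<alpha>)) (top_of_set (Y \<alpha>)) (\<phi> \<alpha>)"
  using larger_charts by (simp add: tropical_charts_def)

lemma open_chart: "\<alpha> \<in> Idx \<Longrightarrow> open_map (subtopology X (V \<alpha>)) (top_of_set (Y \<alpha>)) (\<phi> \<alpha>)"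
  using larger_charts by (simp add: tropical_charts_def)

lemma overlap_maps_to:
  "\<alpha> \<in> Idx \<Longrightarrow> \<beta> \<in> Idx \<Longrightarrow> x \<in> V \<alpha> \<Longrightarrow> x \<in> V \<beta> \<Longrightarrow>
    maps_to (amb \<alpha>) (amb \<beta>) (overlap \<A> \<alpha> \<beta>) (\<phi> \<alpha> x) (\<phi> \<beta> x)"
  using larger_charts by (simp add: tropical_charts_def)

text \<open>The cochain lives on overlaps of the \<open>U\<close>, while points are moved in
  overlaps of the \<open>V\<close>; the last clause of \<open>slightly_larger\<close> extends the
  sections.\<close>

lemma wave_section:
  assumes "\<alpha> \<in> Idx" "\<beta> \<in> Idx"
  shows "c \<alpha> \<beta> \<in> RN (amb \<alpha>)" and "x \<in> V \<alpha> \<Longrightarrow> x \<in> V \<beta> \<Longrightarrow> c \<alpha> \<beta> \<in> wave_at \<A> \<alpha> x"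
proof -
  have "c \<alpha> \<beta> \<in> wave_sections \<A> \<alpha> (U \<alpha> \<inter> U \<beta>)"
    using cocycle assms by (simp add: wave_cocycle_def)
  then have "c \<alpha> \<beta> \<in> wave_sections \<A> \<alpha> (V \<alpha> \<inter> V \<beta>)"
    using larger assms unfolding slightly_larger_def by blast
  then show "c \<alpha> \<beta> \<in> RN (amb \<alpha>)" "x \<in> V \<alpha> \<Longrightarrow> x \<in> V \<beta> \<Longrightarrow> c \<alpha> \<beta> \<in> wave_at \<A> \<alpha> x"
    by (auto simp: wave_sections_def)
qed

lemma same_stratum_refl:
  assumes "x \<in> topspace X"
  shows "same_stratum X \<A> x x"
proof -
  obtain \<alpha> where "\<alpha> \<in> Idx" "x \<in> U \<alpha>" using assms cover by blast
  then show ?thesis unfolding same_stratum_def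
    by (intro exI[of _ "\<lambda>_. x"]) (use assms in \<open>auto simp: pathin_def\<close>)
qed

text \<open>The component through \<open>x\<close> of a stratum is not lost by the shrinking.\<close>

lemma patches_meet:
  assumes B: "B \<subseteq> Idx" "B \<noteq> {}" and x: "\<And>\<beta>. \<beta> \<in> B \<Longrightarrow> x \<in> V \<beta>"
  shows "(\<Inter>\<beta>\<in>B. U \<beta>) \<noteq> {}"
proof -
  let ?G = "\<Inter>\<beta>\<in>B. V \<beta>" and ?S = "{y. same_stratum X \<A> x y}"
  have xX: "x \<in> topspace X" using B x V_topspace by blast
  then have xS: "x \<in> topspace (subtopology X (?S \<inter> ?G))"
    using x same_stratum_refl by auto
  have "?S \<in> strata X \<A>" using xX by (auto simp: strata_def)
  moreover have "connected_component_of_set (subtopology X (?S \<inter> ?G)) x \<in>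
      connected_components_of (subtopology X (?S \<inter> ?G))"
    unfolding connected_components_of_def using xS by (rule imageI)
  ultimately have C: "connected_component_of_set (subtopology X (?S \<inter> ?G)) x \<in> strata_in X \<A> ?G"
    unfolding strata_in_def by (rule UN_I)
  have "\<forall>B\<subseteq>Idx. B \<noteq> {} \<longrightarrow> (\<forall>C\<in>strata_in X \<A> (\<Inter>\<beta>\<in>B. V \<beta>). C \<inter> (\<Inter>\<beta>\<in>B. U \<beta>) \<noteq> {})"
    using larger by (simp add: slightly_larger_def)
  then have "connected_component_of_set (subtopology X (?S \<inter> ?G)) x \<inter> (\<Inter>\<beta>\<in>B. U \<beta>) \<noteq> {}"
    using B C by metis
  then show ?thesis by blast
qed

text \<open>The cocycle condition is imposed only where three patches \<open>U\<close> meet. By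
  \<open>patches_meet\<close> they do whenever the thickened ones share a point.\<close>

lemma cocycle_eq:
  assumes "\<alpha> \<in> Idx" "\<beta> \<in> Idx" "\<gamma> \<in> Idx" "x \<in> V \<alpha>" "x \<in> V \<beta>" "x \<in> V \<gamma>"
  shows "c \<alpha> \<gamma> = c \<alpha> \<beta> + wave_transport \<A> \<beta> \<alpha> (c \<beta> \<gamma>)"
proof -
  have "(\<Inter>\<delta>\<in>{\<alpha>, \<beta>, \<gamma>}. U \<delta>) \<noteq> {}"
    by (rule patches_meet) (use assms in auto)
  then have "U \<alpha> \<inter> U \<beta> \<inter> U \<gamma> \<noteq> {}" by auto
  then show ?thesis using cocycle assms(1-3) unfolding wave_cocycle_def by blast
qed

lemma chart_inj: "\<alpha> \<in> Idx \<Longrightarrow> inj_on (\<phi> \<alpha>) (V \<alpha>)"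
  using embedding[of \<alpha>] V_topspace[of \<alpha>] unfolding embedding_map_def
  by (metis homeomorphic_imp_injective_map topspace_subtopology_subset)

lemma chart_eq_iff: "\<alpha> \<in> Idx \<Longrightarrow> p \<in> V \<alpha> \<Longrightarrow> q \<in> V \<alpha> \<Longrightarrow> \<phi> \<alpha> p = \<phi> \<alpha> q \<longleftrightarrow> p = q"
  using chart_inj by (auto dest: inj_onD)

lemma chart_continuous:
  assumes "\<alpha> \<in> Idx"
  shows "continuous_map (subtopology X (V \<alpha>)) (top_of_set (Y \<alpha>)) (\<phi> \<alpha>)"
  using embedding[OF assms] unfolding embedding_map_def
  by (rule homeomorphic_imp_continuous_map[THEN continuous_map_into_fulltopology])

lemma chart_in_Y:
  assumes "\<alpha> \<in> Idx" "x \<in> V \<alpha>"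
  shows "\<phi> \<alpha> x \<in> Y \<alpha>"
  using continuous_map_image_subset_topspace[OF chart_continuous[OF assms(1)]] V_topspace[OF assms(1)] assms(2)
  by auto

lemma Y_TN: "\<alpha> \<in> Idx \<Longrightarrow> Y \<alpha> \<subseteq> TN (amb \<alpha>)"
  using complex_balanced complex_subset_TN by blast

lemma chart_in_TN: "\<alpha> \<in> Idx \<Longrightarrow> x \<in> V \<alpha> \<Longrightarrow> \<phi> \<alpha> x \<in> TN (amb \<alpha>)"
  using chart_in_Y Y_TN by blast

lemma open_chart_image:
  assumes "\<alpha> \<in> Idx" "openin X W" "W \<subseteq> V \<alpha>"
  obtains Q where "open Q" "\<phi> \<alpha> ` W = Y \<alpha> \<inter> Q"
proof -
  have "openin (subtopology X (V \<alpha>)) W"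
    using assms by (simp add: openin_open_subtopology openin_V)
  then have "openin (top_of_set (Y \<alpha>)) (\<phi> \<alpha> ` W)"
    using open_chart[OF assms(1)] by (simp add: open_map_def)
  then show thesis using that by (auto simp: openin_open)
qed

lemma openin_chart_preimage:
  assumes "\<alpha> \<in> Idx" "open Q"
  shows "openin X {x \<in> V \<alpha>. \<phi> \<alpha> x \<in> Q}"
proof -
  have "openin (top_of_set (Y \<alpha>)) (Y \<alpha> \<inter> Q)" using assms(2) by (auto simp: openin_open)
  then have "openin (subtopology X (V \<alpha>)) {x \<in> topspace (subtopology X (V \<alpha>)). \<phi> \<alpha> x \<in> Y \<alpha> \<inter> Q}"
    by (rule openin_continuous_map_preimage[OF chart_continuous[OF assms(1)]])
  moreover have "{x \<in> topspace (subtopology X (V \<alpha>)). \<phi> \<alpha> x \<in> Y \<alpha> \<inter> Q} = {x \<in> V \<alpha>. \<phi> \<alpha> x \<in> Q}"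
    using chart_in_Y[OF assms(1)] V_topspace[OF assms(1)] by auto
  ultimately show ?thesis
    using openin_open_subtopology[OF openin_V[OF assms(1)]] by auto
qed

section \<open>Shifting points of the space in a chart\<close>

text \<open>A relation and not a map, because the translated point may leave the complex or the
  thickened patch.\<close>

definition shift :: "real \<Rightarrow> 'i \<Rightarrow> (nat \<Rightarrow> real) \<Rightarrow> 'x \<Rightarrow> 'x \<Rightarrow> bool" where
  "shift e \<alpha> v q p \<longleftrightarrow> q \<in> V \<alpha> \<and> p \<in> V \<alpha> \<and> \<phi> \<alpha> p = translate (\<phi> \<alpha> q) (rscale e v)"

lemma shift_uminus: "shift e \<alpha> v q p \<Longrightarrow> shift e \<alpha> (- v) p q"
  by (auto simp: shift_def translate_translate rv.scale_minus_right)

lemma shift_trans: "shift e \<alpha> v q p \<Longrightarrow> shift e \<alpha> w p r \<Longrightarrow> shift e \<alpha> (v + w) q r"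
  by (auto simp: shift_def translate_translate rv.scale_right_distrib)

text \<open>The overlap map turns the translation into one by the transported vector. Both sides are
  values of its continuous extension at one point, hence equal.\<close>

lemma shift_transport:
  assumes "\<alpha> \<in> Idx" "\<beta> \<in> Idx" "shift e \<alpha> v q p" "q \<in> V \<beta>" "p \<in> V \<beta>" "v \<in> RN (amb \<alpha>)"
  shows "shift e \<beta> (wave_transport \<A> \<alpha> \<beta> v) q p"
proof -
  have "maps_to (amb \<alpha>) (amb \<beta>) (overlap \<A> \<alpha> \<beta>) (translate (\<phi> \<alpha> q) (rscale e v))
      (translate (\<phi> \<beta> q) (linear_part (amb \<alpha>) (amb \<beta>) (overlap \<A> \<alpha> \<beta>) (rscale e v)))"
  proof -
    have "q \<in> V \<alpha>" using assms(3) by (simp add: shift_def)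
    from maps_to_translate[OF overlap_maps_to[OF assms(1,2) this assms(4)] RN_rscale[OF assms(6)]]
    show ?thesis .
  qed
  moreover have "maps_to (amb \<alpha>) (amb \<beta>) (overlap \<A> \<alpha> \<beta>) (translate (\<phi> \<alpha> q) (rscale e v)) (\<phi> \<beta> p)"
    using overlap_maps_to[of \<alpha> \<beta> p] assms by (auto simp: shift_def)
  ultimately have "translate (\<phi> \<beta> q) (linear_part (amb \<alpha>) (amb \<beta>) (overlap \<A> \<alpha> \<beta>) (rscale e v)) = \<phi> \<beta> p"
    by (rule maps_to_unique)
  then show ?thesis using assms by (simp add: shift_def wave_transport_def linear_part_rscale)
qed

lemma shift_local:
  assumes \<alpha>: "\<alpha> \<in> Idx" and x: "x \<in> V \<alpha>" "x \<in> W" and W: "openin X W"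
  shows "locally_eventually X (at_right 0) x (\<lambda>e q. \<forall>p. shift e \<alpha> v q p \<longrightarrow> p \<in> W)"
proof -
  obtain Q where Q: "open Q" "\<phi> \<alpha> ` (W \<inter> V \<alpha>) = Y \<alpha> \<inter> Q"
    by (rule open_chart_image[OF \<alpha> openin_Int[OF W openin_V[OF \<alpha>]]]) auto
  have "\<phi> \<alpha> x \<in> Q" using Q x by auto
  then obtain G d where G: "open G" "\<phi> \<alpha> x \<in> G" "d > (0::real)"
    "\<And>y s. y \<in> G \<Longrightarrow> \<bar>s\<bar> < d \<Longrightarrow> translate y (rscale s v) \<in> Q"
    using translate_into_open[OF Q(1)] by metis
  let ?G = "{q \<in> V \<alpha>. \<phi> \<alpha> q \<in> G}"
  have "p \<in> W" if q: "q \<in> ?G" and e: "0 < e" "e < d" and p: "shift e \<alpha> v q p" for e q p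
  proof -
    have pV: "p \<in> V \<alpha>" using p by (simp add: shift_def)
    have "\<phi> \<alpha> p \<in> Q" using G(4)[of "\<phi> \<alpha> q" e] q e p by (simp add: shift_def)
    then have "\<phi> \<alpha> p \<in> \<phi> \<alpha> ` (W \<inter> V \<alpha>)" unfolding Q(2) using chart_in_Y[OF \<alpha> pV] by blast
    then show ?thesis using pV chart_eq_iff[OF \<alpha>] by auto
  qed
  moreover have "\<forall>\<^sub>F e in at_right 0. 0 < e \<and> e < d"
    using G(3) unfolding eventually_at_right_field by auto
  ultimately have "\<forall>\<^sub>F e in at_right 0. \<forall>q\<in>?G. \<forall>p. shift e \<alpha> v q p \<longrightarrow> p \<in> W"
    by (auto elim!: eventually_mono)
  then show ?thesis unfolding locally_eventually_def
    using openin_chart_preimage[OF \<alpha> G(1)] G(2) x by blast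
qed

text \<open>A point moved along a wave vector can only leave the complex after leaving the region where
  that vector is a wave vector.\<close>

lemma shift_exists_local:
  assumes \<alpha>: "\<alpha> \<in> Idx" "\<beta> \<in> Idx" and x: "x \<in> V \<alpha>" "x \<in> V \<beta>"
  shows "locally_eventually X (at_right 0) x (\<lambda>e q. \<exists>p. p \<in> V \<beta> \<and> shift e \<alpha> (c \<alpha> \<beta>) q p)"
proof -
  let ?v = "c \<alpha> \<beta>"
  obtain n where complex: "polyhedral_complex (amb \<alpha>) n (facets \<A> \<alpha>)" using complex_balanced[OF \<alpha>(1)] by auto
  obtain Q where Q: "open Q" "\<phi> \<alpha> ` (V \<alpha> \<inter> V \<beta>) = Y \<alpha> \<inter> Q"
    by (rule open_chart_image[OF \<alpha>(1) openin_Int[OF openin_V[OF \<alpha>(1)] openin_V[OF \<alpha>(2)]]]) auto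
  have "\<phi> \<alpha> x \<in> Q" using Q x by auto
  then obtain G d where G: "open G" "\<phi> \<alpha> x \<in> G" "d > (0::real)"
    "\<And>y s. y \<in> G \<Longrightarrow> \<bar>s\<bar> < d \<Longrightarrow> translate y (rscale s ?v) \<in> Q"
    using translate_into_open[OF Q(1)] by metis
  have vR: "?v \<in> RN (amb \<alpha>)" using wave_section(1)[OF \<alpha>] .
  let ?G = "{q \<in> V \<alpha>. \<phi> \<alpha> q \<in> G}"
  have "\<exists>p. p \<in> V \<beta> \<and> shift e \<alpha> ?v q p" if q: "q \<in> ?G" and e: "0 < e" "e < d" for e q
  proof -
    let ?T = "{s. translate (\<phi> \<alpha> q) (rscale s ?v) \<in> Y \<alpha>}"
    \<comment> \<open>Up to time \<open>d\<close> the line stays in \<open>Q\<close>, so whenever it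
      is in the complex it is in the overlap of the thickened patches. There \<open>?v\<close> is a
      wave vector and the motion can be resumed.\<close>
    have "e \<in> ?T"
    proof (rule continuous_induction)
      show "closed ?T"
        using q chart_in_TN[OF \<alpha>(1)] vR by (intro closed_line_in_complex[OF complex]) auto
      show "0 \<in> ?T" using q chart_in_Y[OF \<alpha>(1)] by simp
      show "\<forall>\<^sub>F r in at_right 0. s + r \<in> ?T" if s: "s \<in> ?T" "0 \<le> s" "s < d" for s
      proof -
        have "translate (\<phi> \<alpha> q) (rscale s ?v) \<in> \<phi> \<alpha> ` (V \<alpha> \<inter> V \<beta>)"
          unfolding Q(2) using s q G(4)[of "\<phi> \<alpha> q" s] by auto
        then obtain p where p: "p \<in> V \<alpha> \<inter> V \<beta>" "\<phi> \<alpha> p = translate (\<phi> \<alpha> q) (rscale s ?v)"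
          by (rule imageE) (simp add: that)
        have "?v \<in> wave_space (amb \<alpha>) (facets \<A> \<alpha>) (\<phi> \<alpha> p)"
          using wave_section(2)[OF \<alpha>, of p] p(1) by (simp add: wave_at_def)
        then have "\<forall>\<^sub>F r in at_right 0. translate (\<phi> \<alpha> p) (rscale r ?v) \<in> Y \<alpha>"
          using wave_space_translate[OF complex chart_in_Y[OF \<alpha>(1)]] p(1) by simp
        then show ?thesis by (simp add: p(2) translate_translate rv.scale_left_distrib)
      qed
    qed (use e in auto)
    then have "translate (\<phi> \<alpha> q) (rscale e ?v) \<in> \<phi> \<alpha> ` (V \<alpha> \<inter> V \<beta>)"
      unfolding Q(2) using q e G(4)[of "\<phi> \<alpha> q" e] by auto
    then obtain p where "p \<in> V \<alpha> \<inter> V \<beta>" "\<phi> \<alpha> p = translate (\<phi> \<alpha> q) (rscale e ?v)"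
      by (rule imageE) (simp add: that)
    then show ?thesis using q by (auto simp: shift_def)
  qed
  moreover have "\<forall>\<^sub>F e in at_right 0. 0 < e \<and> e < d"
    using G(3) unfolding eventually_at_right_field by auto
  ultimately have "\<forall>\<^sub>F e in at_right 0. \<forall>q\<in>?G. \<exists>p. p \<in> V \<beta> \<and> shift e \<alpha> ?v q p"
    by (auto elim!: eventually_mono)
  then show ?thesis unfolding locally_eventually_def
    using openin_chart_preimage[OF \<alpha>(1) G(1)] G(2) x by blast
qed

text \<open>One move made by the gluing, or none. The negative sign allows a move to be undone in
  the same chart. Starting points are confined to the closed set \<open>clU \<alpha>\<close>: a
  point of it lies in \<open>V \<alpha>\<close>, where \<open>shift_local\<close> applies, and a
  point outside has a neighbourhood where chart \<open>\<alpha>\<close> contributes no move.\<close>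

definition near :: "real \<Rightarrow> 'x \<Rightarrow> 'x \<Rightarrow> bool" where
  "near e q p \<longleftrightarrow> q = p \<or> (\<exists>\<alpha>\<in>Idx. \<exists>\<beta>\<in>Idx. q \<in> clU \<alpha> \<and> (shift e \<alpha> (c \<alpha> \<beta>) q p \<or> shift e \<alpha> (- c \<alpha> \<beta>) q p))"

lemma near_refl: "near e q q"
  by (simp add: near_def)

lemma near_local:
  assumes x: "x \<in> W" and W: "openin X W"
  shows "locally_eventually X (at_right 0) x (\<lambda>e q. \<forall>p. near e q p \<longrightarrow> p \<in> W)"
proof -
  have xX: "x \<in> topspace X" using x W openin_subset by blast
  have "locally_eventually X (at_right 0) x (\<lambda>e q. \<forall>\<beta>\<in>Idx. \<forall>p. q \<in> clU \<alpha> \<and>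
      (shift e \<alpha> (c \<alpha> \<beta>) q p \<or> shift e \<alpha> (- c \<alpha> \<beta>) q p) \<longrightarrow> p \<in> W)" if \<alpha>: "\<alpha> \<in> Idx" for \<alpha>
  proof (cases "x \<in> clU \<alpha>")
    case True
    then have xV: "x \<in> V \<alpha>" using clU_V[OF \<alpha>] by auto
    have "locally_eventually X (at_right 0) x (\<lambda>e q. (\<forall>p. shift e \<alpha> (c \<alpha> \<beta>) q p \<longrightarrow> p \<in> W) \<and>
        (\<forall>p. shift e \<alpha> (- c \<alpha> \<beta>) q p \<longrightarrow> p \<in> W))" for \<beta>
      by (intro locally_eventually_conj shift_local \<alpha> xV x W)
    then have "locally_eventually X (at_right 0) x (\<lambda>e q. \<forall>\<beta>\<in>Idx. (\<forall>p. shift e \<alpha> (c \<alpha> \<beta>) q p \<longrightarrow> p \<in> W) \<and>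
        (\<forall>p. shift e \<alpha> (- c \<alpha> \<beta>) q p \<longrightarrow> p \<in> W))"
      by (rule locally_eventually_ball_finite[OF finite_Idx xX])
    then show ?thesis by (rule locally_eventually_mono) blast
  next
    case False
    have "openin X (topspace X - clU \<alpha>)" by (intro openin_diff) auto
    then show ?thesis unfolding locally_eventually_def
      using False xX by (intro exI[of _ "topspace X - clU \<alpha>"]) auto
  qed
  then have "locally_eventually X (at_right 0) x (\<lambda>e q. \<forall>\<alpha>\<in>Idx. \<forall>\<beta>\<in>Idx. \<forall>p. q \<in> clU \<alpha> \<and>
      (shift e \<alpha> (c \<alpha> \<beta>) q p \<or> shift e \<alpha> (- c \<alpha> \<beta>) q p) \<longrightarrow> p \<in> W)"
    by (rule locally_eventually_ball_finite[OF finite_Idx xX])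
  moreover have "locally_eventually X (at_right 0) x (\<lambda>e q. q \<in> W)"
    unfolding locally_eventually_def using x W by auto
  ultimately have "locally_eventually X (at_right 0) x (\<lambda>e q. q \<in> W \<and> (\<forall>\<alpha>\<in>Idx. \<forall>\<beta>\<in>Idx. \<forall>p. q \<in> clU \<alpha> \<and>
      (shift e \<alpha> (c \<alpha> \<beta>) q p \<or> shift e \<alpha> (- c \<alpha> \<beta>) q p) \<longrightarrow> p \<in> W))"
    by (intro locally_eventually_conj)
  then show ?thesis
    by (rule locally_eventually_mono) (auto simp: near_def)
qed

lemma near_near_local:
  assumes x: "x \<in> W" and W: "openin X W"
  shows "locally_eventually X (at_right 0) x (\<lambda>e q. \<forall>p r. near e q p \<and> near e p r \<longrightarrow> r \<in> W)"
proof -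
  obtain G where G: "openin X G" "x \<in> G" and ev: "\<forall>\<^sub>F e in at_right 0. \<forall>p\<in>G. \<forall>r. near e p r \<longrightarrow> r \<in> W"
    using near_local[OF x W] unfolding locally_eventually_def by blast
  obtain G' where G': "openin X G'" "x \<in> G'" and ev': "\<forall>\<^sub>F e in at_right 0. \<forall>q\<in>G'. \<forall>p. near e q p \<longrightarrow> p \<in> G"
    using near_local[OF G(2,1)] unfolding locally_eventually_def by blast
  from ev ev' have "\<forall>\<^sub>F e in at_right 0. \<forall>q\<in>G'. \<forall>p r. near e q p \<and> near e p r \<longrightarrow> r \<in> W"
    by eventually_elim blast
  then show ?thesis unfolding locally_eventually_def using G' by blast
qed

lemma compactin_clU: "compactin X (clU \<alpha>)"
  using compact by (simp add: closedin_compact_space)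

text \<open>A point glued to a point of \<open>U \<beta>\<close> may lie outside the closure of \<open>U \<beta>\<close>.  The last clause
  says that it can be moved nevertheless, together with its neighbours.\<close>

definition small :: "real \<Rightarrow> bool" where
  "small e \<longleftrightarrow>
     (\<forall>\<alpha>\<in>Idx. \<forall>q\<in>clU \<alpha>. \<forall>p r. near e q p \<and> near e p r \<longrightarrow> r \<in> V \<alpha>) \<and>
     (\<forall>x\<in>topspace X. \<exists>\<gamma>\<in>Idx. \<forall>p r. near e x p \<and> near e p r \<longrightarrow> r \<in> U \<gamma>) \<and>
     (\<forall>\<alpha>\<in>Idx. \<forall>\<beta>\<in>Idx. \<forall>p\<in>clU \<beta>. \<forall>q\<in>clU \<alpha>. near e p q \<longrightarrow>
        (\<exists>G. openin X G \<and> q \<in> G \<and> (\<forall>q'\<in>G. \<exists>p'. p' \<in> V \<beta> \<and> shift e \<alpha> (c \<alpha> \<beta>) q' p')))"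

lemma eventually_small: "\<forall>\<^sub>F e in at_right 0. small e"
  unfolding small_def
proof (intro eventually_conj)
  show "\<forall>\<^sub>F e in at_right 0. \<forall>\<alpha>\<in>Idx. \<forall>q\<in>clU \<alpha>. \<forall>p r. near e q p \<and> near e p r \<longrightarrow> r \<in> V \<alpha>"
  proof (rule eventually_ball_finite[OF finite_Idx], rule ballI, rule compactin_eventually_ball[OF compactin_clU])
    fix \<alpha> x assume \<alpha>: "\<alpha> \<in> Idx" and x: "x \<in> clU \<alpha>"
    then show "\<exists>G. openin X G \<and> x \<in> G \<and> (\<forall>\<^sub>F e in at_right 0. \<forall>q\<in>G. \<forall>p r. near e q p \<and> near e p r \<longrightarrow> r \<in> V \<alpha>)"
      using near_near_local[of x "V \<alpha>"] clU_V openin_V unfolding locally_eventually_def by blast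
  qed
  show "\<forall>\<^sub>F e in at_right 0. \<forall>x\<in>topspace X. \<exists>\<gamma>\<in>Idx. \<forall>p r. near e x p \<and> near e p r \<longrightarrow> r \<in> U \<gamma>"
  proof (rule compactin_eventually_ball)
    show "compactin X (topspace X)" using compact by (simp add: compact_space_def)
    fix x assume "x \<in> topspace X"
    then obtain \<gamma> where \<gamma>: "\<gamma> \<in> Idx" "x \<in> U \<gamma>" using cover by blast
    have "locally_eventually X (at_right 0) x (\<lambda>e q. \<exists>\<gamma>\<in>Idx. \<forall>p r. near e q p \<and> near e p r \<longrightarrow> r \<in> U \<gamma>)"
      using near_near_local[OF \<gamma>(2) openin_U[OF \<gamma>(1)]] by (rule locally_eventually_mono) (use \<gamma>(1) in blast)
    then show "\<exists>G. openin X G \<and> x \<in> G \<and> (\<forall>\<^sub>F e in at_right 0. \<forall>q\<in>G. \<exists>\<gamma>\<in>Idx. \<forall>p r. near e q p \<and> near e p r \<longrightarrow> r \<in> U \<gamma>)"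
      unfolding locally_eventually_def .
  qed
  show "\<forall>\<^sub>F e in at_right 0. \<forall>\<alpha>\<in>Idx. \<forall>\<beta>\<in>Idx. \<forall>p\<in>clU \<beta>. \<forall>q\<in>clU \<alpha>. near e p q \<longrightarrow>
        (\<exists>G. openin X G \<and> q \<in> G \<and> (\<forall>q'\<in>G. \<exists>p'. p' \<in> V \<beta> \<and> shift e \<alpha> (c \<alpha> \<beta>) q' p'))"
  proof (rule eventually_ball_finite[OF finite_Idx], rule ballI, rule eventually_ball_finite[OF finite_Idx],
      rule ballI, rule compactin_eventually_ball[OF compactin_clU])
    fix \<alpha> \<beta> x assume \<alpha>: "\<alpha> \<in> Idx" "\<beta> \<in> Idx" and x: "x \<in> clU \<beta>"
    let ?P = "\<lambda>e p. \<forall>q\<in>clU \<alpha>. near e p q \<longrightarrow>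
        (\<exists>G. openin X G \<and> q \<in> G \<and> (\<forall>q'\<in>G. \<exists>p'. p' \<in> V \<beta> \<and> shift e \<alpha> (c \<alpha> \<beta>) q' p'))"
    have "locally_eventually X (at_right 0) x ?P"
    \<comment> \<open>If \<open>x\<close> lies in both closures, the target of a short move still
      lies in the neighbourhood where \<open>shift_exists_local\<close> holds. Otherwise short moves
      from near \<open>x\<close> never reach \<open>clU \<alpha>\<close>.\<close>
    proof (cases "x \<in> clU \<alpha>")
      case True
      then have xV: "x \<in> V \<alpha>" "x \<in> V \<beta>" using x clU_V \<alpha> by auto
      obtain G where G: "openin X G" "x \<in> G" and
        ev: "\<forall>\<^sub>F e in at_right 0. \<forall>q\<in>G. \<exists>p. p \<in> V \<beta> \<and> shift e \<alpha> (c \<alpha> \<beta>) q p"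
        using shift_exists_local[OF \<alpha> xV] unfolding locally_eventually_def by blast
      obtain G' where G': "openin X G'" "x \<in> G'" and
        ev': "\<forall>\<^sub>F e in at_right 0. \<forall>p\<in>G'. \<forall>q. near e p q \<longrightarrow> q \<in> G"
        using near_local[OF G(2,1)] unfolding locally_eventually_def by blast
      from ev ev' have "\<forall>\<^sub>F e in at_right 0. \<forall>p\<in>G'. ?P e p"
        by eventually_elim (use G(1) in blast)
      then show ?thesis unfolding locally_eventually_def using G' by blast
    next
      case False
      have "openin X (topspace X - clU \<alpha>)" by (intro openin_diff) auto
      moreover have "x \<in> topspace X - clU \<alpha>" using False x in_closure_of by fastforce
      ultimately have "locally_eventually X (at_right 0) x (\<lambda>e p. \<forall>q. near e p q \<longrightarrow> q \<in> topspace X - clU \<alpha>)"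
        by (intro near_local)
      then show ?thesis by (rule locally_eventually_mono) blast
    qed
    then show "\<exists>G. openin X G \<and> x \<in> G \<and> (\<forall>\<^sub>F e in at_right 0. \<forall>p\<in>G. ?P e p)"
      unfolding locally_eventually_def .
  qed
qed

end

section \<open>The gluing relation for small deformations\<close>

locale small_deformation = thickened_atlas X \<A> V c
  for X :: "'x topology" and \<A> :: "('i, 'x) atlas" and V c +
  fixes e :: real
  assumes small: "small e"
begin

lemma near_near_V: "\<alpha> \<in> Idx \<Longrightarrow> q \<in> clU \<alpha> \<Longrightarrow> near e q p \<Longrightarrow> near e p r \<Longrightarrow> r \<in> V \<alpha>"
  using small unfolding small_def by (elim conjE) blast

lemma near_V: "\<alpha> \<in> Idx \<Longrightarrow> q \<in> clU \<alpha> \<Longrightarrow> near e q p \<Longrightarrow> p \<in> V \<alpha>"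
  using near_near_V near_refl by blast

lemma common_patch:
  assumes "x \<in> topspace X"
  obtains \<gamma> where "\<gamma> \<in> Idx" "x \<in> U \<gamma>" "\<And>p. near e x p \<Longrightarrow> p \<in> U \<gamma>"
proof -
  obtain \<gamma> where "\<gamma> \<in> Idx" "\<forall>p r. near e x p \<and> near e p r \<longrightarrow> r \<in> U \<gamma>"
    using small assms unfolding small_def by (elim conjE) blast
  then show thesis using that[of \<gamma>] near_refl by blast
qed

lemma shift_exists:
  assumes "\<alpha> \<in> Idx" "\<beta> \<in> Idx" "p \<in> clU \<beta>" "q \<in> clU \<alpha>" "near e p q"
  shows "\<exists>G. openin X G \<and> q \<in> G \<and> (\<forall>q'\<in>G. \<exists>p'. p' \<in> V \<beta> \<and> shift e \<alpha> (c \<alpha> \<beta>) q' p')"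
  using small[unfolded small_def, THEN conjunct2, THEN conjunct2, rule_format, OF assms] .

text \<open>The cocycle identity for a single index kills the transport of
  \<open>c \<alpha> \<alpha>\<close> by the self-overlap. Applied to a shift, which exists by
  smallness, the transport shows that this shift leaves \<open>q\<close> fixed.\<close>

lemma shift_self:
  assumes \<alpha>: "\<alpha> \<in> Idx" and q: "q \<in> U \<alpha>"
  shows "shift e \<alpha> (c \<alpha> \<alpha>) q q"
proof -
  have qcl: "q \<in> clU \<alpha>" and qV: "q \<in> V \<alpha>" using U_clU[OF \<alpha>] U_V[OF \<alpha>] q by auto
  obtain p where p: "shift e \<alpha> (c \<alpha> \<alpha>) q p"
    using shift_exists[OF \<alpha> \<alpha> qcl qcl near_refl] by blast
  have "wave_transport \<A> \<alpha> \<alpha> (c \<alpha> \<alpha>) = 0"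
    using cocycle_eq[OF \<alpha> \<alpha> \<alpha> qV qV qV] by simp
  then have "shift e \<alpha> 0 q p"
    using shift_transport[OF \<alpha> \<alpha> p _ _ wave_section(1)[OF \<alpha> \<alpha>]] p by (simp add: shift_def)
  then have "p = q" using chart_eq_iff[OF \<alpha>, of p q] by (simp add: shift_def)
  then show ?thesis using p by simp
qed

text \<open>Unlike in the deformed gluing, the moved point \<open>p\<close> need only lie in
  \<open>V \<alpha>\<close>, not in \<open>U \<alpha>\<close>. The memberships
  \<open>q \<in> V \<beta>\<close> and \<open>p \<in> V \<alpha>\<close> allow the shift to be read
  in either chart.\<close>

definition glued :: "'i \<Rightarrow> 'x \<Rightarrow> 'i \<Rightarrow> 'x \<Rightarrow> bool" where
  "glued \<alpha> q \<beta> p \<longleftrightarrow> \<alpha> \<in> Idx \<and> \<beta> \<in> Idx \<and> q \<in> U \<alpha> \<and> p \<in> U \<beta> \<and> q \<in> V \<beta> \<and> p \<in> V \<alpha> \<and>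
     shift e \<alpha> (c \<alpha> \<beta>) q p"

lemma glued_refl: "\<alpha> \<in> Idx \<Longrightarrow> q \<in> U \<alpha> \<Longrightarrow> glued \<alpha> q \<alpha> q"
  using shift_self U_V by (auto simp: glued_def)

lemma glued_same_patch:
  assumes "glued \<alpha> q \<alpha> p"
  shows "p = q"
proof -
  have \<alpha>: "\<alpha> \<in> Idx" "q \<in> U \<alpha>" "p \<in> V \<alpha>" "q \<in> V \<alpha>" using assms by (auto simp: glued_def)
  have "\<phi> \<alpha> p = \<phi> \<alpha> q"
    using shift_self[OF \<alpha>(1,2)] assms by (simp add: glued_def shift_def)
  then show ?thesis using chart_eq_iff[OF \<alpha>(1), of p q] \<alpha> by simp
qed

lemma glued_near: "glued \<alpha> q \<beta> p \<Longrightarrow> near e q p"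
  using U_clU unfolding glued_def near_def by blast

lemma glued_sym:
  assumes g: "glued \<alpha> q \<beta> p"
  shows "glued \<beta> p \<alpha> q"
proof -
  have \<alpha>: "\<alpha> \<in> Idx" "\<beta> \<in> Idx" and q: "q \<in> U \<alpha>" "q \<in> V \<beta>" and p: "p \<in> U \<beta>" "p \<in> V \<alpha>"
    and s: "shift e \<alpha> (c \<alpha> \<beta>) q p" using g by (auto simp: glued_def)
  have pV: "p \<in> V \<beta>" and qV: "q \<in> V \<alpha>" using U_V \<alpha> p q by auto
  let ?t = "wave_transport \<A> \<alpha> \<beta> (c \<alpha> \<beta>)"
  have "shift e \<beta> ?t q p" by (rule shift_transport[OF \<alpha> s q(2) pV wave_section(1)[OF \<alpha>]])
  \<comment> \<open>The trivial shift by \<open>c \<beta> \<beta>\<close> is inserted because the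
    cocycle identity expresses \<open>c \<beta> \<alpha>\<close> as
    \<open>c \<beta> \<beta> - ?t\<close>.\<close>
  from shift_trans[OF shift_self[OF \<alpha>(2) p(1)] shift_uminus[OF this]]
  have "shift e \<beta> (c \<beta> \<beta> + - ?t) p q" .
  moreover have "c \<beta> \<beta> = c \<beta> \<alpha> + ?t"
    by (rule cocycle_eq[OF \<alpha>(2,1,2) pV p(2) pV])
  ultimately have "shift e \<beta> (c \<beta> \<alpha>) p q" by simp
  then show ?thesis using \<alpha> p q by (simp add: glued_def)
qed

text \<open>To add the two vectors, the second shift has to be read in chart
  \<open>\<alpha>\<close>, which requires \<open>r \<in> V \<alpha>\<close>; likewise
  \<open>q \<in> V \<gamma>\<close>. Each point is two moves from the other, as the first clause of
  \<open>small\<close> allows.\<close>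

lemma glued_trans:
  assumes g: "glued \<alpha> q \<beta> p" and h: "glued \<beta> p \<gamma> r"
  shows "glued \<alpha> q \<gamma> r"
proof -
  have \<alpha>: "\<alpha> \<in> Idx" "\<beta> \<in> Idx" "\<gamma> \<in> Idx" and q: "q \<in> U \<alpha>" "q \<in> V \<beta>" and p: "p \<in> U \<beta>" "p \<in> V \<alpha>" "p \<in> V \<gamma>"
    and r: "r \<in> U \<gamma>" "r \<in> V \<beta>"
    and s: "shift e \<alpha> (c \<alpha> \<beta>) q p" "shift e \<beta> (c \<beta> \<gamma>) p r"
    using g h by (auto simp: glued_def)
  have V: "q \<in> V \<alpha>" "p \<in> V \<beta>" "r \<in> V \<gamma>" using U_V \<alpha> p q r by auto
  have "r \<in> clU \<gamma>" "q \<in> clU \<alpha>" using U_clU \<alpha> q r by auto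
  then have far: "q \<in> V \<gamma>" "r \<in> V \<alpha>"
    using near_near_V[OF \<alpha>(3) _ glued_near[OF glued_sym[OF h]] glued_near[OF glued_sym[OF g]]]
      near_near_V[OF \<alpha>(1) _ glued_near[OF g] glued_near[OF h]] by auto
  have "shift e \<alpha> (wave_transport \<A> \<beta> \<alpha> (c \<beta> \<gamma>)) p r"
    by (rule shift_transport[OF \<alpha>(2,1) s(2) p(2) far(2) wave_section(1)[OF \<alpha>(2,3)]])
  from shift_trans[OF s(1) this] have "shift e \<alpha> (c \<alpha> \<gamma>) q r"
    by (simp add: cocycle_eq[OF \<alpha> V(1) q(2) far(1)])
  then show ?thesis using \<alpha> q r far by (simp add: glued_def)
qed

text \<open>All shifts of a point stay inside a single patch \<open>\<gamma>\<close>, where the gluing is not affected by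
  the boundaries of the patches \<open>\<alpha>\<close> and \<open>\<beta>\<close>.\<close>

lemma glued_via_common_patch:
  assumes g: "glued \<alpha> q \<beta> p"
  obtains \<gamma> r where "glued \<gamma> r \<alpha> q" "glued \<gamma> r \<beta> p" "q \<in> U \<gamma>" "p \<in> U \<gamma>"
proof -
  have \<alpha>: "\<alpha> \<in> Idx" and q: "q \<in> U \<alpha>" using g by (auto simp: glued_def)
  then have qX: "q \<in> topspace X" and qcl: "q \<in> clU \<alpha>" using cover U_clU by auto
  obtain \<gamma> where \<gamma>: "\<gamma> \<in> Idx" "q \<in> U \<gamma>" "\<And>p. near e q p \<Longrightarrow> p \<in> U \<gamma>"
    using common_patch[OF qX] by metis
  have qcl': "q \<in> clU \<gamma>" using \<gamma> U_clU by auto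
  \<comment> \<open>The partner of \<open>q\<close> in patch \<open>\<gamma>\<close>. Moving it to
    \<open>q\<close> or \<open>p\<close> ends inside \<open>U \<gamma>\<close>, the extra condition
    that the deformed gluing imposes.\<close>
  obtain r where r: "r \<in> V \<gamma>" "shift e \<alpha> (c \<alpha> \<gamma>) q r"
    using shift_exists[OF \<alpha> \<gamma>(1) qcl' qcl near_refl] by blast
  have "near e q r" using r \<alpha> \<gamma> qcl unfolding near_def by blast
  then have "glued \<alpha> q \<gamma> r"
    using \<alpha> \<gamma> q r U_V[OF \<gamma>(1)] by (auto simp: glued_def shift_def)
  then have *: "glued \<gamma> r \<alpha> q" by (rule glued_sym)
  show thesis
    by (rule that[OF * glued_trans[OF * g] \<gamma>(2) \<gamma>(3)[OF glued_near[OF g]]])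
qed

section \<open>Comparison with the relation generated by the deformed overlap maps\<close>

abbreviation "Z \<equiv> chart_sum \<A>"
abbreviation "R \<equiv> deformed_equiv \<A> c e"

lemma topspace_Z: "(\<alpha>, y) \<in> topspace Z \<longleftrightarrow> \<alpha> \<in> Idx \<and> y \<in> \<phi> \<alpha> ` U \<alpha>"
  by (auto simp: chart_sum_def)

lemma gluing_imp_glued:
  assumes g: "((\<alpha>, y), (\<beta>, z)) \<in> deformed_gluing \<A> c e"
  shows "\<exists>q p. y = \<phi> \<alpha> q \<and> z = \<phi> \<beta> p \<and> glued \<alpha> q \<beta> p"
proof -
  have Z: "(\<alpha>, y) \<in> topspace Z" "(\<beta>, z) \<in> topspace Z"
    and t: "translate y (rscale e (c \<alpha> \<beta>)) \<in> \<phi> \<alpha> ` (U \<alpha> \<inter> U \<beta>)"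
    and m: "maps_to (amb \<alpha>) (amb \<beta>) (deformed_overlap \<A> c e \<alpha> \<beta>) y z"
    using g by (auto simp: deformed_gluing_def)
  have \<alpha>: "\<alpha> \<in> Idx" "\<beta> \<in> Idx" using Z by (auto simp: topspace_Z)
  obtain q where q: "q \<in> U \<alpha>" "y = \<phi> \<alpha> q" using Z by (auto simp: topspace_Z)
  obtain p' where p': "p' \<in> U \<beta>" "z = \<phi> \<beta> p'" using Z by (auto simp: topspace_Z)
  obtain p where p: "p \<in> U \<alpha>" "p \<in> U \<beta>" "\<phi> \<alpha> p = translate y (rscale e (c \<alpha> \<beta>))" using t by auto
  have V: "q \<in> V \<alpha>" "p \<in> V \<alpha>" "p \<in> V \<beta>" "p' \<in> V \<beta>" using U_V \<alpha> p q p' by auto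
  have s: "shift e \<alpha> (c \<alpha> \<beta>) q p" using p V q by (simp add: shift_def)
  have "maps_to (amb \<alpha>) (amb \<beta>) (overlap \<A> \<alpha> \<beta>) (\<phi> \<alpha> p) z"
    using m maps_to_precompose[OF RN_rscale[OF wave_section(1)[OF \<alpha>]] chart_in_TN[OF \<alpha>(1) V(1)]] p q
    by (simp add: deformed_overlap_def)
  then have "z = \<phi> \<beta> p" using overlap_maps_to[OF \<alpha> V(2,3)] by (rule maps_to_unique)
  then have "p' = p" using p' chart_eq_iff[OF \<alpha>(2), of p' p] V by simp
  \<comment> \<open>Undoing the move in chart \<open>\<alpha>\<close> leads from \<open>p\<close>, a
    point of \<open>U \<beta>\<close>, to \<open>q\<close>; so \<open>q\<close> cannot have left
    \<open>V \<beta>\<close>.\<close>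
  have "p \<in> clU \<alpha>" "p \<in> clU \<beta>" using U_clU \<alpha> p by auto
  moreover have "near e p q" using \<alpha> shift_uminus[OF s] \<open>p \<in> clU \<alpha>\<close> unfolding near_def by blast
  ultimately have "q \<in> V \<beta>" using near_V \<alpha> by blast
  then have "glued \<alpha> q \<beta> p" using \<alpha> q p V s by (simp add: glued_def)
  then show ?thesis using q p' \<open>p' = p\<close> by blast
qed

lemma glued_maps_to:
  assumes g: "glued \<alpha> q \<beta> p"
  shows "maps_to (amb \<alpha>) (amb \<beta>) (deformed_overlap \<A> c e \<alpha> \<beta>) (\<phi> \<alpha> q) (\<phi> \<beta> p)"
proof -
  have \<alpha>: "\<alpha> \<in> Idx" "\<beta> \<in> Idx" and V: "q \<in> V \<alpha>" "p \<in> V \<alpha>" "p \<in> V \<beta>"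
    and s: "\<phi> \<alpha> p = translate (\<phi> \<alpha> q) (rscale e (c \<alpha> \<beta>))"
    using g U_V by (auto simp: glued_def shift_def)
  show ?thesis
    using overlap_maps_to[OF \<alpha> V(2,3)]
      maps_to_precompose[OF RN_rscale[OF wave_section(1)[OF \<alpha>]] chart_in_TN[OF \<alpha>(1) V(1)]] s
    by (simp add: deformed_overlap_def)
qed

lemma glued_imp_gluing:
  assumes g: "glued \<alpha> q \<beta> p" and p: "p \<in> U \<alpha>"
  shows "((\<alpha>, \<phi> \<alpha> q), (\<beta>, \<phi> \<beta> p)) \<in> deformed_gluing \<A> c e"
proof -
  have *: "\<alpha> \<in> Idx" "\<beta> \<in> Idx" "q \<in> U \<alpha>" "p \<in> U \<beta>" "translate (\<phi> \<alpha> q) (rscale e (c \<alpha> \<beta>)) = \<phi> \<alpha> p"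
    using g by (auto simp: glued_def shift_def)
  then have "(\<alpha>, \<phi> \<alpha> q) \<in> topspace Z" "(\<beta>, \<phi> \<beta> p) \<in> topspace Z"
    "translate (\<phi> \<alpha> q) (rscale e (c \<alpha> \<beta>)) \<in> \<phi> \<alpha> ` (U \<alpha> \<inter> U \<beta>)"
    using p by (auto simp: topspace_Z)
  then show ?thesis
    using glued_maps_to[OF g] unfolding deformed_gluing_def by blast
qed

definition glued_rel :: "('i \<times> (nat \<Rightarrow> ereal)) rel" where
  "glued_rel = {((\<alpha>, \<phi> \<alpha> q), (\<beta>, \<phi> \<beta> p)) | \<alpha> q \<beta> p. glued \<alpha> q \<beta> p}"

lemma glued_rel_iff:
  assumes "q \<in> U \<alpha>" "p \<in> U \<beta>" "\<alpha> \<in> Idx" "\<beta> \<in> Idx"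
  shows "((\<alpha>, \<phi> \<alpha> q), (\<beta>, \<phi> \<beta> p)) \<in> glued_rel \<longleftrightarrow> glued \<alpha> q \<beta> p"
proof
  assume "((\<alpha>, \<phi> \<alpha> q), (\<beta>, \<phi> \<beta> p)) \<in> glued_rel"
  then obtain q' p' where *: "\<phi> \<alpha> q = \<phi> \<alpha> q'" "\<phi> \<beta> p = \<phi> \<beta> p'" "glued \<alpha> q' \<beta> p'"
    by (auto simp: glued_rel_def)
  then have "q' \<in> V \<alpha>" "p' \<in> V \<beta>" "q \<in> V \<alpha>" "p \<in> V \<beta>" using U_V assms by (auto simp: glued_def)
  then show "glued \<alpha> q \<beta> p" using * chart_eq_iff assms by metis
qed (auto simp: glued_rel_def)

lemma trans_glued_rel: "trans glued_rel"
proof (rule transI)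
  fix x y z assume xy: "(x, y) \<in> glued_rel" and yz: "(y, z) \<in> glued_rel"
  obtain \<alpha> q \<beta> p where 1: "x = (\<alpha>, \<phi> \<alpha> q)" "y = (\<beta>, \<phi> \<beta> p)" "glued \<alpha> q \<beta> p"
    using xy by (auto simp: glued_rel_def)
  obtain p' \<gamma> r where 2: "y = (\<beta>, \<phi> \<beta> p')" "z = (\<gamma>, \<phi> \<gamma> r)" "glued \<beta> p' \<gamma> r"
    using yz 1 by (auto simp: glued_rel_def)
  have "\<beta> \<in> Idx" "p \<in> V \<beta>" "p' \<in> V \<beta>" using 1 2 U_V by (auto simp: glued_def)
  then have "p' = p" using 1 2 chart_eq_iff[of \<beta> p' p] by simp
  then have "glued \<alpha> q \<gamma> r" using glued_trans[OF 1(3)] 2(3) by simp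
  then show "(x, z) \<in> glued_rel" using 1 2 by (auto simp: glued_rel_def)
qed

lemma deformed_equiv_eq: "R = glued_rel"
proof
  have sub: "deformed_gluing \<A> c e \<union> (deformed_gluing \<A> c e)\<inverse> \<subseteq> glued_rel"
  proof -
    have "deformed_gluing \<A> c e \<subseteq> glued_rel"
      using gluing_imp_glued unfolding glued_rel_def by fast
    moreover have "glued_rel\<inverse> \<subseteq> glued_rel"
      using glued_sym unfolding glued_rel_def by fast
    ultimately show ?thesis by blast
  qed
  have "(deformed_gluing \<A> c e \<union> (deformed_gluing \<A> c e)\<inverse>)\<^sup>+ \<subseteq> glued_rel\<^sup>+"
    using trancl_mono[OF _ sub] by auto
  moreover have "Id_on (topspace Z) \<subseteq> glued_rel"
  proof (clarsimp simp: topspace_Z)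
    fix \<alpha> q assume "\<alpha> \<in> Idx" "q \<in> U \<alpha>"
    then show "((\<alpha>, \<phi> \<alpha> q), (\<alpha>, \<phi> \<alpha> q)) \<in> glued_rel"
      unfolding glued_rel_def using glued_refl by blast
  qed
  ultimately show "R \<subseteq> glued_rel"
    unfolding deformed_equiv_def by (simp add: trancl_id[OF trans_glued_rel])
  show "glued_rel \<subseteq> R"
  proof
    fix x assume "x \<in> glued_rel"
    then obtain \<alpha> q \<beta> p where x: "x = ((\<alpha>, \<phi> \<alpha> q), (\<beta>, \<phi> \<beta> p))" and g: "glued \<alpha> q \<beta> p"
      by (auto simp: glued_rel_def)
    obtain \<gamma> r where r: "glued \<gamma> r \<alpha> q" "glued \<gamma> r \<beta> p" "q \<in> U \<gamma>" "p \<in> U \<gamma>"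
      using glued_via_common_patch[OF g] .
    let ?G = "deformed_gluing \<A> c e \<union> (deformed_gluing \<A> c e)\<inverse>"
    \<comment> \<open>The first of the two steps runs against the gluing, from \<open>q\<close> back
      to \<open>r\<close>; the second runs along it.\<close>
    have "((\<alpha>, \<phi> \<alpha> q), (\<gamma>, \<phi> \<gamma> r)) \<in> ?G" using glued_imp_gluing[OF r(1,3)] by blast
    moreover have "((\<gamma>, \<phi> \<gamma> r), (\<beta>, \<phi> \<beta> p)) \<in> ?G" using glued_imp_gluing[OF r(2,4)] by blast
    ultimately have "x \<in> ?G\<^sup>+" unfolding x by (rule trancl_into_trancl[OF r_into_trancl])
    then show "x \<in> R" unfolding deformed_equiv_def by blast
  qed
qed

lemma R_iff:
  assumes "q \<in> U \<alpha>" "p \<in> U \<beta>" "\<alpha> \<in> Idx" "\<beta> \<in> Idx"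
  shows "((\<alpha>, \<phi> \<alpha> q), (\<beta>, \<phi> \<beta> p)) \<in> R \<longleftrightarrow> glued \<alpha> q \<beta> p"
  unfolding deformed_equiv_eq using glued_rel_iff[OF assms] .

lemma equiv_R: "equiv (topspace Z) R"
proof (rule equivI)
  show "R \<subseteq> topspace Z \<times> topspace Z"
    unfolding deformed_equiv_eq glued_rel_def by (auto simp: topspace_Z glued_def)
  show "refl_on (topspace Z) R"
    unfolding refl_on_def deformed_equiv_def by auto
  show "sym R"
    unfolding deformed_equiv_eq glued_rel_def using glued_sym by (intro symI) fast
  show "trans R" unfolding deformed_equiv_eq by (rule trans_glued_rel)
qed

text \<open>Smallness provides moved points for all \<open>q'\<close> near \<open>q\<close>, and
  continuity of the translation puts them into \<open>W\<close>. The point \<open>p\<close> only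
  witnesses that \<open>q\<close> is at most one move away from \<open>clU \<gamma>\<close>.\<close>

lemma shift_open:
  assumes \<alpha>: "\<alpha> \<in> Idx" "\<gamma> \<in> Idx" and q: "q \<in> clU \<alpha>" and p: "p \<in> clU \<gamma>" "near e p q"
    and r: "shift e \<alpha> (c \<alpha> \<gamma>) q r" "r \<in> W" and W: "openin X W"
  obtains G where "openin X G" "q \<in> G"
    "\<forall>q'\<in>G. q' \<in> V \<gamma> \<and> (\<exists>r'\<in>W. r' \<in> V \<alpha> \<and> shift e \<alpha> (c \<alpha> \<gamma>) q' r')"
proof -
  obtain G1 where G1: "openin X G1" "q \<in> G1" "\<forall>q'\<in>G1. \<exists>p'. p' \<in> V \<gamma> \<and> shift e \<alpha> (c \<alpha> \<gamma>) q' p'"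
    using shift_exists[OF \<alpha> p(1) q p(2)] by blast
  obtain Q where Q: "open Q" "\<phi> \<alpha> ` (W \<inter> V \<alpha>) = Y \<alpha> \<inter> Q"
    by (rule open_chart_image[OF \<alpha>(1) openin_Int[OF W openin_V[OF \<alpha>(1)]]]) auto
  let ?t = "\<lambda>y. translate y (rscale e (c \<alpha> \<gamma>))"
  have oQ: "open (?t -` Q)" using Q(1) continuous_on_translate by (rule open_vimage)
  let ?G = "G1 \<inter> V \<gamma> \<inter> {q' \<in> V \<alpha>. \<phi> \<alpha> q' \<in> ?t -` Q}"
  have "openin X ?G"
    by (intro openin_Int G1(1) openin_V[OF \<alpha>(2)] openin_chart_preimage[OF \<alpha>(1) oQ])
  moreover have "q \<in> ?G"
  proof -
    have "q \<in> V \<gamma>" using near_V[OF \<alpha>(2) p] .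
    moreover have "r \<in> V \<alpha>" "q \<in> V \<alpha>" "\<phi> \<alpha> r = ?t (\<phi> \<alpha> q)" using r(1) by (auto simp: shift_def)
    moreover have "\<phi> \<alpha> r \<in> Y \<alpha> \<inter> Q" unfolding Q(2)[symmetric] using r(2) \<open>r \<in> V \<alpha>\<close> by blast
    ultimately show ?thesis using G1(2) by simp
  qed
  moreover have "q' \<in> V \<gamma> \<and> (\<exists>r'\<in>W. r' \<in> V \<alpha> \<and> shift e \<alpha> (c \<alpha> \<gamma>) q' r')" if q': "q' \<in> ?G" for q'
  proof -
    obtain r' where r': "shift e \<alpha> (c \<alpha> \<gamma>) q' r'" using G1(3) q' by blast
    then have "r' \<in> V \<alpha>" "\<phi> \<alpha> r' = ?t (\<phi> \<alpha> q')" by (auto simp: shift_def)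
    then have "\<phi> \<alpha> r' \<in> \<phi> \<alpha> ` (W \<inter> V \<alpha>)" unfolding Q(2) using q' chart_in_Y[OF \<alpha>(1) \<open>r' \<in> V \<alpha>\<close>] by simp
    then have "r' \<in> W" using chart_eq_iff[OF \<alpha>(1)] \<open>r' \<in> V \<alpha>\<close> by auto
    then show ?thesis using r' \<open>r' \<in> V \<alpha>\<close> q' by blast
  qed
  ultimately show thesis using that by blast
qed

text \<open>The trace on the patch \<open>\<beta>\<close> of the saturation of \<open>W\<close>. By
  symmetry it consists of the points that a move in chart \<open>\<beta>\<close> carries into
  \<open>W\<close>, which is an open condition by \<open>shift_open\<close>.\<close>

lemma openin_glued:
  assumes \<alpha>: "\<alpha> \<in> Idx" "\<beta> \<in> Idx" and W: "openin X W" "W \<subseteq> U \<alpha>"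
  shows "openin X {p. \<exists>q\<in>W. glued \<alpha> q \<beta> p}"
proof (subst openin_subopen, intro ballI)
  fix p assume "p \<in> {p. \<exists>q\<in>W. glued \<alpha> q \<beta> p}"
  then obtain q where q: "q \<in> W" "glued \<alpha> q \<beta> p" by auto
  have g: "glued \<beta> p \<alpha> q" using q(2) by (rule glued_sym)
  have p: "p \<in> clU \<beta>" "p \<in> U \<beta>" "shift e \<beta> (c \<beta> \<alpha>) p q" "q \<in> clU \<alpha>" "q \<in> V \<beta>"
    using g U_clU by (auto simp: glued_def)
  have qW: "q \<in> W \<inter> V \<beta>" using q p by auto
  have oW: "openin X (W \<inter> V \<beta>)" using W openin_V[OF \<alpha>(2)] by auto
  obtain G where G: "openin X G" "p \<in> G"
    "\<forall>p'\<in>G. p' \<in> V \<alpha> \<and> (\<exists>q'\<in>W \<inter> V \<beta>. q' \<in> V \<beta> \<and> shift e \<beta> (c \<beta> \<alpha>) p' q')"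
    by (rule shift_open[OF \<alpha>(2,1) p(1) p(4) glued_near[OF q(2)] p(3) qW oW])
  have "\<exists>q'\<in>W. glued \<alpha> q' \<beta> p'" if p': "p' \<in> G" "p' \<in> U \<beta>" for p'
  proof -
    obtain q' where q': "q' \<in> W" "q' \<in> V \<beta>" "shift e \<beta> (c \<beta> \<alpha>) p' q'" using bspec[OF G(3) p'(1)] by blast
    moreover have "p' \<in> V \<alpha>" using bspec[OF G(3) p'(1)] by (rule conjunct1)
    ultimately have "glued \<beta> p' \<alpha> q'" using p'(2) W(2) \<alpha> by (auto simp: glued_def)
    then show ?thesis using q'(1) glued_sym by (intro bexI[of _ q'])
  qed
  then show "\<exists>T. openin X T \<and> p \<in> T \<and> T \<subseteq> {p. \<exists>q\<in>W. glued \<alpha> q \<beta> p}"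
    using G(1,2) p(2) openin_U[OF \<alpha>(2)] by (intro exI[of _ "G \<inter> U \<beta>"]) auto
qed

section \<open>The deformed space\<close>

abbreviation "D \<equiv> deformed_space \<A> c e"
abbreviation "\<B> \<equiv> deformed_atlas \<A> c e"

definition piece :: "'i \<Rightarrow> (nat \<Rightarrow> ereal) \<Rightarrow> ('i \<times> (nat \<Rightarrow> ereal)) set" where
  "piece \<alpha> y = R `` {(\<alpha>, y)}"

lemma atlas_simps:
  "index \<B> = Idx" "ambient \<B> = amb" "facets \<B> = facets \<A>" "overlap \<B> = deformed_overlap \<A> c e"
  "patch \<B> \<alpha> = piece \<alpha> ` \<phi> \<alpha> ` U \<alpha>"
  by (simp_all add: deformed_atlas_def piece_def)

lemma piece_eq_iff:
  assumes "\<alpha> \<in> Idx" "\<beta> \<in> Idx" "q \<in> U \<alpha>" "p \<in> U \<beta>"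
  shows "piece \<alpha> (\<phi> \<alpha> q) = piece \<beta> (\<phi> \<beta> p) \<longleftrightarrow> glued \<alpha> q \<beta> p"
proof -
  have "(\<alpha>, \<phi> \<alpha> q) \<in> topspace Z" "(\<beta>, \<phi> \<beta> p) \<in> topspace Z" using assms by (auto simp: topspace_Z)
  then show ?thesis
    unfolding piece_def using eq_equiv_class_iff[OF equiv_R] R_iff[OF assms(3,4,1,2)] by blast
qed

lemma piece_inj:
  assumes "\<alpha> \<in> Idx"
  shows "inj_on (piece \<alpha>) (\<phi> \<alpha> ` U \<alpha>)"
proof (rule inj_onI)
  fix y z assume "y \<in> \<phi> \<alpha> ` U \<alpha>" "z \<in> \<phi> \<alpha> ` U \<alpha>" and eq: "piece \<alpha> y = piece \<alpha> z"
  then obtain q p where qp: "q \<in> U \<alpha>" "p \<in> U \<alpha>" "y = \<phi> \<alpha> q" "z = \<phi> \<alpha> p" by blast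
  then have "glued \<alpha> q \<alpha> p" using eq piece_eq_iff[OF assms assms] by simp
  then show "y = z" using glued_same_patch[of \<alpha> q p] qp by simp
qed

lemma chart_piece:
  assumes \<alpha>: "\<alpha> \<in> Idx" and y: "y \<in> \<phi> \<alpha> ` U \<alpha>"
  shows "chart \<B> \<alpha> (piece \<alpha> y) = y"
proof -
  have "(THE z. z \<in> \<phi> \<alpha> ` U \<alpha> \<and> (\<alpha>, z) \<in> piece \<alpha> y) = y"
  proof (rule the_equality)
    have "(\<alpha>, y) \<in> topspace Z" using assms by (simp add: topspace_Z)
    then show "y \<in> \<phi> \<alpha> ` U \<alpha> \<and> (\<alpha>, y) \<in> piece \<alpha> y"
      using equiv_class_self[OF equiv_R] y unfolding piece_def by blast
    fix z assume z: "z \<in> \<phi> \<alpha> ` U \<alpha> \<and> (\<alpha>, z) \<in> piece \<alpha> y"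
    then have "piece \<alpha> y = piece \<alpha> z" unfolding piece_def using equiv_class_eq[OF equiv_R] by blast
    then show "z = y" using inj_onD[OF piece_inj[OF \<alpha>]] z y by metis
  qed
  then show ?thesis by (simp add: deformed_atlas_def)
qed

lemma topspace_D: "topspace D = (\<Union>\<alpha>\<in>Idx. piece \<alpha> ` \<phi> \<alpha> ` U \<alpha>)"
proof -
  have "topspace Z = Sigma Idx (\<lambda>\<alpha>. \<phi> \<alpha> ` U \<alpha>)" by (auto simp: topspace_Z)
  then show ?thesis
    unfolding deformed_space_def topspace_quotient_topology quotient_def piece_def by auto
qed

lemma quotient_map_D: "quotient_map Z D (\<lambda>z. R `` {z})"
  unfolding deformed_space_def by (rule quotient_map_quotient_topology)

lemma piece_continuous:
  assumes "\<alpha> \<in> Idx"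
  shows "continuous_map (top_of_set (\<phi> \<alpha> ` U \<alpha>)) D (piece \<alpha>)"
proof -
  have "continuous_map (top_of_set (\<phi> \<alpha> ` U \<alpha>)) Z (\<lambda>y. (\<alpha>, y))"
    unfolding chart_sum_def using assms by (rule continuous_map_component_injection)
  from continuous_map_compose[OF this quotient_imp_continuous_map[OF quotient_map_D]]
  show ?thesis by (simp add: o_def piece_def[abs_def])
qed

lemma openin_chart_U_preimage:
  assumes "\<alpha> \<in> Idx" "openin (top_of_set (\<phi> \<alpha> ` U \<alpha>)) S"
  shows "openin X {q \<in> U \<alpha>. \<phi> \<alpha> q \<in> S}"
proof -
  obtain Q where Q: "open Q" "S = \<phi> \<alpha> ` U \<alpha> \<inter> Q" using assms(2) by (auto simp: openin_open)
  have "{q \<in> U \<alpha>. \<phi> \<alpha> q \<in> S} = U \<alpha> \<inter> {x \<in> V \<alpha>. \<phi> \<alpha> x \<in> Q}" using Q(2) U_V[OF assms(1)] by auto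
  then show ?thesis
    using openin_Int[OF openin_U[OF assms(1)] openin_chart_preimage[OF assms(1) Q(1)]] by simp
qed

lemma openin_chart_U_image:
  assumes \<alpha>: "\<alpha> \<in> Idx" and W: "openin X W" "W \<subseteq> U \<alpha>"
  shows "openin (top_of_set (\<phi> \<alpha> ` U \<alpha>)) (\<phi> \<alpha> ` W)"
proof -
  obtain Q where Q: "open Q" "\<phi> \<alpha> ` W = Y \<alpha> \<inter> Q"
    by (rule open_chart_image[OF \<alpha> W(1)]) (use W(2) U_V[OF \<alpha>] in auto)
  have "\<phi> \<alpha> ` U \<alpha> \<subseteq> Y \<alpha>" using chart_in_Y[OF \<alpha>] U_V[OF \<alpha>] by blast
  moreover have "A = B \<inter> Q" if "A = C \<inter> Q" "A \<subseteq> B" "B \<subseteq> C" for A B C :: "(nat \<Rightarrow> ereal) set"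
    using that by blast
  ultimately have "\<phi> \<alpha> ` W = \<phi> \<alpha> ` U \<alpha> \<inter> Q" using Q(2) image_mono[OF W(2)] by metis
  then show ?thesis using Q(1) unfolding openin_open by blast
qed

lemma openin_chart_U:
  assumes \<alpha>: "\<alpha> \<in> Idx"
  shows "openin (top_of_set (Y \<alpha>)) (\<phi> \<alpha> ` U \<alpha>)"
proof -
  obtain Q where "open Q" "\<phi> \<alpha> ` U \<alpha> = Y \<alpha> \<inter> Q"
    by (rule open_chart_image[OF \<alpha> openin_U[OF \<alpha>] U_V[OF \<alpha>]])
  then show ?thesis unfolding openin_open by blast
qed

lemma piece_open:
  assumes \<alpha>: "\<alpha> \<in> Idx"
  shows "open_map (top_of_set (\<phi> \<alpha> ` U \<alpha>)) D (piece \<alpha>)"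
  unfolding open_map_def
proof (intro allI impI)
  fix S assume S: "openin (top_of_set (\<phi> \<alpha> ` U \<alpha>)) S"
  then have SU: "S \<subseteq> \<phi> \<alpha> ` U \<alpha>" by (simp add: openin_imp_subset)
  let ?W = "{q \<in> U \<alpha>. \<phi> \<alpha> q \<in> S}"
  have W: "openin X ?W" using openin_chart_U_preimage[OF \<alpha> S] .
  let ?P = "{z \<in> topspace Z. R `` {z} \<in> piece \<alpha> ` S}"
  \<comment> \<open>Openness in the quotient is openness of the saturation, checked on each summand
    of the disjoint union.\<close>
  have fibre: "{y. (\<beta>, y) \<in> ?P} = \<phi> \<beta> ` {p. \<exists>q\<in>?W. glued \<alpha> q \<beta> p}" if \<beta>: "\<beta> \<in> Idx" for \<beta>
  proof (intro equalityI subsetI)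
    fix y assume "y \<in> {y. (\<beta>, y) \<in> ?P}"
    then obtain p y' where p: "p \<in> U \<beta>" "y = \<phi> \<beta> p" and y': "y' \<in> S" "piece \<beta> y = piece \<alpha> y'"
      by (auto simp: topspace_Z piece_def)
    then obtain q where q: "q \<in> U \<alpha>" "y' = \<phi> \<alpha> q" using SU by blast
    then have "glued \<alpha> q \<beta> p" using piece_eq_iff[OF \<alpha> \<beta> q(1) p(1)] p y' by simp
    then show "y \<in> \<phi> \<beta> ` {p. \<exists>q\<in>?W. glued \<alpha> q \<beta> p}" using p y' q by blast
  next
    fix y assume "y \<in> \<phi> \<beta> ` {p. \<exists>q\<in>?W. glued \<alpha> q \<beta> p}"
    then obtain p q where p: "y = \<phi> \<beta> p" and q: "q \<in> U \<alpha>" "\<phi> \<alpha> q \<in> S" "glued \<alpha> q \<beta> p" by blast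
    have pU: "p \<in> U \<beta>" using q(3) by (simp add: glued_def)
    have "piece \<beta> y = piece \<alpha> (\<phi> \<alpha> q)" using piece_eq_iff[OF \<alpha> \<beta> q(1) pU] p q(3) by simp
    then show "y \<in> {y. (\<beta>, y) \<in> ?P}" using \<beta> p pU q(2) by (auto simp: topspace_Z piece_def)
  qed
  have "openin Z ?P"
    unfolding chart_sum_def openin_sum_topology
  proof (intro conjI ballI)
    show "{z \<in> topspace (sum_topology (\<lambda>\<alpha>. top_of_set (\<phi> \<alpha> ` U \<alpha>)) Idx). R `` {z} \<in> piece \<alpha> ` S}
        \<subseteq> Sigma Idx (topspace \<circ> (\<lambda>\<alpha>. top_of_set (\<phi> \<alpha> ` U \<alpha>)))"
      by auto
    fix \<beta> assume \<beta>: "\<beta> \<in> Idx"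
    have "openin (top_of_set (\<phi> \<beta> ` U \<beta>)) (\<phi> \<beta> ` {p. \<exists>q\<in>?W. glued \<alpha> q \<beta> p})"
      by (rule openin_chart_U_image[OF \<beta> openin_glued[OF \<alpha> \<beta> W]]) (auto simp: glued_def)
    then show "openin (top_of_set (\<phi> \<beta> ` U \<beta>))
        {y. (\<beta>, y) \<in> {z \<in> topspace (sum_topology (\<lambda>\<alpha>. top_of_set (\<phi> \<alpha> ` U \<alpha>)) Idx). R `` {z} \<in> piece \<alpha> ` S}}"
      using fibre[OF \<beta>] unfolding chart_sum_def by simp
  qed
  moreover have "piece \<alpha> ` S \<subseteq> topspace Z // R"
    using SU \<alpha> by (auto simp: piece_def topspace_Z intro!: quotientI)
  ultimately show "openin D (piece \<alpha> ` S)"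
    unfolding deformed_space_def openin_quotient_topology by blast
qed

lemma chart_homeomorphic:
  assumes \<alpha>: "\<alpha> \<in> Idx"
  shows "homeomorphic_map (subtopology D (patch \<B> \<alpha>)) (top_of_set (\<phi> \<alpha> ` U \<alpha>)) (chart \<B> \<alpha>)"
proof -
  have "embedding_map (top_of_set (\<phi> \<alpha> ` U \<alpha>)) D (piece \<alpha>)"
    using piece_continuous[OF \<alpha>] piece_open[OF \<alpha>] piece_inj[OF \<alpha>]
    by (intro injective_open_imp_embedding_map) auto
  then have "homeomorphic_map (top_of_set (\<phi> \<alpha> ` U \<alpha>)) (subtopology D (patch \<B> \<alpha>)) (piece \<alpha>)"
    by (simp add: embedding_map_def atlas_simps)
  then obtain g where g: "homeomorphic_maps (top_of_set (\<phi> \<alpha> ` U \<alpha>)) (subtopology D (patch \<B> \<alpha>)) (piece \<alpha>) g"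
    unfolding homeomorphic_map_maps by blast
  then have "homeomorphic_map (subtopology D (patch \<B> \<alpha>)) (top_of_set (\<phi> \<alpha> ` U \<alpha>)) g"
    by (simp add: homeomorphic_maps_map)
  then show ?thesis
  proof (rule homeomorphic_map_eq)
    fix x assume "x \<in> topspace (subtopology D (patch \<B> \<alpha>))"
    then obtain y where y: "y \<in> \<phi> \<alpha> ` U \<alpha>" "x = piece \<alpha> y" by (auto simp: atlas_simps)
    then have "g x = y" using g by (auto simp: homeomorphic_maps_def)
    then show "g x = chart \<B> \<alpha> x" using chart_piece[OF \<alpha> y(1)] y(2) by simp
  qed
qed

lemma patch_subset: "\<alpha> \<in> Idx \<Longrightarrow> patch \<B> \<alpha> \<subseteq> topspace D"
  by (auto simp: topspace_D atlas_simps)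

lemma deformed_charts: "tropical_charts D \<B>"
  unfolding tropical_charts_def
proof (intro conjI ballI)
  show "finite (index \<B>)" using finite_Idx by (simp add: atlas_simps)
  show "(\<Union>\<alpha>\<in>index \<B>. patch \<B> \<alpha>) = topspace D" by (simp add: topspace_D atlas_simps)
next
  fix \<alpha> assume "\<alpha> \<in> index \<B>"
  then have \<alpha>: "\<alpha> \<in> Idx" by (simp add: atlas_simps)
  show "openin D (patch \<B> \<alpha>)"
    using piece_open[OF \<alpha>] unfolding open_map_def atlas_simps by simp
  show "\<exists>n. polyhedral_complex (ambient \<B> \<alpha>) n (facets \<B> \<alpha>) \<and> balanced (ambient \<B> \<alpha>) n (facets \<B> \<alpha>)"
    using complex_balanced[OF \<alpha>] by (simp add: atlas_simps)
  note h = chart_homeomorphic[OF \<alpha>]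
  have top: "topspace (subtopology D (patch \<B> \<alpha>)) = patch \<B> \<alpha>" using patch_subset[OF \<alpha>] by auto
  have im: "chart \<B> \<alpha> ` patch \<B> \<alpha> = \<phi> \<alpha> ` U \<alpha>"
    using homeomorphic_imp_surjective_map[OF h] top by simp
  have UY: "\<phi> \<alpha> ` U \<alpha> \<subseteq> Y \<alpha>" using openin_chart_U[OF \<alpha>] openin_imp_subset by blast
  have "subtopology (top_of_set (\<Union>(facets \<B> \<alpha>))) (chart \<B> \<alpha> ` topspace (subtopology D (patch \<B> \<alpha>)))
      = top_of_set (\<phi> \<alpha> ` U \<alpha>)"
    unfolding top im atlas_simps(3) using UY by (simp add: subtopology_subtopology Int_absorb1)
  then show "embedding_map (subtopology D (patch \<B> \<alpha>)) (top_of_set (\<Union>(facets \<B> \<alpha>))) (chart \<B> \<alpha>)"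
    using h unfolding embedding_map_def by (simp only:)
  show "open_map (subtopology D (patch \<B> \<alpha>)) (top_of_set (\<Union>(facets \<B> \<alpha>))) (chart \<B> \<alpha>)"
    unfolding open_map_def
  proof (intro allI impI)
    fix S assume "openin (subtopology D (patch \<B> \<alpha>)) S"
    then have "openin (top_of_set (\<phi> \<alpha> ` U \<alpha>)) (chart \<B> \<alpha> ` S)"
      using homeomorphic_imp_open_map[OF h] by (simp add: open_map_def)
    then show "openin (top_of_set (\<Union>(facets \<B> \<alpha>))) (chart \<B> \<alpha> ` S)"
      unfolding atlas_simps using openin_chart_U[OF \<alpha>] by (rule openin_trans)
  qed
next
  fix \<alpha> \<beta> x assume "\<alpha> \<in> index \<B>" "\<beta> \<in> index \<B>" and x: "x \<in> patch \<B> \<alpha> \<inter> patch \<B> \<beta>"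
  then have \<alpha>: "\<alpha> \<in> Idx" "\<beta> \<in> Idx" by (simp_all add: atlas_simps)
  obtain q p where q: "q \<in> U \<alpha>" "x = piece \<alpha> (\<phi> \<alpha> q)" and p: "p \<in> U \<beta>" "x = piece \<beta> (\<phi> \<beta> p)"
    using x by (auto simp: atlas_simps)
  have "glued \<alpha> q \<beta> p" using piece_eq_iff[OF \<alpha> q(1) p(1)] q p by simp
  moreover have "chart \<B> \<alpha> x = \<phi> \<alpha> q"
    unfolding q(2) using q(1) by (intro chart_piece[OF \<alpha>(1)]) blast
  moreover have "chart \<B> \<beta> x = \<phi> \<beta> p"
    unfolding p(2) using p(1) by (intro chart_piece[OF \<alpha>(2)]) blast
  ultimately show "maps_to (ambient \<B> \<alpha>) (ambient \<B> \<beta>) (overlap \<B> \<alpha> \<beta>) (chart \<B> \<alpha> x) (chart \<B> \<beta> x)"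
    using glued_maps_to by (simp add: atlas_simps)
qed

section \<open>Finite type of the deformed space\<close>

lemma closed_chart_clU:
  assumes \<alpha>: "\<alpha> \<in> Idx"
  shows "closed (\<phi> \<alpha> ` clU \<alpha>)"
proof -
  have "compactin (subtopology X (V \<alpha>)) (clU \<alpha>)"
    using compactin_clU clU_V[OF \<alpha>] by (simp add: compactin_subtopology)
  then have "compactin (top_of_set (Y \<alpha>)) (\<phi> \<alpha> ` clU \<alpha>)"
    using chart_continuous[OF \<alpha>] by (rule image_compactin)
  then have "compactin euclidean (\<phi> \<alpha> ` clU \<alpha>)" by (simp add: compactin_subtopology)
  then have "closedin euclidean (\<phi> \<alpha> ` clU \<alpha>)" by (rule compactin_imp_closedin[OF Hausdorff_space_fun])
  then show ?thesis by simp
qed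

text \<open>The limit \<open>x\<close> may lie on the boundary of \<open>U \<alpha>\<close> and then
  has no class through chart \<open>\<alpha>\<close>. The limit in the quotient is the class of
  \<open>r\<close>, which is \<open>x\<close> moved by \<open>c \<alpha> \<gamma>\<close> into a
  patch \<open>\<gamma>\<close> containing it.\<close>

lemma sequence_limit:
  assumes \<alpha>: "\<alpha> \<in> Idx" and q: "\<And>k. q k \<in> U \<alpha>" and lim: "(\<lambda>k. \<phi> \<alpha> (q k)) \<longlonglongrightarrow> y"
  shows "\<exists>l. limitin D (\<lambda>k. piece \<alpha> (\<phi> \<alpha> (q k))) l sequentially"
proof -
  have "\<forall>\<^sub>F k in sequentially. \<phi> \<alpha> (q k) \<in> \<phi> \<alpha> ` clU \<alpha>"
    using q U_clU[OF \<alpha>] by (intro always_eventually) blast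
  then have "y \<in> \<phi> \<alpha> ` clU \<alpha>"
    using Lim_in_closed_set[OF closed_chart_clU[OF \<alpha>] _ _ lim] by simp
  then obtain x where x: "x \<in> clU \<alpha>" "y = \<phi> \<alpha> x" by blast
  have xV: "x \<in> V \<alpha>" using x(1) clU_V[OF \<alpha>] by blast
  then have xX: "x \<in> topspace X" using V_topspace[OF \<alpha>] by blast
  obtain \<gamma> where \<gamma>: "\<gamma> \<in> Idx" "x \<in> U \<gamma>" "\<And>p. near e x p \<Longrightarrow> p \<in> U \<gamma>"
    using common_patch[OF xX] by metis
  have xcl: "x \<in> clU \<gamma>" using \<gamma> U_clU by blast
  obtain r where r: "shift e \<alpha> (c \<alpha> \<gamma>) x r"
    using shift_exists[OF \<alpha> \<gamma>(1) xcl x(1) near_refl] by blast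
  have "near e x r" using r \<alpha> \<gamma>(1) x(1) unfolding near_def by blast
  then have rU: "r \<in> U \<gamma>" using \<gamma>(3) by blast
  have "limitin D (\<lambda>k. piece \<alpha> (\<phi> \<alpha> (q k))) (piece \<gamma> (\<phi> \<gamma> r)) sequentially"
    unfolding limitin_def
  proof (intro conjI allI impI)
    show "piece \<gamma> (\<phi> \<gamma> r) \<in> topspace D" using rU \<gamma>(1) by (auto simp: topspace_D)
    fix T assume T: "openin D T \<and> piece \<gamma> (\<phi> \<gamma> r) \<in> T"
    let ?S = "{y \<in> \<phi> \<gamma> ` U \<gamma>. piece \<gamma> y \<in> T}"
    have "openin (top_of_set (\<phi> \<gamma> ` U \<gamma>)) ?S"
      using openin_continuous_map_preimage[OF piece_continuous[OF \<gamma>(1)], of T] T by simp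
    then have oW: "openin X {r' \<in> U \<gamma>. \<phi> \<gamma> r' \<in> ?S}" by (rule openin_chart_U_preimage[OF \<gamma>(1)])
    have rW: "r \<in> {r' \<in> U \<gamma>. \<phi> \<gamma> r' \<in> ?S}" using rU T by blast
    obtain G where G: "openin X G" "x \<in> G" "\<forall>q'\<in>G. q' \<in> V \<gamma> \<and>
        (\<exists>r'\<in>{r' \<in> U \<gamma>. \<phi> \<gamma> r' \<in> ?S}. r' \<in> V \<alpha> \<and> shift e \<alpha> (c \<alpha> \<gamma>) q' r')"
      by (rule shift_open[OF \<alpha> \<gamma>(1) x(1) xcl near_refl r rW oW])
    obtain Q where Q: "open Q" "\<phi> \<alpha> ` (G \<inter> V \<alpha>) = Y \<alpha> \<inter> Q"
      by (rule open_chart_image[OF \<alpha> openin_Int[OF G(1) openin_V[OF \<alpha>]]]) auto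
    have "y \<in> \<phi> \<alpha> ` (G \<inter> V \<alpha>)" unfolding x(2) using xV G(2) by (intro imageI IntI)
    then have "y \<in> Q" unfolding Q(2) by (rule IntD2)
    then have "\<forall>\<^sub>F k in sequentially. \<phi> \<alpha> (q k) \<in> Q" using lim Q(1) by (intro topological_tendstoD)
    then show "\<forall>\<^sub>F k in sequentially. piece \<alpha> (\<phi> \<alpha> (q k)) \<in> T"
    proof eventually_elim
      case (elim k)
      have qV: "q k \<in> V \<alpha>" using q U_V[OF \<alpha>] by blast
      have "\<phi> \<alpha> (q k) \<in> \<phi> \<alpha> ` (G \<inter> V \<alpha>)" unfolding Q(2) using elim chart_in_Y[OF \<alpha> qV] by blast
      then have "q k \<in> G" using chart_eq_iff[OF \<alpha>] qV by auto
      then obtain r' where r': "q k \<in> V \<gamma>" "r' \<in> U \<gamma>" "piece \<gamma> (\<phi> \<gamma> r') \<in> T" "r' \<in> V \<alpha>" "shift e \<alpha> (c \<alpha> \<gamma>) (q k) r'"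
        using G(3) by blast
      \<comment> \<open>The moved points \<open>r'\<close> represent the classes of the
        \<open>q k\<close> in patch \<open>\<gamma>\<close>, where convergence can be
        tested.\<close>
      then have "glued \<alpha> (q k) \<gamma> r'" using \<alpha> \<gamma>(1) q by (simp add: glued_def)
      then have "piece \<alpha> (\<phi> \<alpha> (q k)) = piece \<gamma> (\<phi> \<gamma> r')"
        using piece_eq_iff[OF \<alpha> \<gamma>(1) q r'(2)] by blast
      then show ?case using r'(3) by simp
    qed
  qed
  then show ?thesis by blast
qed

text \<open>The first alternative always holds: by compactness, a sequence that converges in the
  ambient space also converges in the deformed space.\<close>

lemma deformed_finite_type: "finite_type D \<B>"
  unfolding finite_type_def
proof (intro ballI allI impI disjI1)
  fix \<alpha> and s :: "nat \<Rightarrow> ('i \<times> (nat \<Rightarrow> ereal)) set" and y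
  assume "\<alpha> \<in> index \<B>" and s: "range s \<subseteq> patch \<B> \<alpha> \<and> (\<lambda>k. chart \<B> \<alpha> (s k)) \<longlonglongrightarrow> y"
  then have \<alpha>: "\<alpha> \<in> Idx" by (simp add: atlas_simps)
  have "\<forall>k. \<exists>q. q \<in> U \<alpha> \<and> s k = piece \<alpha> (\<phi> \<alpha> q)" using s by (auto simp: atlas_simps)
  then obtain q where q: "\<And>k. q k \<in> U \<alpha>" "\<And>k. s k = piece \<alpha> (\<phi> \<alpha> (q k))" by metis
  have "chart \<B> \<alpha> (s k) = \<phi> \<alpha> (q k)" for k unfolding q(2) using q(1) by (intro chart_piece[OF \<alpha>]) blast
  then have "(\<lambda>k. \<phi> \<alpha> (q k)) \<longlonglongrightarrow> y" using s by simp
  from sequence_limit[OF \<alpha> q(1) this] show "\<exists>l. limitin D s l sequentially"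
    by (simp add: q(2)[abs_def, symmetric])
qed

lemma deformed_tropical_space: "tropical_space D \<B>"
  unfolding tropical_space_def using deformed_charts deformed_finite_type by blast

end

theorem proposition3p7:
  fixes X :: "'x topology" and \<A> :: "('i, 'x) atlas"
    and V :: "'i \<Rightarrow> 'x set"
    and \<tau> :: "('i \<Rightarrow> 'i \<Rightarrow> nat \<Rightarrow> real) set" and c :: "'i \<Rightarrow> 'i \<Rightarrow> nat \<Rightarrow> real"
  assumes "tropical_space X \<A>"
    and "compact_space X"
    and "connected_overlaps X \<A>"
    and "slightly_larger X \<A> V"
    and "\<tau> \<in> wave_H1 \<A>"
    and "c \<in> \<tau>"
  shows "\<forall>\<^sub>F \<epsilon> in at_right (0::real).
           tropical_space (deformed_space \<A> c \<epsilon>) (deformed_atlas \<A> c \<epsilon>)"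
proof -
  have "wave_cocycle \<A> c"
    using assms(5,6) by (auto simp: wave_H1_def quotient_def)
  with assms(1,2,4) interpret thickened_atlas X \<A> V c
    by unfold_locales
  show ?thesis
    using eventually_small
  proof eventually_elim
    case (elim e)
    interpret small_deformation X \<A> V c e
      by unfold_locales (rule elim)
    show ?case by (rule deformed_tropical_space)
  qed
qed

end
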